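(* There exists a constant $C>0$ such that, for every $A\in H^1(\mathbb{R})$ and every $f\in L^\infty(\mathbb{R})$, $$\big\|[|D_x|,A]f\big\|_{L^2}\le C\,\|A\|_{H^1}\,\|f\|_{L^\infty}.$$
   Context: $|D_x|$ is the Fourier multiplier with symbol $|\xi|$ on $\mathbb{R}$, and $[|D_x|,A]f=|D_x|(Af)-A\,|D_x|f$, where $A$ acts by multiplication and the terms are understood as distributions (by duality). *)

theory Defs
  imports "HOL-Probability.Probability"
begin

text \<open>Elements of Lebesgue and Sobolev spaces are represented by functions rather than by classes
  modulo almost-everywhere equality. Functions are complex-valued, and the Fourier transform is
  normalised as \<open>\<integral> exp (-\<i> x \<xi>) \<phi>(x) dx\<close>, so that \<open>D\<^sub>x = -\<i> d/dx\<close> has symbol \<open>\<xi>\<close>.\<close>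

definition L2 :: "(real \<Rightarrow> complex) set" where
  "L2 = {f \<in> borel_measurable lebesgue. integrable lebesgue (\<lambda>x. (norm (f x))\<^sup>2)}"

definition L2_norm :: "(real \<Rightarrow> complex) \<Rightarrow> real" where
  "L2_norm f = sqrt (LINT x|lebesgue. (norm (f x))\<^sup>2)"

definition Linf :: "(real \<Rightarrow> complex) set" where
  "Linf = {f \<in> borel_measurable lebesgue. esssup lebesgue (\<lambda>x. ereal (norm (f x))) < \<infinity>}"

definition Linf_norm :: "(real \<Rightarrow> complex) \<Rightarrow> real" where
  "Linf_norm f = real_of_ereal (esssup lebesgue (\<lambda>x. ereal (norm (f x))))"

definition vderiv :: "(real \<Rightarrow> complex) \<Rightarrow> real \<Rightarrow> complex" where
  "vderiv \<phi> = (\<lambda>x. vector_derivative \<phi> (at x))"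

definition schwartz :: "(real \<Rightarrow> complex) set" where
  "schwartz = {\<phi>. \<forall>k m :: nat. (\<forall>x. (vderiv ^^ k) \<phi> differentiable (at x)) \<and>
     bounded (range (\<lambda>x. x ^ m *\<^sub>R (vderiv ^^ k) \<phi> x))}"

text \<open>Derivative in the sense of tempered distributions, for functions in \<open>L\<^sup>2\<close>.\<close>

definition has_weak_deriv :: "(real \<Rightarrow> complex) \<Rightarrow> (real \<Rightarrow> complex) \<Rightarrow> bool" where
  "has_weak_deriv A B \<longleftrightarrow> A \<in> L2 \<and> B \<in> L2 \<and>
     (\<forall>\<phi>\<in>schwartz. (LINT x|lebesgue. B x * \<phi> x) = - (LINT x|lebesgue. A x * vderiv \<phi> x))"

definition H1 :: "(real \<Rightarrow> complex) set" where
  "H1 = {A. \<exists>B. has_weak_deriv A B}"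

text \<open>The weak derivative is unique only up to null sets, which the norm does not see.\<close>

definition H1_norm :: "(real \<Rightarrow> complex) \<Rightarrow> real" where
  "H1_norm A = sqrt ((L2_norm A)\<^sup>2 + (L2_norm (SOME B. has_weak_deriv A B))\<^sup>2)"

definition fourier :: "(real \<Rightarrow> complex) \<Rightarrow> real \<Rightarrow> complex" where
  "fourier \<phi> \<xi> = (LINT x|lebesgue. cis (- (x * \<xi>)) * \<phi> x)"

text \<open>The Fourier transform on \<open>L\<^sup>2\<close>, where the defining integral need not converge, is the one of
  tempered distributions, defined by duality; \<open>U\<close> is determined by \<open>u\<close> almost everywhere.\<close>

definition has_fourier_L2 :: "(real \<Rightarrow> complex) \<Rightarrow> (real \<Rightarrow> complex) \<Rightarrow> bool" where
  "has_fourier_L2 u U \<longleftrightarrow> u \<in> L2 \<and> U \<in> L2 \<and>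
     (\<forall>\<phi>\<in>schwartz. (LINT \<xi>|lebesgue. U \<xi> * \<phi> \<xi>) = (LINT x|lebesgue. u x * fourier \<phi> x))"

text \<open>\<open>has_absD u h\<close>: \<open>h = |D\<^sub>x| u\<close> in \<open>L\<^sup>2\<close>. Such an \<open>h\<close> exists exactly for \<open>u\<close> in \<open>H\<^sup>1\<close>, and is then
  unique almost everywhere.\<close>

definition has_absD :: "(real \<Rightarrow> complex) \<Rightarrow> (real \<Rightarrow> complex) \<Rightarrow> bool" where
  "has_absD u h \<longleftrightarrow>
     (\<exists>U. has_fourier_L2 u U \<and> has_fourier_L2 h (\<lambda>\<xi>. complex_of_real \<bar>\<xi>\<bar> * U \<xi>))"

text \<open>\<open>has_absD_pairing u \<psi> c\<close>: the duality pairing \<open>\<langle>|D\<^sub>x| u, \<psi>\<rangle> := \<integral> u |D\<^sub>x|\<psi>\<close> is defined, with value \<open>c\<close>.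
  The pairing is bilinear (no complex conjugation); \<open>|D\<^sub>x|\<close> is its own transpose because its symbol
  is even.\<close>

definition has_absD_pairing ::
    "(real \<Rightarrow> complex) \<Rightarrow> (real \<Rightarrow> complex) \<Rightarrow> complex \<Rightarrow> bool" where
  "has_absD_pairing u \<psi> c \<longleftrightarrow>
     (\<exists>h. has_absD \<psi> h \<and> has_bochner_integral lebesgue (\<lambda>x. u x * h x) c)"

text \<open>\<open>has_absD_commutator A f g\<close>: the distribution \<open>[|D\<^sub>x|, A] f = |D\<^sub>x|(A f) - A |D\<^sub>x| f\<close> is defined and
  is the \<open>L\<^sup>2\<close> function \<open>g\<close>. The second term is tested by moving the multiplication onto the
  test function: \<open>\<langle>A |D\<^sub>x| f, \<phi>\<rangle> = \<langle>|D\<^sub>x| f, A \<phi>\<rangle>\<close>, where \<open>A \<phi>\<close> is in general no longer Schwartz.\<close>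

definition has_absD_commutator ::
    "(real \<Rightarrow> complex) \<Rightarrow> (real \<Rightarrow> complex) \<Rightarrow> (real \<Rightarrow> complex) \<Rightarrow> bool" where
  "has_absD_commutator A f g \<longleftrightarrow> g \<in> L2 \<and>
     (\<forall>\<phi>\<in>schwartz. \<exists>a b. has_absD_pairing (\<lambda>x. A x * f x) \<phi> a \<and>
        has_absD_pairing f (\<lambda>x. A x * \<phi> x) b \<and>
        (LINT x|lebesgue. g x * \<phi> x) = a - b)"

end

theory Submission
  imports Defs
begin

text \<open>By duality it suffices to bound the \<open>L\<^sup>1\<close> norm of \<open>A |D| \<phi> - |D| (A \<phi>)\<close> by \<open>\<parallel>A'\<parallel>\<^sub>2 \<parallel>\<phi>\<parallel>\<^sub>2\<close>, that is, to
  bound the trilinear form in \<open>A\<close>, \<open>\<phi>\<close> and a bounded \<open>f\<close> with symbol \<open>r - q\<close>, where \<open>p, q, r\<close> are the moduli of the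
  frequencies \<open>\<xi>, \<eta>, \<zeta>\<close> of \<open>A, \<phi>, f\<close> and \<open>\<xi> + \<eta> + \<zeta> = 0\<close>. With \<open>s = p + q + r\<close>, the product \<open>(r - q) s\<^sup>2\<close> is a combination of
  \<open>p\<^sup>2 r\<close>, \<open>p\<^sup>2 q\<close>, \<open>p q r\<close> up to signs of the frequencies, and \<open>1 / s\<^sup>2 = \<integral> y exp (- y s) dy\<close> turns each term into an integral
  over the half plane, with weight \<open>y\<close>, of three harmonic extensions, at least two of them differentiated. Whenever the
  extension \<open>u\<close> of \<open>f\<close> is not differentiated, it is bounded and the other two factors are square functions. Otherwise one
  needs the Carleson embedding \<open>\<integral>\<integral> y |\<nabla> u|\<^sup>2 |w|\<^sup>2 \<le> C \<parallel>f\<parallel>\<^sup>2 \<parallel>w\<parallel>\<^sup>2\<close>, which for bounded \<open>f\<close> follows from Green's formula for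
  \<open>|u|\<^sup>2 |w|\<^sup>2\<close>, whose Laplacian is \<open>2 |\<nabla> u|\<^sup>2 |w|\<^sup>2\<close> up to terms controlled by \<open>|u|\<^sup>2 |\<nabla> w|\<^sup>2\<close>.\<close>

section \<open>Square-integrable functions\<close>

text \<open>The pointwise bound |r - q| \<le> p does not suffice: the supremum of f cannot be read
  off the size of its Fourier transform, and the Hilbert transform does not preserve boundedness, so
  f may enter only through its Poisson extension. Each monomial of (r - q) s^2 has degree three and
  contains \<xi>: one factor \<xi> is spent on the norm of A', and the other two frequencies are the
  two derivatives that the weight y of a square function balances. The estimate is first proved for
  integrable bounded f, with constants that see only the supremum M; truncation then gives all
  bounded f. The constant: with N = 2 pi M, Green's formula yields 22 pi N^2 = (6 + 16) pi N^2, from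
  boundary values and absorbed cross terms. Together with the square function constant pi / 2,
  crudely raised to 22 pi, each term costs 22 pi N, divided by 2 pi in the passage to the half
  plane. Six terms with coefficient 2 make 12 * 11 * 2 pi M = 264 pi M; the normalisation 1 / (4
  pi^2) and the Plancherel factor 2 pi turn this into 132 M.\<close>

definition sq_int :: "(real \<Rightarrow> complex) \<Rightarrow> bool" where
  "sq_int f \<longleftrightarrow> f \<in> borel_measurable borel \<and> integrable lborel (\<lambda>x. (norm (f x))\<^sup>2)"

definition n2 :: "(real \<Rightarrow> complex) \<Rightarrow> real" where
  "n2 f = (LINT x|lborel. (norm (f x))\<^sup>2)"

lemma sq_int_measurable [measurable_dest]: "sq_int f \<Longrightarrow> f \<in> borel_measurable borel"
  by (simp add: sq_int_def)

lemma sq_int_integrable: "sq_int f \<Longrightarrow> integrable lborel (\<lambda>x. (norm (f x))\<^sup>2)"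
  by (simp add: sq_int_def)

lemma n2_nonneg [simp]: "0 \<le> n2 f"
  by (simp add: n2_def)

lemma nn_integral_n2: "sq_int f \<Longrightarrow> (\<integral>\<^sup>+x. ennreal ((norm (f x))\<^sup>2) \<partial>lborel) = ennreal (n2 f)"
  unfolding n2_def by (intro nn_integral_eq_integral) (auto simp: sq_int_def)

lemma sq_intI_nn:
  assumes [measurable]: "f \<in> borel_measurable borel"
    and "(\<integral>\<^sup>+x. ennreal ((norm (f x))\<^sup>2) \<partial>lborel) \<le> ennreal C" "0 \<le> C"
  shows "sq_int f" "n2 f \<le> C"
proof -
  have "integrable lborel (\<lambda>x. (norm (f x))\<^sup>2)"
    using assms(2) by (intro integrableI_nonneg) (auto simp: top_unique less_top[symmetric])
  then show 1: "sq_int f" by (simp add: sq_int_def)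
  show "n2 f \<le> C" using assms(2) unfolding nn_integral_n2[OF 1] by (simp add: \<open>0 \<le> C\<close>)
qed

lemma sq_int_bound:
  assumes [measurable]: "f \<in> borel_measurable borel" and "integrable lborel g"
    and "\<And>x. (norm (f x))\<^sup>2 \<le> g x"
  shows "sq_int f"
  unfolding sq_int_def
  by (intro conjI assms(1) Bochner_Integration.integrable_bound[OF assms(2)])
     (auto intro!: AE_I2 order_trans[OF assms(3)])

lemma sq_int_mono:
  assumes "f \<in> borel_measurable borel" and "sq_int g" and "\<And>x. norm (f x) \<le> norm (g x)"
  shows "sq_int f"
  using assms by (intro sq_int_bound[OF assms(1) sq_int_integrable[OF assms(2)]]) (auto intro: power_mono)

lemma n2_mono:
  assumes "f \<in> borel_measurable borel" and "sq_int g" and "\<And>x. norm (f x) \<le> norm (g x)"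
  shows "n2 f \<le> n2 g"
  unfolding n2_def
  by (intro integral_mono sq_int_integrable assms(2) sq_int_mono[OF assms]) (auto intro: power_mono assms)

lemma sq_int_add [intro]:
  assumes "sq_int f" "sq_int g" shows "sq_int (\<lambda>x. f x + g x)"
proof (rule sq_int_bound)
  show "(\<lambda>x. f x + g x) \<in> borel_measurable borel" using assms by (auto simp: sq_int_def)
  show "integrable lborel (\<lambda>x. 2 * (norm (f x))\<^sup>2 + 2 * (norm (g x))\<^sup>2)"
    using assms by (auto simp: sq_int_def)
  show "(norm (f x + g x))\<^sup>2 \<le> 2 * (norm (f x))\<^sup>2 + 2 * (norm (g x))\<^sup>2" for x
  proof -
    have "(norm (f x + g x))\<^sup>2 \<le> (norm (f x) + norm (g x))\<^sup>2"
      by (intro power_mono norm_triangle_ineq) auto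
    also have "\<dots> \<le> 2 * (norm (f x))\<^sup>2 + 2 * (norm (g x))\<^sup>2"
      using zero_le_power2[of "norm (f x) - norm (g x)"] by (simp add: power2_eq_square algebra_simps)
    finally show ?thesis .
  qed
qed

lemma sq_int_cmult [intro]: "sq_int f \<Longrightarrow> sq_int (\<lambda>x. c * f x)"
  by (auto simp: sq_int_def norm_mult power_mult_distrib)

lemma n2_cmult: "n2 (\<lambda>x. c * f x) = (norm c)\<^sup>2 * n2 f"
  by (auto simp: n2_def norm_mult power_mult_distrib)

lemma sq_int_diff [intro]:
  assumes "sq_int f" "sq_int g" shows "sq_int (\<lambda>x. f x - g x)"
  using sq_int_add[OF assms(1) sq_int_cmult[OF assms(2), of "-1"]] by simp

lemma sq_int_cnj [intro]: "sq_int f \<Longrightarrow> sq_int (\<lambda>x. cnj (f x))"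
  using measurable_compose[OF _ borel_measurable_continuous_onI[OF continuous_on_cnj[OF continuous_on_id]]]
  by (auto simp: sq_int_def)

lemma n2_cnj: "n2 (\<lambda>x. cnj (f x)) = n2 f"
  by (auto simp: n2_def)

lemma sq_int_bounded_mult:
  assumes "sq_int f" "g \<in> borel_measurable borel" "\<And>x. norm (g x) \<le> C"
  shows "sq_int (\<lambda>x. g x * f x)"
proof (rule sq_int_mono[OF _ sq_int_cmult[OF assms(1), of "complex_of_real C"]])
  show "(\<lambda>x. g x * f x) \<in> borel_measurable borel" using assms by (auto simp: sq_int_def)
  have "0 \<le> C" using assms(3)[of 0] norm_ge_zero order_trans by blast
  then show "norm (g x * f x) \<le> norm (complex_of_real C * f x)" for x
    by (simp add: norm_mult mult_right_mono assms(3))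
qed

lemma sq_int_mult_integrable:
  assumes "sq_int f" "sq_int g" shows "integrable lborel (\<lambda>x. f x * g x)"
proof (rule Bochner_Integration.integrable_bound)
  show "integrable lborel (\<lambda>x. (norm (f x))\<^sup>2 + (norm (g x))\<^sup>2)"
    using assms by (auto simp: sq_int_def)
  show "(\<lambda>x. f x * g x) \<in> borel_measurable lborel" using assms by (auto simp: sq_int_def)
  have "a * b \<le> a\<^sup>2 + b\<^sup>2" for a b :: real
    using sum_squares_bound[of a b] zero_le_power2[of a] zero_le_power2[of b] by linarith
  then show "AE x in lborel. norm (f x * g x) \<le> norm ((norm (f x))\<^sup>2 + (norm (g x))\<^sup>2)"
    by (auto simp: norm_mult)
qed

section \<open>Cauchy-Schwarz, completeness and Riesz representation in L^2\<close>

lemma Cauchy_Schwarz_L2_abs: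
  assumes "sq_int f" "sq_int g"
  shows "(LINT x|lborel. norm (f x) * norm (g x)) \<le> sqrt (n2 f) * sqrt (n2 g)"
proof -
  define I where "I = (LINT x|lborel. norm (f x) * norm (g x))"
  have [measurable]: "f \<in> borel_measurable borel" "g \<in> borel_measurable borel"
    using assms by (auto simp: sq_int_def)
  have int: "integrable lborel (\<lambda>x. norm (f x) * norm (g x))"
    using integrable_norm[OF sq_int_mult_integrable[OF assms]] by (simp add: norm_mult)
  have I0: "0 \<le> I" unfolding I_def by simp
  have "(\<integral>\<^sup>+x. ennreal (norm (f x)) * ennreal (norm (g x)) \<partial>lborel)\<^sup>2
      \<le> (\<integral>\<^sup>+x. ennreal (norm (f x)) ^ 2 \<partial>lborel) * (\<integral>\<^sup>+x. ennreal (norm (g x)) ^ 2 \<partial>lborel)"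
    by (intro Cauchy_Schwarz_nn_integral) auto
  also have "\<dots> = ennreal (n2 f * n2 g)"
    using nn_integral_n2[OF assms(1)] nn_integral_n2[OF assms(2)] by (simp add: ennreal_power ennreal_mult)
  also have "(\<integral>\<^sup>+x. ennreal (norm (f x)) * ennreal (norm (g x)) \<partial>lborel) = ennreal I"
    unfolding I_def using nn_integral_eq_integral[OF int] by (simp add: ennreal_mult)
  finally have "I\<^sup>2 \<le> n2 f * n2 g"
    by (simp add: ennreal_power I0)
  then have "I \<le> sqrt (n2 f * n2 g)"
    by (rule real_le_rsqrt)
  then show ?thesis by (simp add: I_def real_sqrt_mult)
qed

lemma Cauchy_Schwarz_L2:
  assumes "sq_int f" "sq_int g"
  shows "norm (LINT x|lborel. f x * g x) \<le> sqrt (n2 f) * sqrt (n2 g)"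
  using integral_norm_bound[of lborel "\<lambda>x. f x * g x"] Cauchy_Schwarz_L2_abs[OF assms]
  by (simp add: norm_mult)

lemma n2_add:
  assumes "sq_int f" "sq_int g"
  shows "n2 (\<lambda>x. f x + g x) = n2 f + n2 g + 2 * Re (LINT x|lborel. cnj (f x) * g x)"
proof -
  have *: "(norm (a + b))\<^sup>2 = (norm a)\<^sup>2 + (norm b)\<^sup>2 + 2 * Re (cnj a * b)" for a b :: complex
    unfolding cmod_power2 by (simp add: power2_eq_square algebra_simps)
  define k where "k = (\<lambda>x. cnj (f x) * g x)"
  have int: "integrable lborel k"
    unfolding k_def by (intro sq_int_mult_integrable sq_int_cnj assms)
  have "(LINT x|lborel. (norm (f x))\<^sup>2 + (norm (g x))\<^sup>2 + 2 * Re (k x)) = n2 f + n2 g + 2 * Re (LINT x|lborel. k x)"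
    using assms int by (simp add: n2_def sq_int_def)
  then show ?thesis by (simp add: n2_def[of "\<lambda>x. f x + g x"] * k_def del: times_complex.sel)
qed

text \<open>Geometric decay of the squared steps leaves room for the weights 2^i: the sum of 2^i
  times the i-th squared step is still integrable, and the sequence is Cauchy wherever this sum is
  finite. The same estimate gives the rate of convergence in norm.\<close>

lemma L2_complete:
  assumes phi: "\<And>n. sq_int (\<phi> n)"
    and close: "\<And>n. n2 (\<lambda>x. \<phi> (Suc n) x - \<phi> n x) \<le> C * (1/4) ^ n"
  shows "\<exists>G. sq_int G \<and> (\<lambda>n. n2 (\<lambda>x. G x - \<phi> n x)) \<longlonglongrightarrow> 0"
proof -
  have [measurable]: "\<phi> n \<in> borel_measurable borel" for n using phi by (auto simp: sq_int_def)
  have C: "0 \<le> C" using order_trans[OF n2_nonneg close[of 0]] by simp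
  define a where "a = (\<lambda>n x. norm (\<phi> (Suc n) x - \<phi> n x))"
  have [measurable]: "a n \<in> borel_measurable borel" for n unfolding a_def by measurable
  define H where "H = (\<lambda>x. \<Sum>i. ennreal (2 ^ i * (a i x)\<^sup>2))"
  have [measurable]: "H \<in> borel_measurable borel" unfolding H_def by measurable
  have "(\<integral>\<^sup>+x. H x \<partial>lborel) = (\<Sum>i. \<integral>\<^sup>+x. ennreal (2 ^ i * (a i x)\<^sup>2) \<partial>lborel)"
    unfolding H_def by (intro nn_integral_suminf) auto
  also have "\<dots> \<le> (\<Sum>i. ennreal (C * (1/2) ^ i))"
  proof (intro suminf_le)
    fix i
    have "(\<integral>\<^sup>+x. ennreal (2 ^ i * (a i x)\<^sup>2) \<partial>lborel) = ennreal (2 ^ i * n2 (\<lambda>x. \<phi> (Suc i) x - \<phi> i x))"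
      using nn_integral_n2[OF sq_int_diff[OF phi phi, of "Suc i" i]]
      by (simp add: a_def ennreal_mult nn_integral_cmult)
    also have "\<dots> \<le> ennreal (2 ^ i * (C * (1/4) ^ i))"
      by (intro ennreal_leI mult_left_mono close) auto
    also have "2 ^ i * (C * (1/4) ^ i) = C * (1/2) ^ i"
    proof -
      have "(1/4::real) = (1/2) * (1/2)" by simp
      then have "(1/4::real) ^ i = (1/2) ^ i * (1/2) ^ i" by (metis power_mult_distrib)
      then show ?thesis by (simp add: power_divide)
    qed
    finally show "(\<integral>\<^sup>+x. ennreal (2 ^ i * (a i x)\<^sup>2) \<partial>lborel) \<le> ennreal (C * (1/2) ^ i)" .
  qed auto
  also have "\<dots> = ennreal (\<Sum>i. C * (1/2) ^ i)"
    using C by (intro suminf_ennreal2) (auto intro!: summable_mult summable_geometric)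
  finally have H_int: "(\<integral>\<^sup>+x. H x \<partial>lborel) < \<infinity>"
    using le_less_trans[OF _ ennreal_less_top] by simp
  then have fin: "AE x in lborel. H x \<noteq> \<infinity>"
    by (intro nn_integral_noteq_infinite) auto
  define h where "h = (\<lambda>x. enn2real (H x))"
  have [measurable]: "h \<in> borel_measurable borel" unfolding h_def by measurable
  have h_int: "integrable lborel h"
  proof (rule integrableI_nonneg)
    have "(\<integral>\<^sup>+x. ennreal (h x) \<partial>lborel) = (\<integral>\<^sup>+x. H x \<partial>lborel)"
      using fin by (intro nn_integral_cong_AE) (auto simp: h_def less_top)
    then show "(\<integral>\<^sup>+x. ennreal (h x) \<partial>lborel) < \<infinity>" using H_int by simp
  qed (auto simp: h_def)
  have key: "(norm (\<phi> m x - \<phi> n x))\<^sup>2 \<le> 2 * (1/2) ^ n * h x" if "H x \<noteq> \<infinity>" "n \<le> m" for x n m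
  proof -
    have "norm (\<phi> m x - \<phi> n x) \<le> (\<Sum>i=n..<m. a i x)"
    proof -
      have "\<phi> m x - \<phi> n x = (\<Sum>i=n..<m. \<phi> (Suc i) x - \<phi> i x)"
        using sum_Suc_diff'[OF that(2), of "\<lambda>i. \<phi> i x"] by simp
      then show ?thesis unfolding a_def by (simp add: norm_sum)
    qed
    then have "(norm (\<phi> m x - \<phi> n x))\<^sup>2 \<le> (\<Sum>i=n..<m. a i x)\<^sup>2"
      by (intro power_mono) auto
    \<comment> \<open>Splitting 1 into sqrt ((1/2)^i) * sqrt (2^i) prepares Cauchy-Schwarz: one
      factor sums to a geometric tail, the other to at most \<open>h x\<close>.\<close>
    also have "\<dots> = (\<Sum>i=n..<m. sqrt ((1/2) ^ i) * (sqrt (2 ^ i) * a i x))\<^sup>2"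
      by (simp add: real_sqrt_mult[symmetric] mult.assoc[symmetric] power_mult_distrib[symmetric])
    also have "\<dots> \<le> (\<Sum>i=n..<m. (sqrt ((1/2) ^ i))\<^sup>2) * (\<Sum>i=n..<m. (sqrt (2 ^ i) * a i x)\<^sup>2)"
      by (rule Cauchy_Schwarz_ineq_sum)
    also have "\<dots> = (\<Sum>i=n..<m. (1/2) ^ i) * (\<Sum>i=n..<m. 2 ^ i * (a i x)\<^sup>2)"
      by (simp add: power_mult_distrib)
    also have "\<dots> \<le> (2 * (1/2) ^ n) * h x"
    proof (intro mult_mono)
      have "(\<Sum>i=n..<m. (1/2::real) ^ i) = 2 * (1/2)^n - 2 * (1/2)^m"
        using that(2) by (induction m rule: dec_induct) auto
      then show "(\<Sum>i=n..<m. (1/2::real) ^ i) \<le> 2 * (1/2) ^ n" by simp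
      have "ennreal (\<Sum>i=n..<m. 2 ^ i * (a i x)\<^sup>2) = (\<Sum>i=n..<m. ennreal (2 ^ i * (a i x)\<^sup>2))"
        by (intro sum_ennreal[symmetric]) auto
      also have "\<dots> \<le> H x" unfolding H_def by (intro sum_le_suminf) auto
      also have "H x = ennreal (h x)" using that(1) by (simp add: h_def less_top)
      finally show "(\<Sum>i=n..<m. 2 ^ i * (a i x)\<^sup>2) \<le> h x" by (simp add: h_def)
    qed (auto intro!: sum_nonneg)
    finally show ?thesis .
  qed
  \<comment> \<open>\<open>lim\<close> is total and measurable; its value where the sequence
    diverges concerns only a null set.\<close>
  define G where "G = (\<lambda>x. lim (\<lambda>n. \<phi> n x))"
  have [measurable]: "G \<in> borel_measurable borel" unfolding G_def by measurable
  have conv: "(\<lambda>n. \<phi> n x) \<longlonglongrightarrow> G x" if "H x \<noteq> \<infinity>" for x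
  proof -
    have "Cauchy (\<lambda>n. \<phi> n x)"
    proof (rule metric_CauchyI)
      fix e :: real assume e: "0 < e"
      have "(\<lambda>n. 2 * (1/2) ^ n * h x) \<longlonglongrightarrow> 2 * 0 * h x"
        by (intro tendsto_intros LIMSEQ_realpow_zero) auto
      then have "eventually (\<lambda>n. 2 * (1/2) ^ n * h x < (e/2)\<^sup>2) sequentially"
        using e by (intro order_tendstoD) auto
      then obtain N where N: "2 * (1/2) ^ N * h x < (e/2)\<^sup>2" by (auto simp: eventually_sequentially)
      have *: "norm (\<phi> m x - \<phi> N x) < e/2" if m: "N \<le> m" for m
      proof (rule power_less_imp_less_base[of _ 2])
        show "(norm (\<phi> m x - \<phi> N x))\<^sup>2 < (e/2)\<^sup>2"
          using key[OF \<open>H x \<noteq> \<infinity>\<close> m] N by (rule le_less_trans)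
      qed (use e in simp)
      show "\<exists>M. \<forall>m\<ge>M. \<forall>n\<ge>M. dist (\<phi> m x) (\<phi> n x) < e"
      proof (intro exI allI impI)
        fix m n assume "N \<le> m" "N \<le> n"
        then show "dist (\<phi> m x) (\<phi> n x) < e"
          using *[of m] *[of n] dist_triangle_half_l[of "\<phi> m x" "\<phi> N x" e "\<phi> n x"]
          by (simp add: dist_norm norm_minus_commute)
      qed
    qed
    then show ?thesis unfolding G_def by (metis Cauchy_convergent convergent_LIMSEQ_iff)
  qed
  have G_le: "AE x in lborel. (norm (G x - \<phi> n x))\<^sup>2 \<le> 2 * (1/2) ^ n * h x" for n
    using fin
  proof eventually_elim
    case (elim x)
    have "(\<lambda>m. (norm (\<phi> m x - \<phi> n x))\<^sup>2) \<longlonglongrightarrow> (norm (G x - \<phi> n x))\<^sup>2"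
      by (intro tendsto_intros conv elim)
    then show ?case by (rule Lim_bounded[where M = n]) (use key[OF elim] in auto)
  qed
  have diff_int: "sq_int (\<lambda>x. G x - \<phi> n x)" for n
    unfolding sq_int_def
  proof (intro conjI)
    show "integrable lborel (\<lambda>x. (norm (G x - \<phi> n x))\<^sup>2)"
    proof (rule Bochner_Integration.integrable_bound)
      show "integrable lborel (\<lambda>x. 2 * (1/2) ^ n * h x)" using h_int by auto
      show "AE x in lborel. norm ((norm (G x - \<phi> n x))\<^sup>2) \<le> norm (2 * (1/2) ^ n * h x)"
        using G_le[of n] by eventually_elim (auto simp: h_def)
    qed simp
  qed simp
  have G: "sq_int G"
    using sq_int_add[OF diff_int[of 0] phi[of 0]] by simp
  have "n2 (\<lambda>x. G x - \<phi> n x) \<le> 2 * (1/2) ^ n * (LINT x|lborel. h x)" for n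
  proof -
    have "n2 (\<lambda>x. G x - \<phi> n x) \<le> (LINT x|lborel. 2 * (1/2) ^ n * h x)"
      unfolding n2_def using h_int diff_int[of n] by (intro integral_mono_AE G_le) (auto simp: sq_int_def)
    then show ?thesis using h_int by simp
  qed
  moreover have "(\<lambda>n. 2 * (1/2) ^ n * (LINT x|lborel. h x)) \<longlonglongrightarrow> 2 * 0 * (LINT x|lborel. h x)"
    by (intro tendsto_intros LIMSEQ_realpow_zero) auto
  ultimately have "(\<lambda>n. n2 (\<lambda>x. G x - \<phi> n x)) \<longlonglongrightarrow> 0"
    by (intro real_tendsto_sandwich[of "\<lambda>_. 0" "\<lambda>n. n2 (\<lambda>x. G x - \<phi> n x)" sequentially
          "\<lambda>n. 2 * (1/2) ^ n * (LINT x|lborel. h x)" 0]) (simp_all del: power_divide)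
  with G show ?thesis by blast
qed

text \<open>Riesz representation: the vector \<open>cnj g\<close> minimises \<open>n2 \<phi> - 2 Re (L \<phi>)\<close> on the closure of \<open>S\<close>.\<close>

lemma Riesz_L2:
  fixes L :: "(real \<Rightarrow> complex) \<Rightarrow> complex"
  assumes S: "\<And>\<phi>. \<phi> \<in> S \<Longrightarrow> sq_int \<phi>" and S0: "(\<lambda>x. 0) \<in> S"
    and S_add: "\<And>\<phi> \<psi>. \<phi> \<in> S \<Longrightarrow> \<psi> \<in> S \<Longrightarrow> (\<lambda>x. \<phi> x + \<psi> x) \<in> S"
    and S_mult: "\<And>c \<phi>. \<phi> \<in> S \<Longrightarrow> (\<lambda>x. c * \<phi> x) \<in> S"
    and L_add: "\<And>\<phi> \<psi>. \<phi> \<in> S \<Longrightarrow> \<psi> \<in> S \<Longrightarrow> L (\<lambda>x. \<phi> x + \<psi> x) = L \<phi> + L \<psi>"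
    and L_mult: "\<And>c \<phi>. \<phi> \<in> S \<Longrightarrow> L (\<lambda>x. c * \<phi> x) = c * L \<phi>"
    and L_bound: "\<And>\<phi>. \<phi> \<in> S \<Longrightarrow> norm (L \<phi>) \<le> K * sqrt (n2 \<phi>)" and K: "0 \<le> K"
  shows "\<exists>g. sq_int g \<and> sqrt (n2 g) \<le> K \<and> (\<forall>\<phi>\<in>S. (LINT x|lborel. g x * \<phi> x) = L \<phi>)"
proof -
  define J where "J = (\<lambda>\<phi>. n2 \<phi> - 2 * Re (L \<phi>))"
  \<comment> \<open>Completing the square: t^2 - 2 K t \<ge> - K^2 for t =
    \<open>sqrt (n2 \<phi>)\<close>.\<close>
  have J_lower: "- K\<^sup>2 \<le> J \<phi>" if "\<phi> \<in> S" for \<phi>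
  proof -
    have "Re (L \<phi>) \<le> K * sqrt (n2 \<phi>)"
      using complex_Re_le_cmod L_bound[OF that] by (rule order_trans)
    moreover have "0 \<le> (sqrt (n2 \<phi>) - K)\<^sup>2" by simp
    ultimately show ?thesis unfolding J_def by (simp add: power2_diff mult.commute)
  qed
  define m where "m = Inf (J ` S)"
  have bdd: "bdd_below (J ` S)" by (rule bdd_belowI2[of _ "- K\<^sup>2"]) (rule J_lower)
  have m_le: "m \<le> J \<phi>" if "\<phi> \<in> S" for \<phi> unfolding m_def using bdd that by (rule cINF_lower)
  have "\<exists>\<phi>\<in>S. J \<phi> < m + (1/4) ^ n" for n :: nat
  proof -
    have "Inf (J ` S) < m + (1/4) ^ n" unfolding m_def by simp
    then show ?thesis using cInf_less_iff[OF _ bdd] S0 by auto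
  qed
  then obtain \<phi> where \<phi>S: "\<And>n. \<phi> n \<in> S" and \<phi>J: "\<And>n::nat. J (\<phi> n) < m + (1/4) ^ n" by metis
  have L_diff: "L (\<lambda>x. f x - g x) = L f - L g" if "f \<in> S" "g \<in> S" for f g
    using L_add[OF that(1) S_mult[OF that(2), of "-1"]] L_mult[OF that(2), of "-1"] by simp
  have S_diff: "(\<lambda>x. f x - g x) \<in> S" if "f \<in> S" "g \<in> S" for f g
    using S_add[OF that(1) S_mult[OF that(2), of "-1"]] by simp
  have J_add: "J (\<lambda>x. f x + g x) = J f + n2 g + 2 * Re (LINT x|lborel. cnj (f x) * g x) - 2 * Re (L g)"
    if "f \<in> S" "g \<in> S" for f g
    unfolding J_def using n2_add[OF S[OF that(1)] S[OF that(2)]] L_add[OF that] by simp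
  \<comment> \<open>The parallelogram law. The linear part of \<open>J\<close> cancels, and the
    midpoint stays in \<open>S\<close>, so a minimising sequence has small differences.\<close>
  have par: "n2 (\<lambda>x. f x - g x) = 2 * J f + 2 * J g - 4 * J (\<lambda>x. (1/2) * (f x + g x))"
    if "f \<in> S" "g \<in> S" for f g
  proof -
    have 1: "n2 (\<lambda>x. f x - g x) = n2 f + n2 g - 2 * Re (LINT x|lborel. cnj (f x) * g x)"
      using n2_add[OF S[OF that(1)] sq_int_cmult[OF S[OF that(2)], of "-1"]] n2_cmult[of "-1" g] by simp
    have 2: "4 * J (\<lambda>x. (1/2) * (f x + g x)) = n2 (\<lambda>x. f x + g x) - 4 * Re (L (\<lambda>x. f x + g x))"
      unfolding J_def n2_cmult[of "1/2" "\<lambda>x. f x + g x"] L_mult[OF S_add[OF that], of "1/2"]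
      by (simp add: power2_eq_square)
    have "2 * J f + 2 * J g = 2 * n2 f + 2 * n2 g - 4 * Re (L f) - 4 * Re (L g)"
      by (simp add: J_def)
    then show ?thesis
      using 1 2 n2_add[OF S[OF that(1)] S[OF that(2)]] L_add[OF that] by simp
  qed
  have "n2 (\<lambda>x. \<phi> (Suc n) x - \<phi> n x) \<le> 4 * (1/4) ^ n" for n
  proof -
    have "m \<le> J (\<lambda>x. (1/2) * (\<phi> (Suc n) x + \<phi> n x))" by (intro m_le S_mult S_add \<phi>S)
    moreover have "J (\<phi> (Suc n)) < m + (1/4) ^ n"
      using \<phi>J[of "Suc n"] by (rule less_le_trans) simp
    ultimately show ?thesis unfolding par[OF \<phi>S \<phi>S] using \<phi>J[of n] by simp
  qed
  from L2_complete[OF S[OF \<phi>S] this]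
  obtain G where G: "sq_int G" and lim: "(\<lambda>n. n2 (\<lambda>x. G x - \<phi> n x)) \<longlonglongrightarrow> 0" by blast
  have lim_pair: "(\<lambda>n. (LINT x|lborel. cnj (\<phi> n x) * g x)) \<longlonglongrightarrow> (LINT x|lborel. cnj (G x) * g x)"
    if g: "sq_int g" for g
  proof (rule LIM_zero_cancel, rule Lim_null_comparison)
    have "(LINT x|lborel. cnj (\<phi> n x) * g x) - (LINT x|lborel. cnj (G x) * g x)
        = - (LINT x|lborel. cnj (G x - \<phi> n x) * g x)" for n
      using sq_int_mult_integrable[OF sq_int_cnj[OF S[OF \<phi>S]] g, of n]
        sq_int_mult_integrable[OF sq_int_cnj[OF G] g]
      by (simp add: left_diff_distrib)
    then show "\<forall>\<^sub>F n in sequentially. norm ((LINT x|lborel. cnj (\<phi> n x) * g x) - (LINT x|lborel. cnj (G x) * g x))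
        \<le> sqrt (n2 (\<lambda>x. G x - \<phi> n x)) * sqrt (n2 g)"
      using Cauchy_Schwarz_L2[OF sq_int_cnj[OF sq_int_diff[OF G S[OF \<phi>S]]] g]
      by (simp add: n2_cnj del: complex_cnj_diff)
    show "(\<lambda>n. sqrt (n2 (\<lambda>x. G x - \<phi> n x)) * sqrt (n2 g)) \<longlonglongrightarrow> 0"
      using tendsto_mult[OF tendsto_real_sqrt[OF lim] tendsto_const[of "sqrt (n2 g)"]] by simp
  qed
  have rep: "(LINT x|lborel. cnj (G x) * g x) = L g" if g: "g \<in> S" for g
  proof -
    define D where "D = (LINT x|lborel. cnj (G x) * g x) - L g"
    \<comment> \<open>The first variation at the minimum in the direction \<open>c * g\<close>,
      taken along the minimising sequence because the minimiser itself need not lie in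
      \<open>S\<close>.\<close>
    have step: "0 \<le> (norm c)\<^sup>2 * n2 g + 2 * Re (c * D)" for c
    proof -
      have cg: "(\<lambda>x. c * g x) \<in> S" using S_mult g .
      have "- ((1/4) ^ n) \<le> (norm c)\<^sup>2 * n2 g + 2 * Re (c * ((LINT x|lborel. cnj (\<phi> n x) * g x) - L g))" for n
      proof -
        have "m \<le> J (\<lambda>x. \<phi> n x + c * g x)" by (intro m_le S_add \<phi>S cg)
        also have "\<dots> = J (\<phi> n) + (norm c)\<^sup>2 * n2 g + 2 * Re (c * ((LINT x|lborel. cnj (\<phi> n x) * g x) - L g))"
          unfolding J_add[OF \<phi>S cg] n2_cmult L_mult[OF g]
          by (simp only: mult.left_commute[of _ c]) (simp add: algebra_simps)
        finally show ?thesis using \<phi>J[of n] by simp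
      qed
      moreover have "(\<lambda>n. (norm c)\<^sup>2 * n2 g + 2 * Re (c * ((LINT x|lborel. cnj (\<phi> n x) * g x) - L g)))
          \<longlonglongrightarrow> (norm c)\<^sup>2 * n2 g + 2 * Re (c * D)"
        unfolding D_def by (intro tendsto_intros lim_pair S g)
      moreover have "(\<lambda>n. - ((1/4) ^ n) :: real) \<longlonglongrightarrow> - 0"
        by (intro tendsto_intros LIMSEQ_realpow_zero) auto
      ultimately show ?thesis by (intro LIMSEQ_le[of "\<lambda>n. - ((1/4) ^ n)" 0]) auto
    qed
    have "D = 0"
    proof (rule ccontr)
      assume D: "D \<noteq> 0"
      \<comment> \<open>For c = - t cnj D the linear term is - 2 t |D|^2 and the quadratic one at
        most t |D|^2, so the sum is negative unless D vanishes. The summand 1 covers the case that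
        \<open>n2 g\<close> is 0.\<close>
      define t where "t = 1 / (n2 g + 1)"
      have t: "0 < t" "t * n2 g \<le> 1" by (auto simp: t_def field_simps add_pos_nonneg add_nonneg_pos)
      have "0 \<le> (norm (- of_real t * cnj D))\<^sup>2 * n2 g + 2 * Re (- of_real t * cnj D * D)" by (rule step)
      also have "Re (- of_real t * cnj D * D) = - t * (norm D)\<^sup>2"
        unfolding cmod_power2 by (simp add: power2_eq_square algebra_simps)
      also have "(norm (- of_real t * cnj D))\<^sup>2 = t\<^sup>2 * (norm D)\<^sup>2"
        using t by (simp add: norm_mult power_mult_distrib)
      also have "t\<^sup>2 * (norm D)\<^sup>2 * n2 g + 2 * (- t * (norm D)\<^sup>2) = (t * (norm D)\<^sup>2) * (t * n2 g - 2)"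
        by (simp add: power2_eq_square algebra_simps)
      finally have "0 \<le> (t * (norm D)\<^sup>2) * (t * n2 g - 2)" .
      moreover have "0 < t * (norm D)\<^sup>2" using t D by simp
      ultimately show False using t(2) by (simp add: zero_le_mult_iff)
    qed
    then show ?thesis by (simp add: D_def)
  qed
  \<comment> \<open>\<open>L_bound\<close> speaks of elements of \<open>S\<close> only, so the norm
    of \<open>G\<close> is compared with \<open>L (\<phi> n)\<close> and the limit is taken.\<close>
  have "n2 G \<le> K * sqrt (n2 G)"
  proof (rule LIMSEQ_le)
    have "cnj z * z = complex_of_real ((norm z)\<^sup>2)" for z
      by (simp only: complex_norm_square mult.commute)
    then have "(LINT x|lborel. cnj (G x) * G x) = complex_of_real (n2 G)"
      by (simp only: n2_def integral_complex_of_real)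
    then show "(\<lambda>n. Re (LINT x|lborel. cnj (\<phi> n x) * G x)) \<longlonglongrightarrow> n2 G"
      using tendsto_Re[OF lim_pair[OF G]] by simp
    show "(\<lambda>n. K * (sqrt (n2 G) + sqrt (n2 (\<lambda>x. G x - \<phi> n x)))) \<longlonglongrightarrow> K * sqrt (n2 G)"
      using tendsto_mult[OF tendsto_const[of K] tendsto_add[OF tendsto_const[of "sqrt (n2 G)"] tendsto_real_sqrt[OF lim]]]
      by simp
    have tri: "sqrt (n2 (\<phi> n)) \<le> sqrt (n2 G) + sqrt (n2 (\<lambda>x. G x - \<phi> n x))" for n
    proof -
      let ?d = "\<lambda>x. \<phi> n x - G x"
      have d: "sq_int ?d" by (intro sq_int_diff G S \<phi>S)
      have n2d: "n2 ?d = n2 (\<lambda>x. G x - \<phi> n x)" by (simp add: n2_def norm_minus_commute)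
      have "n2 (\<phi> n) = n2 G + n2 ?d + 2 * Re (LINT x|lborel. cnj (G x) * ?d x)"
        using n2_add[OF G d] by simp
      also have "\<dots> \<le> n2 G + n2 ?d + 2 * (sqrt (n2 G) * sqrt (n2 ?d))"
        using order_trans[OF complex_Re_le_cmod Cauchy_Schwarz_L2[OF sq_int_cnj[OF G] d]]
        by (simp add: n2_cnj)
      also have "\<dots> = (sqrt (n2 G) + sqrt (n2 ?d))\<^sup>2" by (simp add: power2_sum)
      finally have "sqrt (n2 (\<phi> n)) \<le> sqrt (n2 G) + sqrt (n2 ?d)" by (intro real_le_lsqrt) auto
      then show ?thesis by (simp only: n2d)
    qed
    have "(LINT x|lborel. cnj (\<phi> n x) * G x) = cnj (L (\<phi> n))" for n
      unfolding rep[OF \<phi>S, symmetric] Bochner_Integration.integral_cnj[symmetric]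
      by (simp add: mult.commute)
    then have "Re (LINT x|lborel. cnj (\<phi> n x) * G x) \<le> norm (L (\<phi> n))" for n
      using complex_Re_le_cmod[of "cnj (L (\<phi> n))"] by simp
    then show "\<exists>N. \<forall>n\<ge>N. Re (LINT x|lborel. cnj (\<phi> n x) * G x) \<le> K * (sqrt (n2 G) + sqrt (n2 (\<lambda>x. G x - \<phi> n x)))"
      using order_trans[OF _ order_trans[OF L_bound[OF \<phi>S] mult_left_mono[OF tri K]]] by blast
  qed
  then have "sqrt (n2 G) * sqrt (n2 G) \<le> K * sqrt (n2 G)" by simp
  then have "sqrt (n2 G) \<le> K"
    using K by (cases "n2 G = 0") (simp, metis mult_le_cancel_right_pos n2_nonneg real_sqrt_gt_0_iff order_le_less)
  then show ?thesis using rep G by (intro exI[of _ "\<lambda>x. cnj (G x)"]) (auto simp: n2_cnj)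
qed

section \<open>The Fourier transform\<close>

lemma measurable_cis [measurable]: "cis \<in> borel_measurable borel"
  by (intro borel_measurable_continuous_onI continuous_intros)

lemma measurable_cnj [measurable]: "cnj \<in> borel_measurable borel"
  by (intro borel_measurable_continuous_onI continuous_intros)

definition ft :: "(real \<Rightarrow> complex) \<Rightarrow> real \<Rightarrow> complex" where
  "ft U x = (LINT \<xi>|lborel. cis (- (x * \<xi>)) * U \<xi>)"

text \<open>On the intersection of L^1 and L^2 the transform is an integral and obeys Bessel's
  inequality; this is the class of test functions for the L^2 theory.\<close>

definition L12 :: "(real \<Rightarrow> complex) \<Rightarrow> bool" where
  "L12 U \<longleftrightarrow> integrable lborel U \<and> sq_int U"

lemma L12_add: "L12 f \<Longrightarrow> L12 g \<Longrightarrow> L12 (\<lambda>x. f x + g x)"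
  by (auto simp: L12_def)

lemma L12_cmult: "L12 f \<Longrightarrow> L12 (\<lambda>x. c * f x)"
  by (auto simp: L12_def)

lemma L12_0: "L12 (\<lambda>x. 0)"
  by (auto simp: L12_def sq_int_def)

lemma L12_bounded:
  assumes "integrable lborel f" "\<And>x. norm (f x) \<le> C"
  shows "L12 f"
proof -
  have f [measurable]: "f \<in> borel_measurable borel" using assms(1) by auto
  show ?thesis unfolding L12_def
  proof (intro conjI assms(1) sq_int_bound[OF f])
    show "integrable lborel (\<lambda>x. C * norm (f x))" using assms(1) by auto
    show "(norm (f x))\<^sup>2 \<le> C * norm (f x)" for x
      by (simp add: power2_eq_square mult_right_mono assms(2))
  qed
qed

lemma integrable_reflect:
  fixes f :: "real \<Rightarrow> 'a :: {banach, second_countable_topology}"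
  shows "integrable lborel f \<Longrightarrow> integrable lborel (\<lambda>x. f (- x))"
  using lborel_integrable_real_affine[of f "-1" 0] by simp

lemma integral_reflect:
  fixes f :: "real \<Rightarrow> 'a :: {banach, second_countable_topology}"
  shows "(LINT x|lborel. f (- x)) = (LINT x|lborel. f x)"
  using lborel_integral_real_affine[of "-1" f 0] by simp

lemma integrable_shift:
  fixes f :: "real \<Rightarrow> 'a :: {banach, second_countable_topology}"
  shows "integrable lborel f \<Longrightarrow> integrable lborel (\<lambda>x. f (t + x))"
  using lborel_integrable_real_affine[of f 1 t] by simp

lemma integral_shift:
  fixes f :: "real \<Rightarrow> 'a :: {banach, second_countable_topology}"
  shows "(LINT x|lborel. f (t + x)) = (LINT x|lborel. f x)"
  using lborel_integral_real_affine[of 1 f t] by simp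

lemma sq_int_reflect: "sq_int f \<Longrightarrow> sq_int (\<lambda>x. f (- x))"
  using integrable_reflect[of "\<lambda>x. (norm (f x))\<^sup>2"] by (auto simp: sq_int_def)

lemma n2_reflect: "n2 (\<lambda>x. f (- x)) = n2 f"
  using integral_reflect[of "\<lambda>x. (norm (f x))\<^sup>2"] by (auto simp: n2_def)

lemma L12_reflect: "L12 f \<Longrightarrow> L12 (\<lambda>x. f (- x))"
  by (auto simp: L12_def intro: integrable_reflect sq_int_reflect)

lemma ft_integrable:
  assumes "integrable lborel U" shows "integrable lborel (\<lambda>\<xi>. cis (- (x * \<xi>)) * U \<xi>)"
  by (rule Bochner_Integration.integrable_bound[OF assms]) (use assms in \<open>auto simp: norm_mult\<close>)

lemma ft_measurable [measurable]: "ft U \<in> borel_measurable borel" if "U \<in> borel_measurable borel"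
proof -
  note that[measurable]
  show ?thesis unfolding ft_def[abs_def] by measurable
qed

lemma norm_ft_le: "norm (ft U x) \<le> (LINT \<xi>|lborel. norm (U \<xi>))"
  unfolding ft_def using integral_norm_bound[of lborel "\<lambda>\<xi>. cis (- (x * \<xi>)) * U \<xi>"] by (simp add: norm_mult)

lemma ft_add: "integrable lborel f \<Longrightarrow> integrable lborel g \<Longrightarrow> ft (\<lambda>x. f x + g x) t = ft f t + ft g t"
  unfolding ft_def by (simp add: ring_distribs ft_integrable)

lemma ft_cmult: "ft (\<lambda>x. c * f x) t = c * ft f t"
  unfolding ft_def by (simp add: mult.left_commute[of _ c])

lemma cnj_ft: "cnj (ft U x) = ft (\<lambda>\<xi>. cnj (U (- \<xi>))) x"
  unfolding ft_def Bochner_Integration.integral_cnj[symmetric]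
  using integral_reflect[of "\<lambda>\<xi>. cnj (cis (- (x * \<xi>)) * U \<xi>)"] by (simp add: cis_cnj)

lemma integrable_tensor:
  fixes f g :: "real \<Rightarrow> 'a :: {real_normed_field, banach, second_countable_topology}"
  assumes f: "integrable lborel f" and g: "integrable lborel g"
  shows "integrable (lborel \<Otimes>\<^sub>M lborel) (\<lambda>z. f (fst z) * g (snd z))"
proof (rule lborel_pair.Fubini_integrable)
  have [measurable]: "f \<in> borel_measurable borel" "g \<in> borel_measurable borel" using f g by auto
  show "(\<lambda>z. f (fst z) * g (snd z)) \<in> borel_measurable (lborel \<Otimes>\<^sub>M lborel)" by measurable
  show "integrable lborel (\<lambda>x. LINT y|lborel. norm (f (fst (x, y)) * g (snd (x, y))))"
    using f by (simp add: norm_mult)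
  show "AE x in lborel. integrable lborel (\<lambda>y. f (fst (x, y)) * g (snd (x, y)))"
    using g by simp
qed

lemma integrable_tensor_bounded:
  fixes f g :: "real \<Rightarrow> complex"
  assumes f: "integrable lborel f" and g: "integrable lborel g"
    and k [measurable]: "k \<in> borel_measurable (lborel \<Otimes>\<^sub>M lborel)" and C: "\<And>z. norm (k z) \<le> C"
  shows "integrable (lborel \<Otimes>\<^sub>M lborel) (\<lambda>z. k z * (f (fst z) * g (snd z)))"
proof (rule Bochner_Integration.integrable_bound)
  have [measurable]: "f \<in> borel_measurable borel" "g \<in> borel_measurable borel" using f g by auto
  show "integrable (lborel \<Otimes>\<^sub>M lborel) (\<lambda>z. complex_of_real C * (f (fst z) * g (snd z)))"
    using integrable_tensor[OF f g] by auto
  show "(\<lambda>z. k z * (f (fst z) * g (snd z))) \<in> borel_measurable (lborel \<Otimes>\<^sub>M lborel)" by measurable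
  show "AE z in lborel \<Otimes>\<^sub>M lborel. norm (k z * (f (fst z) * g (snd z))) \<le> norm (complex_of_real C * (f (fst z) * g (snd z)))"
    by (intro AE_I2) (simp add: norm_mult mult_right_mono order_trans[OF C abs_ge_self])
qed

lemma integral_tensor_swap:
  fixes f g :: "real \<Rightarrow> complex"
  assumes "integrable lborel f" and "integrable lborel g"
    and "case_prod k \<in> borel_measurable (lborel \<Otimes>\<^sub>M lborel)" and "\<And>x y. norm (k x y) \<le> C"
  shows "(LINT x|lborel. f x * (LINT y|lborel. k x y * g y)) = (LINT y|lborel. g y * (LINT x|lborel. k x y * f x))"
proof -
  have "integrable (lborel \<Otimes>\<^sub>M lborel) (\<lambda>(x, y). k x y * (f x * g y))"
    using integrable_tensor_bounded[OF assms(1,2,3), of C] assms(4) by (simp add: case_prod_unfold)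
  from lborel_pair.Fubini_integral[OF this]
  have "(LINT y|lborel. LINT x|lborel. k x y * (f x * g y)) = (LINT x|lborel. LINT y|lborel. k x y * (f x * g y))" .
  moreover have "(LINT y|lborel. LINT x|lborel. k x y * (f x * g y)) = (LINT y|lborel. g y * (LINT x|lborel. k x y * f x))"
    by (simp add: mult.commute mult.left_commute flip: integral_mult_right_zero)
  moreover have "(LINT x|lborel. LINT y|lborel. k x y * (f x * g y)) = (LINT x|lborel. f x * (LINT y|lborel. k x y * g y))"
    by (simp add: mult.commute mult.left_commute flip: integral_mult_right_zero)
  ultimately show ?thesis by simp
qed

lemma ft_multiplication:
  assumes "integrable lborel U" "integrable lborel V"
  shows "(LINT x|lborel. ft U x * V x) = (LINT x|lborel. U x * ft V x)"
proof -
  have "ft V y = (LINT x|lborel. cis (- (x * y)) * V x)" for y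
    by (simp add: ft_def mult.commute[of y])
  with integral_tensor_swap[OF assms(2,1), of "\<lambda>x y. cis (- (x * y))" 1] show ?thesis
    by (simp add: ft_def mult.commute[of _ "V _"])
qed

text \<open>Fubini in the frequency variable. It is used with a Gaussian \<open>k\<close> in
  Bessel's inequality and with the exponential \<open>k\<close> that produces the Poisson
  kernel.\<close>

lemma ft_mult_ft:
  assumes k: "integrable lborel k" and W: "integrable lborel W"
  shows "ft (\<lambda>x. k x * ft W x) \<xi> = (LINT \<eta>|lborel. W \<eta> * ft k (\<xi> + \<eta>))"
proof -
  have "ft (\<lambda>x. k x * ft W x) \<xi> = (LINT x|lborel. (cis (- (\<xi> * x)) * k x) * (LINT \<eta>|lborel. cis (- (x * \<eta>)) * W \<eta>))"
    unfolding ft_def by (simp add: mult.assoc)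
  also have "\<dots> = (LINT \<eta>|lborel. W \<eta> * (LINT x|lborel. cis (- (x * \<eta>)) * (cis (- (\<xi> * x)) * k x)))"
    by (rule integral_tensor_swap[OF ft_integrable[OF k] W, of _ 1]) auto
  also have "\<dots> = (LINT \<eta>|lborel. W \<eta> * ft k (\<xi> + \<eta>))"
  proof -
    have "cis (- (x * \<eta>)) * cis (- (\<xi> * x)) = cis (- ((\<xi> + \<eta>) * x))" for x \<eta>
      by (simp add: cis_mult algebra_simps)
    then show ?thesis unfolding ft_def by (simp only: mult.assoc[symmetric])
  qed
  finally show ?thesis .
qed

section \<open>Gaussians and Bessel's inequality\<close>

lemma ft_gauss1:
  "integrable lborel (\<lambda>x. exp (- x\<^sup>2 / 2) :: real)"
  "ft (\<lambda>x. complex_of_real (exp (- x\<^sup>2 / 2))) t = complex_of_real (sqrt (2 * pi) * exp (- t\<^sup>2 / 2))"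
proof -
  have "(\<lambda>x. exp (- x\<^sup>2 / 2) :: real) = (\<lambda>x. sqrt (2 * pi) * std_normal_density x)"
    by (simp add: std_normal_density_def)
  then show "integrable lborel (\<lambda>x. exp (- x\<^sup>2 / 2) :: real)"
    by (simp add: integrable_normal_density)
  \<comment> \<open>The transform is read off the known characteristic function of the standard
    normal distribution, up to the factor sqrt (2 * pi) of the density.\<close>
  have "char std_normal_distribution (- t) = (LINT x|lborel. std_normal_density x *\<^sub>R iexp (- t * x))"
    unfolding char_def by (subst integral_density) (auto simp: normal_density_nonneg)
  also have "\<dots> = (LINT x|lborel. complex_of_real (1 / sqrt (2 * pi)) * (cis (- (t * x)) * complex_of_real (exp (- x\<^sup>2 / 2))))"
    by (intro Bochner_Integration.integral_cong refl) (simp add: std_normal_density_def scaleR_conv_of_real cis_conv_exp mult.commute)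
  also have "\<dots> = complex_of_real (1 / sqrt (2 * pi)) * ft (\<lambda>x. complex_of_real (exp (- x\<^sup>2 / 2))) t"
    by (simp add: ft_def)
  finally show "ft (\<lambda>x. complex_of_real (exp (- x\<^sup>2 / 2))) t = complex_of_real (sqrt (2 * pi) * exp (- t\<^sup>2 / 2))"
    unfolding char_std_normal_distribution by (simp add: field_simps)
qed

lemma ft_gauss:
  assumes a: "0 < a"
  shows "integrable lborel (\<lambda>x. exp (- (a\<^sup>2 * x\<^sup>2) / 2) :: real)"
    "ft (\<lambda>x. complex_of_real (exp (- (a\<^sup>2 * x\<^sup>2) / 2))) t = complex_of_real (sqrt (2 * pi) / a * exp (- (t / a)\<^sup>2 / 2))"
proof -
  show "integrable lborel (\<lambda>x. exp (- (a\<^sup>2 * x\<^sup>2) / 2) :: real)"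
    using lborel_integrable_real_affine[OF ft_gauss1(1), of a 0] a by (simp add: power_mult_distrib)
  have "complex_of_real (sqrt (2 * pi) * exp (- (t / a)\<^sup>2 / 2)) = ft (\<lambda>x. complex_of_real (exp (- x\<^sup>2 / 2))) (t / a)"
    by (simp only: ft_gauss1)
  also have "\<dots> = \<bar>a\<bar> *\<^sub>R (LINT x|lborel. cis (- (t / a * (0 + a * x))) * complex_of_real (exp (- (0 + a * x)\<^sup>2 / 2)))"
    unfolding ft_def using a by (intro lborel_integral_real_affine) auto
  also have "\<dots> = a * ft (\<lambda>x. complex_of_real (exp (- (a\<^sup>2 * x\<^sup>2) / 2))) t"
    using a by (simp add: ft_def power_mult_distrib scaleR_conv_of_real)
  finally show "ft (\<lambda>x. complex_of_real (exp (- (a\<^sup>2 * x\<^sup>2) / 2))) t = complex_of_real (sqrt (2 * pi) / a * exp (- (t / a)\<^sup>2 / 2))"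
    using a by (simp add: nonzero_eq_divide_eq mult.commute)
qed

text \<open>The transform of the Gaussian weight has the same mass 2 pi at every scale; this becomes
  the constant of Bessel's inequality.\<close>

lemma integral_gauss_scaled:
  assumes a: "0 < a"
  shows "(\<integral>\<^sup>+\<xi>. ennreal (sqrt (2 * pi) / a * exp (- ((\<eta> + \<xi>) / a)\<^sup>2 / 2)) \<partial>lborel) = ennreal (2 * pi)"
proof -
  have "(\<integral>\<^sup>+\<xi>. ennreal (sqrt (2 * pi) / a * exp (- ((\<eta> + \<xi>) / a)\<^sup>2 / 2)) \<partial>lborel)
      = \<bar>a\<bar> * (\<integral>\<^sup>+\<xi>. ennreal (sqrt (2 * pi) / a * exp (- ((\<eta> + (- \<eta> + a * \<xi>)) / a)\<^sup>2 / 2)) \<partial>lborel)"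
    using a by (intro nn_integral_real_affine) auto
  also have "\<dots> = ennreal a * (\<integral>\<^sup>+\<xi>. ennreal (2 * pi / a) * ennreal (std_normal_density \<xi>) \<partial>lborel)"
    using a
  proof -
    have "sqrt (2 * pi) / a * exp (- ((\<eta> + (- \<eta> + a * \<xi>)) / a)\<^sup>2 / 2) = 2 * pi / a * std_normal_density \<xi>" for \<xi>
    proof -
      have "2 * pi * (1 / sqrt (2 * pi)) = sqrt (2 * pi)" using real_div_sqrt[of "2 * pi"] by simp
      then have "2 * pi / a * (1 / sqrt (2 * pi) * E) = sqrt (2 * pi) / a * E" for E
        by (metis mult.assoc times_divide_eq_left)
      then show ?thesis using a by (simp only: std_normal_density_def) simp
    qed
    moreover have "ennreal (2 * pi / a * std_normal_density \<xi>) = ennreal (2 * pi / a) * ennreal (std_normal_density \<xi>)" for \<xi>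
      using a by (intro ennreal_mult) (auto simp: normal_density_nonneg)
    ultimately show ?thesis using a by (simp only: abs_of_pos)
  qed
  also have "\<dots> = ennreal a * ennreal (2 * pi / a)"
    using nn_integral_eq_integral[OF integrable_normal_density[of 1 0]] integral_normal_density[of 1 0]
    by (simp add: nn_integral_cmult normal_density_nonneg)
  also have "\<dots> = ennreal (2 * pi)" using a by (simp add: ennreal_mult[symmetric])
  finally show ?thesis .
qed

text \<open>The Gaussian weight makes all integrals absolutely convergent and has an explicit nonnegative transform.\<close>

lemma Bessel:
  assumes U: "L12 U"
  shows "sq_int (ft U)" "n2 (ft U) \<le> 2 * pi * n2 U"
proof -
  have Ui: "integrable lborel U" and U2: "sq_int U" using U by (auto simp: L12_def)
  have [measurable]: "U \<in> borel_measurable borel" using Ui by auto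
  \<comment> \<open>\<open>ft W\<close> is the conjugate of \<open>ft U\<close>, so the squared
    modulus becomes a product of two transforms and the multiplication formula applies.\<close>
  define W where "W = (\<lambda>\<xi>. cnj (U (- \<xi>)))"
  have W: "L12 W" using L12_reflect[OF U] by (auto simp: W_def L12_def)
  then have Wi: "integrable lborel W" by (auto simp: L12_def)
  have [measurable]: "W \<in> borel_measurable borel" using Wi by auto
  have n2W: "n2 W = n2 U" unfolding W_def by (simp add: n2_cnj n2_reflect)
  define w where "w = (\<lambda>a x::real. exp (- (a\<^sup>2 * x\<^sup>2) / 2))"
  define G where "G = (\<lambda>a t::real. sqrt (2 * pi) / a * exp (- (t / a)\<^sup>2 / 2))"
  have [measurable]: "w a \<in> borel_measurable borel" "G a \<in> borel_measurable borel" for a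
    unfolding w_def G_def by measurable
  have bound: "(\<integral>\<^sup>+x. ennreal ((norm (ft U x))\<^sup>2 * w a x) \<partial>lborel) \<le> ennreal (2 * pi * n2 U)" if a: "0 < a" for a
  proof -
    have wi: "integrable lborel (\<lambda>x. complex_of_real (w a x))"
      using ft_gauss(1)[OF a] by (simp add: w_def)
    have wG: "ft (\<lambda>x. complex_of_real (w a x)) t = complex_of_real (G a t)" for t
      unfolding w_def G_def by (rule ft_gauss(2)[OF a])
    have G0: "0 \<le> G a t" for t using a by (simp add: G_def)
    have bdd: "norm (ft U x) \<le> (LINT \<xi>|lborel. norm (U \<xi>))" for x by (rule norm_ft_le)
    have int: "integrable lborel (\<lambda>x. complex_of_real (w a x) * ft W x)"
    proof (rule Bochner_Integration.integrable_bound)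
      show "integrable lborel (\<lambda>x. complex_of_real (w a x) * complex_of_real (LINT \<xi>|lborel. norm (W \<xi>)))"
        using wi by auto
      have "norm (ft W x) \<le> \<bar>LINT \<xi>|lborel. norm (W \<xi>)\<bar>" for x
        using norm_ft_le[of W x] by linarith
      then show "AE x in lborel. norm (complex_of_real (w a x) * ft W x)
          \<le> norm (complex_of_real (w a x) * complex_of_real (LINT \<xi>|lborel. norm (W \<xi>)))"
        by (intro AE_I2) (simp add: norm_mult mult_left_mono)
    qed measurable
    have sq: "complex_of_real ((norm (ft U x))\<^sup>2 * w a x) = ft U x * (complex_of_real (w a x) * ft W x)" for x
    proof -
      have "ft W x = cnj (ft U x)" unfolding W_def by (rule cnj_ft[symmetric])
      then show ?thesis using complex_norm_square[of "ft U x"] by (simp add: mult.left_commute)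
    qed
    have int2: "integrable lborel (\<lambda>x. (norm (ft U x))\<^sup>2 * w a x)"
    proof (rule Bochner_Integration.integrable_bound)
      show "integrable lborel (\<lambda>x. (LINT \<xi>|lborel. norm (U \<xi>))\<^sup>2 * w a x)"
        using ft_gauss(1)[OF a] by (simp add: w_def)
      show "AE x in lborel. norm ((norm (ft U x))\<^sup>2 * w a x) \<le> norm ((LINT \<xi>|lborel. norm (U \<xi>))\<^sup>2 * w a x)"
        by (intro AE_I2) (simp add: w_def bdd power_mono)
    qed measurable
    define I where "I = (LINT x|lborel. (norm (ft U x))\<^sup>2 * w a x)"
    have I0: "0 \<le> I" unfolding I_def w_def by (intro integral_nonneg_AE) auto
    have "complex_of_real I = (LINT x|lborel. ft U x * (complex_of_real (w a x) * ft W x))"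
      unfolding I_def integral_complex_of_real[symmetric] sq ..
    also have "\<dots> = (LINT \<xi>|lborel. U \<xi> * ft (\<lambda>x. complex_of_real (w a x) * ft W x) \<xi>)"
      by (rule ft_multiplication[OF Ui int])
    also have "\<dots> = (LINT \<xi>|lborel. U \<xi> * (LINT \<eta>|lborel. W \<eta> * complex_of_real (G a (\<xi> + \<eta>))))"
      by (simp only: ft_mult_ft[OF wi Wi] wG)
    finally have I_eq: "complex_of_real I = (LINT \<xi>|lborel. U \<xi> * (LINT \<eta>|lborel. W \<eta> * complex_of_real (G a (\<xi> + \<eta>))))" .
    \<comment> \<open>A Bochner integral that does not converge has value 0, so no integrability has
      to be checked.\<close>
    have norm_le: "ennreal (norm (LINT x|lborel. f x)) \<le> (\<integral>\<^sup>+x. ennreal (norm (f x)) \<partial>lborel)" for f :: "real \<Rightarrow> complex"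
      by (cases "integrable lborel f") (auto simp: integral_norm_bound_ennreal not_integrable_integral_eq)
    have "ennreal I = ennreal (norm (complex_of_real I))" using I0 by simp
    also have "\<dots> \<le> (\<integral>\<^sup>+\<xi>. ennreal (norm (U \<xi> * (LINT \<eta>|lborel. W \<eta> * complex_of_real (G a (\<xi> + \<eta>))))) \<partial>lborel)"
      unfolding I_eq by (rule norm_le)
    also have "\<dots> \<le> (\<integral>\<^sup>+\<xi>. (\<integral>\<^sup>+\<eta>. ennreal (norm (U \<xi>)) * ennreal (norm (W \<eta>) * G a (\<xi> + \<eta>)) \<partial>lborel) \<partial>lborel)"
    proof (rule nn_integral_mono)
      fix \<xi>
      have "ennreal (norm (U \<xi> * (LINT \<eta>|lborel. W \<eta> * complex_of_real (G a (\<xi> + \<eta>)))))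
          = ennreal (norm (U \<xi>)) * ennreal (norm (LINT \<eta>|lborel. W \<eta> * complex_of_real (G a (\<xi> + \<eta>))))"
        by (simp add: norm_mult ennreal_mult)
      also have "\<dots> \<le> ennreal (norm (U \<xi>)) * (\<integral>\<^sup>+\<eta>. ennreal (norm (W \<eta> * complex_of_real (G a (\<xi> + \<eta>)))) \<partial>lborel)"
        by (intro mult_left_mono norm_le) auto
      also have "\<dots> = (\<integral>\<^sup>+\<eta>. ennreal (norm (U \<xi>)) * ennreal (norm (W \<eta>) * G a (\<xi> + \<eta>)) \<partial>lborel)"
        using G0 by (subst nn_integral_cmult[symmetric]) (auto simp: norm_mult)
      finally show "ennreal (norm (U \<xi> * (LINT \<eta>|lborel. W \<eta> * complex_of_real (G a (\<xi> + \<eta>))))) \<le> \<dots>" .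
    qed
    also have "\<dots> \<le> (\<integral>\<^sup>+\<xi>. (\<integral>\<^sup>+\<eta>. ennreal (1/2) * (ennreal ((norm (U \<xi>))\<^sup>2) * ennreal (G a (\<xi> + \<eta>)))
        + ennreal (1/2) * (ennreal ((norm (W \<eta>))\<^sup>2) * ennreal (G a (\<eta> + \<xi>))) \<partial>lborel) \<partial>lborel)"
    proof (intro nn_integral_mono)
      fix \<xi> \<eta>
      \<comment> \<open>Schur's test: the product is split by the arithmetic-geometric mean
        inequality, and the kernel has mass 2 pi in each variable.\<close>
      have "norm (U \<xi>) * norm (W \<eta>) \<le> 1/2 * ((norm (U \<xi>))\<^sup>2 + (norm (W \<eta>))\<^sup>2)"
        using sum_squares_bound[of "norm (U \<xi>)" "norm (W \<eta>)"] by simp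
      then have "norm (U \<xi>) * norm (W \<eta>) * G a (\<xi> + \<eta>) \<le> 1/2 * ((norm (U \<xi>))\<^sup>2 + (norm (W \<eta>))\<^sup>2) * G a (\<xi> + \<eta>)"
        using G0 by (intro mult_right_mono) auto
      then have "norm (U \<xi>) * (norm (W \<eta>) * G a (\<xi> + \<eta>)) \<le> 1/2 * ((norm (U \<xi>))\<^sup>2 * G a (\<xi> + \<eta>)) + 1/2 * ((norm (W \<eta>))\<^sup>2 * G a (\<eta> + \<xi>))"
        by (simp add: ring_distribs mult.assoc add.commute[of \<eta>])
      then have "ennreal (norm (U \<xi>) * (norm (W \<eta>) * G a (\<xi> + \<eta>)))
          \<le> ennreal (1/2 * ((norm (U \<xi>))\<^sup>2 * G a (\<xi> + \<eta>)) + 1/2 * ((norm (W \<eta>))\<^sup>2 * G a (\<eta> + \<xi>)))"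
        by (rule ennreal_leI)
      then show "ennreal (norm (U \<xi>)) * ennreal (norm (W \<eta>) * G a (\<xi> + \<eta>))
          \<le> ennreal (1/2) * (ennreal ((norm (U \<xi>))\<^sup>2) * ennreal (G a (\<xi> + \<eta>)))
            + ennreal (1/2) * (ennreal ((norm (W \<eta>))\<^sup>2) * ennreal (G a (\<eta> + \<xi>)))"
      proof -
        have half: "(0::real) \<le> 1/2" by simp
        show ?thesis if "ennreal (norm (U \<xi>) * (norm (W \<eta>) * G a (\<xi> + \<eta>)))
          \<le> ennreal (1/2 * ((norm (U \<xi>))\<^sup>2 * G a (\<xi> + \<eta>)) + 1/2 * ((norm (W \<eta>))\<^sup>2 * G a (\<eta> + \<xi>)))"
          using that G0 half
          by (simp only: ennreal_mult[symmetric] ennreal_plus[symmetric] mult_nonneg_nonneg norm_ge_zero zero_le_power)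
      qed
    qed
    also have "\<dots> = ennreal (1/2) * (\<integral>\<^sup>+\<xi>. \<integral>\<^sup>+\<eta>. ennreal ((norm (U \<xi>))\<^sup>2) * ennreal (G a (\<xi> + \<eta>)) \<partial>lborel \<partial>lborel)
        + ennreal (1/2) * (\<integral>\<^sup>+\<xi>. \<integral>\<^sup>+\<eta>. ennreal ((norm (W \<eta>))\<^sup>2) * ennreal (G a (\<eta> + \<xi>)) \<partial>lborel \<partial>lborel)"
      by (simp add: nn_integral_add nn_integral_cmult)
    also have "(\<integral>\<^sup>+\<xi>. \<integral>\<^sup>+\<eta>. ennreal ((norm (W \<eta>))\<^sup>2) * ennreal (G a (\<eta> + \<xi>)) \<partial>lborel \<partial>lborel)
        = (\<integral>\<^sup>+\<eta>. \<integral>\<^sup>+\<xi>. ennreal ((norm (W \<eta>))\<^sup>2) * ennreal (G a (\<eta> + \<xi>)) \<partial>lborel \<partial>lborel)"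
      by (rule lborel_pair.Fubini') measurable
    also have "\<dots> = ennreal (n2 W) * ennreal (2 * pi)"
      using integral_gauss_scaled[OF a] nn_integral_n2[of W] W
      by (simp add: nn_integral_cmult nn_integral_multc G_def L12_def)
    also have "(\<integral>\<^sup>+\<xi>. \<integral>\<^sup>+\<eta>. ennreal ((norm (U \<xi>))\<^sup>2) * ennreal (G a (\<xi> + \<eta>)) \<partial>lborel \<partial>lborel) = ennreal (n2 U) * ennreal (2 * pi)"
      using integral_gauss_scaled[OF a] nn_integral_n2[OF U2]
      by (simp add: nn_integral_cmult nn_integral_multc G_def)
    also have "ennreal (1/2) * (ennreal (n2 U) * ennreal (2 * pi)) + ennreal (1/2) * (ennreal (n2 W) * ennreal (2 * pi)) = ennreal (2 * pi * n2 U)"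
      unfolding n2W by (subst ennreal_mult[symmetric] ennreal_plus[symmetric] | simp)+
    finally have "ennreal I \<le> ennreal (2 * pi * n2 U)" .
    moreover have "(\<integral>\<^sup>+x. ennreal ((norm (ft U x))\<^sup>2 * w a x) \<partial>lborel) = ennreal I"
      unfolding I_def by (intro nn_integral_eq_integral int2) (auto simp: w_def)
    ultimately show ?thesis by simp
  qed
  \<comment> \<open>The weight is removed by Fatou's lemma along a = 1 / (n + 1).\<close>
  have "(\<integral>\<^sup>+x. ennreal ((norm (ft U x))\<^sup>2) \<partial>lborel)
      = (\<integral>\<^sup>+x. liminf (\<lambda>n. ennreal ((norm (ft U x))\<^sup>2 * w (1 / real (Suc n)) x)) \<partial>lborel)"
  proof (rule nn_integral_cong)
    fix x
    have "(\<lambda>n. (norm (ft U x))\<^sup>2 * w (1 / real (Suc n)) x) \<longlonglongrightarrow> (norm (ft U x))\<^sup>2 * exp (- (0\<^sup>2 * x\<^sup>2) / 2)"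
      unfolding w_def by (intro tendsto_intros LIMSEQ_Suc[OF lim_1_over_n]) auto
    then have "(\<lambda>n. ennreal ((norm (ft U x))\<^sup>2 * w (1 / real (Suc n)) x)) \<longlonglongrightarrow> ennreal ((norm (ft U x))\<^sup>2)"
      by (intro tendsto_ennrealI) simp
    then show "ennreal ((norm (ft U x))\<^sup>2) = liminf (\<lambda>n. ennreal ((norm (ft U x))\<^sup>2 * w (1 / real (Suc n)) x))"
      by (intro lim_imp_Liminf[symmetric]) auto
  qed
  also have "\<dots> \<le> liminf (\<lambda>n. \<integral>\<^sup>+x. ennreal ((norm (ft U x))\<^sup>2 * w (1 / real (Suc n)) x) \<partial>lborel)"
    by (intro nn_integral_liminf) auto
  also have "\<dots> \<le> ennreal (2 * pi * n2 U)"
    by (intro Liminf_le) (auto intro!: bound always_eventually)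
  finally have fin: "(\<integral>\<^sup>+x. ennreal ((norm (ft U x))\<^sup>2) \<partial>lborel) \<le> ennreal (2 * pi * n2 U)" .
  show "sq_int (ft U)" "n2 (ft U) \<le> 2 * pi * n2 U"
    using sq_intI_nn[OF _ fin] by auto
qed

section \<open>Injectivity of the transform, modulated Gaussians and Parseval's formula\<close>

lemma ft_real_inj:
  fixes h :: "real \<Rightarrow> real"
  assumes h: "integrable lborel h" and ft0: "\<And>t. ft (\<lambda>x. complex_of_real (h x)) t = 0"
  shows "AE x in lborel. h x = 0"
proof -
  have [measurable]: "h \<in> borel_measurable borel" using h by auto
  define p where "p = (\<lambda>x. max 0 (h x))"
  define n where "n = (\<lambda>x. max 0 (- h x))"
  have [measurable]: "p \<in> borel_measurable borel" "n \<in> borel_measurable borel"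
    unfolding p_def n_def by measurable
  have pi: "integrable lborel p" and ni: "integrable lborel n"
    using h by (auto simp: p_def n_def)
  have h_eq: "h x = p x - n x" for x by (auto simp: p_def n_def)
  have pn0: "0 \<le> p x" "0 \<le> n x" for x by (auto simp: p_def n_def)
  have c_int: "integrable lborel (\<lambda>x. iexp (t * x) * complex_of_real (f x))" if "integrable lborel f" for f t
    using ft_integrable[of "\<lambda>x. complex_of_real (f x)" "- t"] that by (simp add: cis_conv_exp)
  have eq: "(LINT x|lborel. iexp (t * x) * complex_of_real (p x)) = (LINT x|lborel. iexp (t * x) * complex_of_real (n x))" for t
  proof -
    have "(LINT x|lborel. iexp (t * x) * complex_of_real (p x)) - (LINT x|lborel. iexp (t * x) * complex_of_real (n x))
        = ft (\<lambda>x. complex_of_real (h x)) (- t)"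
      unfolding ft_def using c_int[OF pi, of t] c_int[OF ni, of t]
      by (simp add: h_eq cis_conv_exp ring_distribs)
    then show ?thesis by (simp add: ft0)
  qed
  define m where "m = (LINT x|lborel. p x)"
  have "complex_of_real m = complex_of_real (LINT x|lborel. n x)"
    using eq[of 0] unfolding m_def by (simp flip: integral_complex_of_real)
  then have mn: "m = (LINT x|lborel. n x)" by (simp only: of_real_eq_iff)
  have m0: "0 \<le> m" unfolding m_def using pn0 by simp
  show ?thesis
  proof (cases "m = 0")
    case True
    have "AE x in lborel. p x = 0" "AE x in lborel. n x = 0"
      using True m_def mn integral_nonneg_eq_0_iff_AE[OF pi] integral_nonneg_eq_0_iff_AE[OF ni] pn0 by auto
    then show ?thesis by eventually_elim (simp add: h_eq)
  next
    case False
    with m0 have m: "0 < m" by simp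
    \<comment> \<open>Equality of the transforms at 0 gives the positive and the negative part the
      same mass \<open>m\<close>; divided by it they are probability densities, and Levy's
      uniqueness theorem applies.\<close>
    define Q where "Q = (\<lambda>f::real\<Rightarrow>real. density lborel (\<lambda>x. ennreal (f x / m)))"
    have Q_dist: "real_distribution (Q f)"
      if f: "f \<in> borel_measurable borel" "integrable lborel f" "\<And>x. 0 \<le> f x" "(LINT x|lborel. f x) = m" for f
    proof -
      note f(1)[measurable]
      have "emeasure (Q f) (space (Q f)) = (\<integral>\<^sup>+x. ennreal (f x / m) \<partial>lborel)"
        unfolding Q_def by (simp add: emeasure_density)
      also have "\<dots> = ennreal (LINT x|lborel. f x / m)"
        using m f by (intro nn_integral_eq_integral) auto
      also have "\<dots> = 1" using m f by simp
      finally have "prob_space (Q f)" by (rule prob_spaceI)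
      then show ?thesis unfolding real_distribution_def real_distribution_axioms_def by (simp add: Q_def)
    qed
    have Q_char: "char (Q f) t = (LINT x|lborel. iexp (t * x) * complex_of_real (f x)) / m"
      if f: "f \<in> borel_measurable borel" "\<And>x. 0 \<le> f x" for f t
    proof -
      note f(1)[measurable]
      have "char (Q f) t = (LINT x|lborel. (f x / m) *\<^sub>R iexp (t * x))"
        unfolding char_def Q_def using f m by (subst integral_density) auto
      also have "\<dots> = (LINT x|lborel. (iexp (t * x) * complex_of_real (f x)) / m)"
        by (simp add: scaleR_conv_of_real mult.commute)
      finally show ?thesis by (simp only: integral_divide_zero)
    qed
    have "Q p = Q n"
    proof (rule Levy_uniqueness)
      show "char (Q p) = char (Q n)" using pn0 eq by (auto simp: Q_char)
    qed (auto intro!: Q_dist pi ni pn0 simp: m_def mn[unfolded m_def])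
    then have "AE x in lborel. ennreal (p x / m) = ennreal (n x / m)"
      unfolding Q_def by (subst (asm) sigma_finite_measure.density_unique_iff[OF sigma_finite_lborel]) auto
    then show ?thesis
      by eventually_elim (use m pn0 in \<open>simp add: h_eq\<close>)
  qed
qed

lemma ft_inj:
  assumes h: "integrable lborel h" and ft0: "\<And>t. ft h t = 0"
  shows "AE x in lborel. h x = 0"
proof -
  have hc: "integrable lborel (\<lambda>x. cnj (h x))" using h by simp
  have ftc: "ft (\<lambda>x. cnj (h x)) t = 0" for t
  proof -
    have "ft (\<lambda>x. cnj (h x)) t = cnj (ft h (- t))"
      unfolding ft_def Bochner_Integration.integral_cnj[symmetric] by (simp add: cis_cnj)
    then show ?thesis by (simp add: ft0)
  qed
  \<comment> \<open>Real and imaginary part are combinations of h and its conjugate, whose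
    transforms both vanish.\<close>
  have re: "complex_of_real (Re z) = (1/2) * z + (1/2) * cnj z" for z
    using complex_add_cnj[of z] by (simp add: field_simps)
  have im: "complex_of_real (Im z) = (1/(2*\<i>)) * z + (- 1/(2*\<i>)) * cnj z" for z
    using complex_diff_cnj[of z] by (simp add: field_simps)
  have "AE x in lborel. Re (h x) = 0" "AE x in lborel. Im (h x) = 0"
    using h hc by (auto intro!: ft_real_inj simp only: re im ft_add ft_cmult ft0 ftc
        integrable_Re integrable_Im integrable_mult_right mult_zero_right add_0)
  then show ?thesis by eventually_elim (simp add: complex_eq_iff)
qed

text \<open>Gaussians modulated by characters: no nonzero L^2 function annihilates them all, and
  their transforms are explicit translated Gaussians. Identities between L^2 functions are checked
  on this family.\<close>

definition mgauss :: "real \<Rightarrow> real \<Rightarrow> complex" where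
  "mgauss t x = cis (- (t * x)) * complex_of_real (exp (- x\<^sup>2 / 2))"

lemma L12_gauss: "L12 (\<lambda>x. complex_of_real (exp (- x\<^sup>2 / 2)))"
  using ft_gauss1(1) by (intro L12_bounded[of _ 1]) auto

lemma L12_mgauss: "L12 (mgauss t)"
  unfolding mgauss_def
  using ft_gauss1(1) by (intro L12_bounded[of _ 1] ft_integrable) (auto simp: norm_mult)

lemma ft_mgauss: "ft (mgauss t) x = complex_of_real (sqrt (2 * pi) * exp (- (t + x)\<^sup>2 / 2))"
proof -
  have "ft (mgauss t) x = ft (\<lambda>x. complex_of_real (exp (- x\<^sup>2 / 2))) (t + x)"
    unfolding ft_def mgauss_def by (simp add: mult.assoc[symmetric] cis_mult algebra_simps)
  then show ?thesis by (simp only: ft_gauss1)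
qed

lemma ft_mgauss_integrable: "integrable lborel (ft (mgauss t))"
  unfolding ft_mgauss[abs_def]
  using integrable_shift[OF ft_gauss1(1), of t] by simp

lemma ft_ft_mgauss: "ft (ft (mgauss t)) \<xi> = complex_of_real (2 * pi) * mgauss t (- \<xi>)"
proof -
  define g where "g = (\<lambda>x. complex_of_real (exp (- x\<^sup>2 / 2)))"
  have "ft (ft (mgauss t)) \<xi> = (LINT x|lborel. cis (t * \<xi>) * (complex_of_real (sqrt (2 * pi)) * (cis (- (\<xi> * (t + x))) * g (t + x))))"
    unfolding ft_def[of "ft (mgauss t)"] ft_mgauss g_def
  proof (intro Bochner_Integration.integral_cong refl)
    fix x
    have "cis (t * \<xi>) * cis (- (\<xi> * (t + x))) = cis (- (\<xi> * x))" by (simp add: cis_mult algebra_simps)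
    then show "cis (- (\<xi> * x)) * complex_of_real (sqrt (2 * pi) * exp (- (t + x)\<^sup>2 / 2))
        = cis (t * \<xi>) * (complex_of_real (sqrt (2 * pi)) * (cis (- (\<xi> * (t + x))) * complex_of_real (exp (- (t + x)\<^sup>2 / 2))))"
      by (simp add: mult.left_commute flip: mult.assoc)
  qed
  also have "\<dots> = cis (t * \<xi>) * (complex_of_real (sqrt (2 * pi)) * ft g \<xi>)"
    using integral_shift[of "\<lambda>x. cis (- (\<xi> * x)) * g x" t] by (simp add: ft_def)
  also have "\<dots> = complex_of_real (2 * pi) * mgauss t (- \<xi>)"
    unfolding g_def ft_gauss1 mgauss_def
    by (simp add: mult.assoc[symmetric] flip: of_real_mult)
  finally show ?thesis .
qed

text \<open>Pairing with \<open>mgauss t\<close> is the Fourier transform at t of h times a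
  Gaussian. Asking for integrability of this product alone admits h of the form \<xi> times an L^2
  function.\<close>

lemma zero_AE_mgauss:
  assumes [measurable]: "h \<in> borel_measurable borel"
    and int: "integrable lborel (\<lambda>x. h x * complex_of_real (exp (- x\<^sup>2 / 2)))"
    and zero: "\<And>t. (LINT x|lborel. h x * mgauss t x) = 0"
  shows "AE x in lborel. h x = 0"
proof -
  have "ft (\<lambda>x. h x * complex_of_real (exp (- x\<^sup>2 / 2))) t = 0" for t
    using zero[of t] by (simp add: ft_def mgauss_def mult.left_commute)
  from ft_inj[OF int this] show ?thesis by eventually_elim simp
qed

lemma zero_AE_mgauss_L2:
  assumes h: "sq_int h" and zero: "\<And>t. (LINT x|lborel. h x * mgauss t x) = 0"
  shows "AE x in lborel. h x = 0"
  using h L12_gauss sq_int_mult_integrable[OF h]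
  by (intro zero_AE_mgauss zero) (auto simp: L12_def)

text \<open>The L^2 transform by duality: Bessel's inequality makes the functional bounded on
  \<open>L12\<close>, and the Riesz representation yields the transform without a density
  argument.\<close>

lemma L2_fourier_exists:
  assumes V: "sq_int V"
  shows "\<exists>h. sq_int h \<and> n2 h \<le> 2 * pi * n2 V \<and> (\<forall>k. L12 k \<longrightarrow> (LINT x|lborel. h x * k x) = (LINT x|lborel. V x * ft k x))"
proof -
  define K where "K = sqrt (2 * pi * n2 V)"
  have VI: "integrable lborel (\<lambda>x. V x * ft k x)" if "L12 k" for k
    by (intro sq_int_mult_integrable V Bessel that)
  have "\<exists>h. sq_int h \<and> sqrt (n2 h) \<le> K \<and> (\<forall>k\<in>Collect L12. (LINT x|lborel. h x * k x) = (LINT x|lborel. V x * ft k x))"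
  proof (rule Riesz_L2)
    fix k l c assume "k \<in> Collect L12"
    then have k: "L12 k" by simp
    then show "sq_int k" by (simp add: L12_def)
    show "(\<lambda>x. c * k x) \<in> Collect L12" using k by (simp add: L12_cmult)
    show "(LINT x|lborel. V x * ft (\<lambda>x. c * k x) x) = c * (LINT x|lborel. V x * ft k x)"
      by (simp add: ft_cmult mult.left_commute[of _ c])
    have "norm (LINT x|lborel. V x * ft k x) \<le> sqrt (n2 V) * sqrt (n2 (ft k))"
      by (intro Cauchy_Schwarz_L2 V Bessel k)
    also have "\<dots> \<le> sqrt (n2 V) * sqrt (2 * pi * n2 k)"
      by (intro mult_left_mono real_sqrt_le_mono Bessel k) auto
    finally show "norm (LINT x|lborel. V x * ft k x) \<le> K * sqrt (n2 k)"
      by (simp add: K_def real_sqrt_mult mult_ac)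
    assume "l \<in> Collect L12"
    then have l: "L12 l" by simp
    show "(\<lambda>x. k x + l x) \<in> Collect L12" using k l by (simp add: L12_add)
    have "ft (\<lambda>x. k x + l x) t = ft k t + ft l t" for t
      using k l by (intro ft_add) (auto simp: L12_def)
    then show "(LINT x|lborel. V x * ft (\<lambda>x. k x + l x) x) = (LINT x|lborel. V x * ft k x) + (LINT x|lborel. V x * ft l x)"
      using VI[OF k] VI[OF l] by (simp add: ring_distribs)
  qed (auto simp: K_def L12_0)
  then obtain h where h: "sq_int h" "sqrt (n2 h) \<le> K"
    "\<And>k. L12 k \<Longrightarrow> (LINT x|lborel. h x * k x) = (LINT x|lborel. V x * ft k x)" by auto
  then have "n2 h \<le> 2 * pi * n2 V" unfolding K_def by (simp only: real_sqrt_le_iff)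
  with h show ?thesis by blast
qed

text \<open>The defect in Parseval's formula is, by Bessel's inequality, an \<open>L\<^sup>2\<close> functional; it vanishes on modulated
  Gaussians.\<close>

lemma Parseval:
  assumes U: "L12 U" and V: "L12 V"
  shows "(LINT x|lborel. ft V x * ft U x) = complex_of_real (2 * pi) * (LINT x|lborel. V (- x) * U x)"
proof -
  have V': "sq_int (ft V)" by (rule Bessel[OF V])
  have V'': "sq_int (\<lambda>x. V (- x))" using L12_reflect[OF V] by (simp add: L12_def)
  obtain g where g: "sq_int g"
    and gk: "\<And>k. L12 k \<Longrightarrow> (LINT x|lborel. g x * k x) = (LINT x|lborel. ft V x * ft k x)"
    using L2_fourier_exists[OF V'] by blast
  define d where "d = (\<lambda>x. g x - complex_of_real (2 * pi) * V (- x))"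
  have d: "sq_int d" unfolding d_def by (intro sq_int_diff g sq_int_cmult V'')
  have dk: "(LINT x|lborel. d x * k x) = (LINT x|lborel. ft V x * ft k x) - complex_of_real (2 * pi) * (LINT x|lborel. V (- x) * k x)"
    if k: "L12 k" for k
  proof -
    have k2: "sq_int k" using k by (simp add: L12_def)
    have "(LINT x|lborel. d x * k x) = (LINT x|lborel. g x * k x - complex_of_real (2 * pi) * (V (- x) * k x))"
      by (simp add: d_def left_diff_distrib mult.assoc)
    also have "\<dots> = (LINT x|lborel. g x * k x) - complex_of_real (2 * pi) * (LINT x|lborel. V (- x) * k x)"
      using sq_int_mult_integrable[OF g k2] sq_int_mult_integrable[OF V'' k2] by simp
    finally show ?thesis by (simp add: gk[OF k])
  qed
  have "AE x in lborel. d x = 0"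
  proof (rule zero_AE_mgauss_L2[OF d])
    fix t
    have "(LINT x|lborel. ft V x * ft (mgauss t) x) = (LINT x|lborel. V x * ft (ft (mgauss t)) x)"
      using V ft_mgauss_integrable by (intro ft_multiplication) (auto simp: L12_def)
    also have "\<dots> = complex_of_real (2 * pi) * (LINT x|lborel. V x * mgauss t (- x))"
      by (simp add: ft_ft_mgauss mult.left_commute[of "V _"])
    also have "(LINT x|lborel. V x * mgauss t (- x)) = (LINT x|lborel. V (- x) * mgauss t x)"
      using integral_reflect[of "\<lambda>x. V x * mgauss t (- x)"] by simp
    finally show "(LINT x|lborel. d x * mgauss t x) = 0" by (simp add: dk[OF L12_mgauss])
  qed
  then have "(LINT x|lborel. d x * U x) = 0"
    by (intro integral_eq_zero_AE) (auto elim: eventually_mono)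
  then show ?thesis by (simp add: dk[OF U])
qed

text \<open>The difference of both sides is in L^2 and vanishes against modulated Gaussians, by the
  multiplication formula and Parseval.\<close>

lemma ft_inversion:
  assumes k: "L12 k" and ki: "integrable lborel (ft k)"
  shows "AE x in lborel. ft (ft k) x = complex_of_real (2 * pi) * k (- x)"
proof -
  have k': "sq_int (\<lambda>x. k (- x))" using L12_reflect[OF k] by (simp add: L12_def)
  define d where "d = (\<lambda>x. ft (ft k) x - complex_of_real (2 * pi) * k (- x))"
  have ftk: "L12 (ft k)" using ki Bessel[OF k] by (simp add: L12_def)
  have ftft: "sq_int (ft (ft k))" by (rule Bessel[OF ftk])
  have d: "sq_int d" unfolding d_def by (intro sq_int_diff ftft sq_int_cmult k')
  have "AE x in lborel. d x = 0"
  proof (rule zero_AE_mgauss_L2[OF d])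
    fix t
    have m: "sq_int (mgauss t)" "integrable lborel (mgauss t)" using L12_mgauss by (auto simp: L12_def)
    have "(LINT x|lborel. ft (ft k) x * mgauss t x) = (LINT x|lborel. ft k x * ft (mgauss t) x)"
      by (intro ft_multiplication ki m)
    also have "\<dots> = complex_of_real (2 * pi) * (LINT x|lborel. k (- x) * mgauss t x)"
      by (rule Parseval[OF L12_mgauss k])
    finally have *: "(LINT x|lborel. ft (ft k) x * mgauss t x) = complex_of_real (2 * pi) * (LINT x|lborel. k (- x) * mgauss t x)" .
    have "(LINT x|lborel. d x * mgauss t x) = (LINT x|lborel. ft (ft k) x * mgauss t x - complex_of_real (2 * pi) * (k (- x) * mgauss t x))"
      by (simp add: d_def left_diff_distrib mult.assoc)
    also have "\<dots> = (LINT x|lborel. ft (ft k) x * mgauss t x) - complex_of_real (2 * pi) * (LINT x|lborel. k (- x) * mgauss t x)"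
      using sq_int_mult_integrable[OF ftft m(1)] sq_int_mult_integrable[OF k' m(1)] by simp
    finally show "(LINT x|lborel. d x * mgauss t x) = 0" by (simp add: *)
  qed
  then show ?thesis by eventually_elim (simp add: d_def)
qed

section \<open>Schwartz functions\<close>

text \<open>Nothing is known about limits of F at infinity. Averaging F' (s + x) over s in [0, 1]
  gives F (1 + x) - F x, whose integral vanishes by translation invariance, while Fubini returns the
  integral of F'.\<close>

lemma integral_derivative_eq_0:
  fixes F :: "real \<Rightarrow> 'a :: euclidean_space"
  assumes F: "integrable lborel F" and F': "integrable lborel F'"
    and deriv: "\<And>x. (F has_vector_derivative F' x) (at x)" and cont: "continuous_on UNIV F'"
  shows "(LINT x|lborel. F' x) = 0"
proof -
  have [measurable]: "F' \<in> borel_measurable borel" using F' by auto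
  have int: "integrable (lborel \<Otimes>\<^sub>M lborel) (\<lambda>(s, x). indicator {0..1} s *\<^sub>R F' (s + x))"
  proof (rule lborel_pair.Fubini_integrable)
    have "integrable lborel (\<lambda>s::real. indicator {0..1} s * (LINT x|lborel. norm (F' x)))"
      by (intro integrable_mult_left) (simp add: integrable_indicator_iff)
    then show "integrable lborel (\<lambda>s. LINT x|lborel. norm (case (s, x) of (s, x) \<Rightarrow> indicator {0..1} s *\<^sub>R F' (s + x)))"
      using integral_shift[of "\<lambda>x. norm (F' x)"] by simp
  qed (use integrable_shift[OF F'] in auto)
  have "(LINT x|lborel. LINT s|lborel. indicator {0..1} s *\<^sub>R F' (s + x)) = (LINT x|lborel. F (1 + x) - F x)"
  proof (intro Bochner_Integration.integral_cong refl)
    fix x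
    have "(LINT s|lborel. indicator {0..1} s *\<^sub>R F' (s + x)) = F (1 + x) - F (0 + x)"
    proof (rule integral_FTC_Icc)
      fix s :: real
      show "((\<lambda>s. F (s + x)) has_vector_derivative F' (s + x)) (at s within {0..1})"
      proof -
        have "((\<lambda>s. s + x) has_vector_derivative (1 + 0)) (at s)"
          by (intro has_vector_derivative_add has_vector_derivative_id has_vector_derivative_const)
        from vector_diff_chain_at[OF this deriv]
        have "((\<lambda>s. F (s + x)) has_vector_derivative F' (s + x)) (at s)" by (simp add: o_def)
        then show ?thesis by (rule has_vector_derivative_at_within)
      qed
    next
      show "continuous_on {0..1} (\<lambda>s. F' (s + x))"
        by (rule continuous_on_compose2[OF cont]) (intro continuous_on_add continuous_on_id continuous_on_const, simp)
    qed simp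
    then show "(LINT s|lborel. indicator {0..1} s *\<^sub>R F' (s + x)) = F (1 + x) - F x" by simp
  qed
  also have "\<dots> = 0"
    using integrable_shift[OF F, of 1] integral_shift[of F 1] F by simp
  finally have "(LINT x|lborel. LINT s|lborel. indicator {0..1} s *\<^sub>R F' (s + x)) = 0" .
  moreover have "(LINT x|lborel. LINT s|lborel. indicator {0..1} s *\<^sub>R F' (s + x))
      = (LINT s|lborel. LINT x|lborel. indicator {0..1} s *\<^sub>R F' (s + x))"
    by (rule lborel_pair.Fubini_integral[OF int])
  moreover have "(LINT s|lborel. LINT x|lborel. indicator {0..1} s *\<^sub>R F' (s + x)) = (LINT s|lborel. indicator {0..1::real} s *\<^sub>R (LINT x|lborel. F' x))"
    using integral_shift[of F'] by simp
  moreover have "\<dots> = (LINT x|lborel. F' x)"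
    by simp
  ultimately show ?thesis by simp
qed

lemma integrable_inverse_square: "integrable lborel (\<lambda>x. 1 / (1 + x\<^sup>2) :: real)"
  using integrable_inverse_1_plus_square
  by (simp add: set_integrable_def inverse_eq_divide)

text \<open>The derivative of the character times \<open>k\<close> integrates to zero.\<close>

lemma ft_deriv:
  assumes k: "integrable lborel k" and k': "integrable lborel k'"
    and deriv: "\<And>x. (k has_vector_derivative k' x) (at x)" and cont: "continuous_on UNIV k'"
  shows "ft k' \<xi> = \<i> * complex_of_real \<xi> * ft k \<xi>"
proof -
  define F where "F = (\<lambda>x. cis (- (\<xi> * x)) * k x)"
  define F' where "F' = (\<lambda>x. - \<i> * complex_of_real \<xi> * (cis (- (\<xi> * x)) * k x) + cis (- (\<xi> * x)) * k' x)"
  have cis_deriv: "((\<lambda>x. cis (- (\<xi> * x))) has_vector_derivative (- \<i> * complex_of_real \<xi> * cis (- (\<xi> * x)))) (at x)" for x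
  proof -
    have "((\<lambda>z. exp (- \<i> * complex_of_real \<xi> * z)) has_field_derivative
        - \<i> * complex_of_real \<xi> * exp (- \<i> * complex_of_real \<xi> * complex_of_real x)) (at (complex_of_real x))"
      by (auto intro!: derivative_eq_intros)
    from has_vector_derivative_real_field[OF this] show ?thesis by (simp add: cis_conv_exp mult.assoc)
  qed
  have contk: "continuous_on UNIV k"
    by (intro continuous_at_imp_continuous_on ballI has_vector_derivative_continuous[OF deriv])
  have "(LINT x|lborel. F' x) = 0"
  proof (rule integral_derivative_eq_0)
    show "integrable lborel F" unfolding F_def by (rule ft_integrable[OF k])
    show "integrable lborel F'" unfolding F'_def
      by (intro Bochner_Integration.integrable_add integrable_mult_right ft_integrable k k')
    show "(F has_vector_derivative F' x) (at x)" for x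
      unfolding F_def F'_def
      by (rule has_vector_derivative_eq_rhs[OF has_vector_derivative_mult[OF cis_deriv deriv]]) (simp add: algebra_simps)
    show "continuous_on UNIV F'" unfolding F'_def
      by (intro continuous_intros cont contk)
  qed
  also have "(LINT x|lborel. F' x) = - \<i> * complex_of_real \<xi> * ft k \<xi> + ft k' \<xi>"
    unfolding F'_def ft_def using ft_integrable[OF k, of \<xi>] ft_integrable[OF k', of \<xi>]
    by (subst Bochner_Integration.integral_add) auto
  finally show ?thesis by (simp add: algebra_simps)
qed

lemma schwartz_vderiv: "\<phi> \<in> schwartz \<Longrightarrow> vderiv \<phi> \<in> schwartz"
  unfolding schwartz_def
proof (intro CollectI allI)
  fix k m :: nat
  assume "\<phi> \<in> {\<phi>. \<forall>k m. (\<forall>x. (vderiv ^^ k) \<phi> differentiable at x) \<and> bounded (range (\<lambda>x. x ^ m *\<^sub>R (vderiv ^^ k) \<phi> x))}"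
  then have "(\<forall>x. (vderiv ^^ Suc k) \<phi> differentiable at x) \<and> bounded (range (\<lambda>x. x ^ m *\<^sub>R (vderiv ^^ Suc k) \<phi> x))" by blast
  then show "(\<forall>x. (vderiv ^^ k) (vderiv \<phi>) differentiable at x) \<and> bounded (range (\<lambda>x. x ^ m *\<^sub>R (vderiv ^^ k) (vderiv \<phi>) x))"
    by (simp only: funpow_Suc_right o_def simp_thms)
qed

lemma schwartz_has_vderiv:
  assumes "\<phi> \<in> schwartz" shows "(\<phi> has_vector_derivative vderiv \<phi> x) (at x)"
proof -
  have "\<phi> differentiable (at x)" using assms by (force simp: schwartz_def dest: spec[of _ 0])
  then show ?thesis by (simp add: vderiv_def vector_derivative_works)
qed

lemma schwartz_continuous: "\<phi> \<in> schwartz \<Longrightarrow> continuous_on UNIV \<phi>"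
  by (intro continuous_at_imp_continuous_on ballI has_vector_derivative_continuous[OF schwartz_has_vderiv])

lemma schwartz_measurable: "\<phi> \<in> schwartz \<Longrightarrow> \<phi> \<in> borel_measurable borel"
  by (intro borel_measurable_continuous_onI schwartz_continuous)

lemma schwartz_bound:
  assumes "\<phi> \<in> schwartz" shows "\<exists>C. \<forall>x. norm (\<phi> x) \<le> C / (1 + x\<^sup>2)"
proof -
  have "bounded (range (\<lambda>x. x ^ m *\<^sub>R \<phi> x))" for m
    using assms by (force simp: schwartz_def dest: spec[of _ 0])
  then have "bounded (range (\<lambda>x. x ^ 0 *\<^sub>R \<phi> x))" "bounded (range (\<lambda>x. x ^ 2 *\<^sub>R \<phi> x))" by blast+
  then obtain C D where CD: "\<And>x. norm (\<phi> x) \<le> C" "\<And>x. norm (x ^ 2 *\<^sub>R \<phi> x) \<le> D"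
    by (auto simp: bounded_iff)
  have "norm (\<phi> x) \<le> (C + D) / (1 + x\<^sup>2)" for x
  proof -
    have "norm (\<phi> x) * (1 + x\<^sup>2) \<le> C + D" using CD(1)[of x] CD(2)[of x] by (simp add: algebra_simps)
    moreover have "0 < 1 + x\<^sup>2" by (simp add: add_pos_nonneg)
    ultimately show ?thesis by (simp add: pos_le_divide_eq)
  qed
  then show ?thesis by blast
qed

lemma L12_quadratic_decay:
  assumes [measurable]: "f \<in> borel_measurable borel" and C: "\<And>x. norm (f x) \<le> C / (1 + x\<^sup>2)"
  shows "L12 f"
proof (rule L12_bounded)
  have "0 \<le> C" using order_trans[OF norm_ge_zero C[of 0]] by simp
  have "integrable lborel (\<lambda>x. C * (1 / (1 + x\<^sup>2)))"
    by (intro integrable_mult_right integrable_inverse_square)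
  then show "integrable lborel f"
    by (rule Bochner_Integration.integrable_bound) (auto intro!: AE_I2 order_trans[OF C] simp: abs_if)
  show "norm (f x) \<le> C" for x
  proof (rule order_trans[OF C])
    have "C / (1 + x\<^sup>2) \<le> C / 1" using \<open>0 \<le> C\<close> by (intro divide_left_mono) (auto simp: add_pos_nonneg)
    then show "C / (1 + x\<^sup>2) \<le> C" by simp
  qed
qed

lemma schwartz_L12: "\<phi> \<in> schwartz \<Longrightarrow> L12 \<phi>"
  using schwartz_bound L12_quadratic_decay schwartz_measurable by blast

lemma ft_vderiv: "\<phi> \<in> schwartz \<Longrightarrow> ft (vderiv \<phi>) \<xi> = \<i> * complex_of_real \<xi> * ft \<phi> \<xi>"
  using schwartz_L12 schwartz_vderiv
  by (intro ft_deriv schwartz_has_vderiv schwartz_continuous) (auto simp: L12_def)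

text \<open>Two derivatives make \<xi>^2 times the transform bounded, which is enough decay for
  \<open>L12\<close>.\<close>

lemma ft_schwartz_L12:
  assumes \<phi>: "\<phi> \<in> schwartz" shows "L12 (ft \<phi>)"
proof (rule L12_quadratic_decay)
  have \<phi>'': "vderiv (vderiv \<phi>) \<in> schwartz" by (intro schwartz_vderiv \<phi>)
  show "ft \<phi> \<in> borel_measurable borel" using schwartz_measurable[OF \<phi>] by measurable
  define C where "C = (LINT x|lborel. norm (\<phi> x)) + (LINT x|lborel. norm (vderiv (vderiv \<phi>) x))"
  fix \<xi>
  have "ft (vderiv (vderiv \<phi>)) \<xi> = - complex_of_real (\<xi>\<^sup>2) * ft \<phi> \<xi>"
    by (simp add: ft_vderiv \<phi> schwartz_vderiv power2_eq_square algebra_simps)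
  then have "norm (ft (vderiv (vderiv \<phi>)) \<xi>) = \<xi>\<^sup>2 * norm (ft \<phi> \<xi>)" by (simp add: norm_mult norm_power)
  then have "norm (ft \<phi> \<xi>) * (1 + \<xi>\<^sup>2) \<le> C"
    using norm_ft_le[of \<phi> \<xi>] norm_ft_le[of "vderiv (vderiv \<phi>)" \<xi>] unfolding C_def by (simp add: algebra_simps)
  moreover have "0 < 1 + \<xi>\<^sup>2" by (simp add: add_pos_nonneg)
  ultimately show "norm (ft \<phi> \<xi>) \<le> C / (1 + \<xi>\<^sup>2)" by (simp add: pos_le_divide_eq)
qed

lemma sq_int_mult_ft_schwartz:
  assumes \<phi>: "\<phi> \<in> schwartz" shows "sq_int (\<lambda>\<xi>. complex_of_real \<xi> * ft \<phi> \<xi>)"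
proof -
  have "sq_int (\<lambda>\<xi>. - \<i> * ft (vderiv \<phi>) \<xi>)"
    by (intro sq_int_cmult Bessel schwartz_L12 schwartz_vderiv \<phi>)
  then show ?thesis by (simp add: ft_vderiv[OF \<phi>] mult.assoc[symmetric])
qed

section \<open>Schwartz space as a vector space containing the Gaussians\<close>

lemma funpow_vderiv_add:
  assumes "f \<in> schwartz" "g \<in> schwartz"
  shows "(vderiv ^^ k) (\<lambda>x. f x + g x) = (\<lambda>x. (vderiv ^^ k) f x + (vderiv ^^ k) g x)"
proof (induction k)
  case (Suc k)
  have "((vderiv ^^ k) h has_vector_derivative vderiv ((vderiv ^^ k) h) x) (at x)" if "h \<in> schwartz" for h x
    using that by (auto simp: schwartz_def vderiv_def vector_derivative_works)
  from has_vector_derivative_add[OF this[OF assms(1)] this[OF assms(2)]]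
  have "vderiv (\<lambda>x. (vderiv ^^ k) f x + (vderiv ^^ k) g x) = (\<lambda>x. vderiv ((vderiv ^^ k) f) x + vderiv ((vderiv ^^ k) g) x)"
    unfolding vderiv_def[of "\<lambda>x. _ x + _ x"] by (intro ext vector_derivative_at)
  then show ?case by (simp add: Suc)
qed simp

lemma schwartz_add:
  assumes "f \<in> schwartz" "g \<in> schwartz" shows "(\<lambda>x. f x + g x) \<in> schwartz"
  unfolding schwartz_def
proof (intro CollectI allI conjI)
  fix k m x
  have fg: "(vderiv ^^ k) f differentiable at x" "(vderiv ^^ k) g differentiable at x"
    "bounded (range (\<lambda>x. x ^ m *\<^sub>R (vderiv ^^ k) f x))" "bounded (range (\<lambda>x. x ^ m *\<^sub>R (vderiv ^^ k) g x))" for x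
    using assms by (auto simp: schwartz_def)
  show "(vderiv ^^ k) (\<lambda>x. f x + g x) differentiable at x"
    unfolding funpow_vderiv_add[OF assms] using fg by (intro differentiable_add)
  show "bounded (range (\<lambda>x. x ^ m *\<^sub>R (vderiv ^^ k) (\<lambda>x. f x + g x) x))"
    unfolding funpow_vderiv_add[OF assms] scaleR_add_right by (intro bounded_plus_comp fg)
qed

lemma funpow_vderiv_cmult:
  assumes "f \<in> schwartz"
  shows "(vderiv ^^ k) (\<lambda>x. c * f x) = (\<lambda>x. c * (vderiv ^^ k) f x)"
proof (induction k)
  case (Suc k)
  have "((vderiv ^^ k) f has_vector_derivative vderiv ((vderiv ^^ k) f) x) (at x)" for x
    using assms by (auto simp: schwartz_def vderiv_def vector_derivative_works)
  then have "((\<lambda>x. c * (vderiv ^^ k) f x) has_vector_derivative c * vderiv ((vderiv ^^ k) f) x) (at x)" for x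
    by (rule has_vector_derivative_mult_right)
  then have "vderiv (\<lambda>x. c * (vderiv ^^ k) f x) = (\<lambda>x. c * vderiv ((vderiv ^^ k) f) x)"
    unfolding vderiv_def[of "\<lambda>x. c * _ x"] by (intro ext vector_derivative_at)
  then show ?case by (simp add: Suc)
qed simp

lemma schwartz_cmult:
  assumes "f \<in> schwartz" shows "(\<lambda>x. c * f x) \<in> schwartz"
  unfolding schwartz_def
proof (intro CollectI allI conjI)
  fix k m x
  have f: "(vderiv ^^ k) f differentiable at x"
    "bounded (range (\<lambda>x. x ^ m *\<^sub>R (vderiv ^^ k) f x))" for x
    using assms by (auto simp: schwartz_def)
  show "(vderiv ^^ k) (\<lambda>x. c * f x) differentiable at x"
    unfolding funpow_vderiv_cmult[OF assms] using f by (intro differentiable_mult) auto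
  have "bounded (range (\<lambda>x. c * (x ^ m *\<^sub>R (vderiv ^^ k) f x)))"
    using bounded_linear_image[OF f(2) bounded_linear_mult_right[of c]] by (simp add: image_image)
  then show "bounded (range (\<lambda>x. x ^ m *\<^sub>R (vderiv ^^ k) (\<lambda>x. c * f x) x))"
    unfolding funpow_vderiv_cmult[OF assms] by simp
qed

lemma poly_gauss_bounded: "\<exists>C. \<forall>y. \<bar>poly q y * exp (- y\<^sup>2 / 2)\<bar> \<le> (C :: real)"
proof -
  \<comment> \<open>The power series gives |y|^n \<le> n! exp |y|, and |y| - y^2 / 2 \<le>
    1/2.\<close>
  have mono: "\<bar>y\<bar> ^ n * exp (- y\<^sup>2 / 2) \<le> fact n * exp (1/2)" for n and y :: real
  proof -
    have "\<bar>y\<bar> ^ n / fact n \<le> exp \<bar>y\<bar>"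
    proof -
      have "(\<Sum>i\<in>{n}. \<bar>y\<bar> ^ i /\<^sub>R fact i) \<le> (\<Sum>i. \<bar>y\<bar> ^ i /\<^sub>R fact i)"
        by (intro sum_le_suminf summable_exp_generic) auto
      then show ?thesis by (simp add: exp_def divide_inverse mult.commute)
    qed
    then have "\<bar>y\<bar> ^ n \<le> fact n * exp \<bar>y\<bar>" by (simp add: field_simps)
    then have "\<bar>y\<bar> ^ n * exp (- y\<^sup>2 / 2) \<le> fact n * exp \<bar>y\<bar> * exp (- y\<^sup>2 / 2)" by (intro mult_right_mono) auto
    also have "\<dots> = fact n * exp (\<bar>y\<bar> - y\<^sup>2 / 2)" by (simp add: mult.assoc mult_exp_exp)
    also have "\<dots> \<le> fact n * exp (1/2)"
      using zero_le_power2[of "\<bar>y\<bar> - 1"] by (intro mult_left_mono) (auto simp: power2_diff)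
    finally show ?thesis .
  qed
  have "\<bar>poly q y * exp (- y\<^sup>2 / 2)\<bar> \<le> (\<Sum>i\<le>degree q. \<bar>coeff q i\<bar> * (fact i * exp (1/2)))" for y
  proof -
    have "\<bar>poly q y * exp (- y\<^sup>2 / 2)\<bar> = \<bar>\<Sum>i\<le>degree q. coeff q i * y ^ i * exp (- y\<^sup>2 / 2)\<bar>"
      by (simp add: poly_altdef sum_distrib_right)
    also have "\<dots> \<le> (\<Sum>i\<le>degree q. \<bar>coeff q i * y ^ i * exp (- y\<^sup>2 / 2)\<bar>)" by (rule sum_abs)
    also have "\<dots> = (\<Sum>i\<le>degree q. \<bar>coeff q i\<bar> * (\<bar>y\<bar> ^ i * exp (- y\<^sup>2 / 2)))"
      by (simp add: abs_mult power_abs mult.assoc)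
    also have "\<dots> \<le> (\<Sum>i\<le>degree q. \<bar>coeff q i\<bar> * (fact i * exp (1/2)))"
      by (intro sum_mono mult_left_mono mono) auto
    finally show ?thesis .
  qed
  then show ?thesis by blast
qed

text \<open>Transforms of modulated Gaussians have this form and must be Schwartz to be admissible
  in the definition of the weak derivative. Each derivative is a polynomial times the same
  Gaussian.\<close>

lemma schwartz_gauss: "(\<lambda>x. complex_of_real (exp (- (t + x)\<^sup>2 / 2))) \<in> schwartz"
proof -
  define g where "g = (\<lambda>x. complex_of_real (exp (- (t + x)\<^sup>2 / 2)))"
  have deriv: "((\<lambda>x. complex_of_real (poly p x * exp (- (t + x)\<^sup>2 / 2))) has_vector_derivative
      complex_of_real (poly (pderiv p - [:t, 1:] * p) x * exp (- (t + x)\<^sup>2 / 2))) (at x)" for p x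
  proof -
    have "((\<lambda>x. exp (- (t + x)\<^sup>2 / 2)) has_real_derivative - (t + x) * exp (- (t + x)\<^sup>2 / 2)) (at x)"
      by (auto intro!: derivative_eq_intros simp: field_simps)
    from DERIV_mult[OF poly_DERIV[of p x] this]
    have "((\<lambda>x. poly p x * exp (- (t + x)\<^sup>2 / 2)) has_real_derivative
      (poly (pderiv p - [:t, 1:] * p) x * exp (- (t + x)\<^sup>2 / 2))) (at x)"
      by (rule DERIV_cong) (simp add: ring_distribs)
    then have "((\<lambda>x. poly p x * exp (- (t + x)\<^sup>2 / 2)) has_vector_derivative
      (poly (pderiv p - [:t, 1:] * p) x * exp (- (t + x)\<^sup>2 / 2))) (at x)"
      by (simp only: has_real_derivative_iff_has_vector_derivative)
    from bounded_linear.has_vector_derivative[OF bounded_linear_of_real this] show ?thesis .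
  qed
  have form: "\<exists>p. (vderiv ^^ k) g = (\<lambda>x. complex_of_real (poly p x * exp (- (t + x)\<^sup>2 / 2)))" for k
  proof (induction k)
    case 0
    show ?case by (intro exI[of _ 1]) (simp add: g_def)
  next
    case (Suc k)
    then obtain p where p: "(vderiv ^^ k) g = (\<lambda>x. complex_of_real (poly p x * exp (- (t + x)\<^sup>2 / 2)))" by blast
    have "vderiv ((vderiv ^^ k) g) = (\<lambda>x. complex_of_real (poly (pderiv p - [:t, 1:] * p) x * exp (- (t + x)\<^sup>2 / 2)))"
      unfolding p vderiv_def by (intro ext vector_derivative_at deriv)
    then show ?case by (intro exI[of _ "pderiv p - [:t, 1:] * p"]) (simp only: funpow.simps o_def)
  qed
  show ?thesis unfolding schwartz_def g_def[symmetric]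
  proof (intro CollectI allI conjI)
    fix k m x
    obtain p where p: "(vderiv ^^ k) g = (\<lambda>x. complex_of_real (poly p x * exp (- (t + x)\<^sup>2 / 2)))" using form by blast
    show "(vderiv ^^ k) g differentiable at x"
      unfolding p using deriv by (rule differentiableI_vector)
    \<comment> \<open>The polynomial is rewritten in the variable y = t + x, in which the uniform
      bound holds.\<close>
    obtain C where C: "\<And>y. \<bar>poly (pcompose (monom 1 m * p) [:-t, 1:]) y * exp (- y\<^sup>2 / 2)\<bar> \<le> C"
      using poly_gauss_bounded by blast
    have "norm (x ^ m *\<^sub>R (vderiv ^^ k) g x) \<le> C" for x
      using C[of "t + x"] unfolding p
      by (simp add: poly_pcompose poly_monom norm_mult norm_power abs_mult power_abs mult.assoc)
    then show "bounded (range (\<lambda>x. x ^ m *\<^sub>R (vderiv ^^ k) g x))" by (auto simp: bounded_iff)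
  qed
qed

section \<open>Fourier transforms of functions in \<open>H\<^sup>1\<close>\<close>

lemma mgauss_reflect: "mgauss t (- x) = mgauss (- t) x"
  by (simp add: mgauss_def)

text \<open>x times the Gaussian is minus its derivative, a Schwartz function, and the character
  does not change the modulus.\<close>

lemma L12_mult_mgauss: "L12 (\<lambda>x. complex_of_real x * mgauss t x)"
proof -
  have "(\<lambda>x. complex_of_real (exp (- x\<^sup>2 / 2))) \<in> schwartz" using schwartz_gauss[of 0] by simp
  then have "L12 (vderiv (\<lambda>x. complex_of_real (exp (- x\<^sup>2 / 2))))" by (intro schwartz_L12 schwartz_vderiv)
  moreover have "vderiv (\<lambda>x. complex_of_real (exp (- x\<^sup>2 / 2))) = (\<lambda>x. - (complex_of_real x * complex_of_real (exp (- x\<^sup>2 / 2))))"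
    unfolding vderiv_def
  proof (intro ext vector_derivative_at)
    fix x :: real
    have "((\<lambda>x. exp (- x\<^sup>2 / 2)) has_real_derivative - (x * exp (- x\<^sup>2 / 2))) (at x)"
      by (auto intro!: derivative_eq_intros)
    then have "((\<lambda>x. exp (- x\<^sup>2 / 2)) has_vector_derivative - (x * exp (- x\<^sup>2 / 2))) (at x)"
      by (simp only: has_real_derivative_iff_has_vector_derivative)
    from bounded_linear.has_vector_derivative[OF bounded_linear_of_real this]
    show "((\<lambda>x. complex_of_real (exp (- x\<^sup>2 / 2))) has_vector_derivative - (complex_of_real x * complex_of_real (exp (- x\<^sup>2 / 2)))) (at x)"
      by simp
  qed
  ultimately have *: "L12 (\<lambda>x. - (complex_of_real x * complex_of_real (exp (- x\<^sup>2 / 2))))" by simp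
  have eq: "complex_of_real x * mgauss t x = - (cis (- (t * x)) * (- (complex_of_real x * complex_of_real (exp (- x\<^sup>2 / 2)))))" for x
    by (simp add: mgauss_def)
  show ?thesis unfolding L12_def
  proof
    show "integrable lborel (\<lambda>x. complex_of_real x * mgauss t x)"
      unfolding eq using * by (intro integrable_minus ft_integrable) (simp add: L12_def)
    have "sq_int (\<lambda>x. cis (- (t * x)) * (- (complex_of_real x * complex_of_real (exp (- x\<^sup>2 / 2)))))"
      using * by (intro sq_int_bounded_mult[where C = 1]) (auto simp: L12_def)
    from sq_int_cmult[OF this, of "-1"] show "sq_int (\<lambda>x. complex_of_real x * mgauss t x)"
      by (simp add: eq)
  qed
qed

text \<open>The derivative of \<open>mgauss t\<close> is - (\<i> t + x) times itself; the rule for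
  transforms of derivatives is solved for the term with x.\<close>

lemma ft_mult_mgauss: "ft (\<lambda>x. complex_of_real x * mgauss t x) x = - \<i> * complex_of_real (t + x) * ft (mgauss t) x"
proof -
  define k' where "k' = (\<lambda>x. - \<i> * complex_of_real t * mgauss t x + (- 1) * (complex_of_real x * mgauss t x))"
  have i1: "integrable lborel (mgauss t)" and i2: "integrable lborel (\<lambda>x. complex_of_real x * mgauss t x)"
    using L12_mgauss L12_mult_mgauss by (auto simp: L12_def)
  have form: "mgauss t x = exp (- \<i> * complex_of_real t * complex_of_real x - (complex_of_real x)\<^sup>2 / 2)" for x
    by (simp add: mgauss_def cis_conv_exp mult_exp_exp algebra_simps flip: exp_of_real)
  have deriv: "(mgauss t has_vector_derivative k' x) (at x)" for x
  proof -
    have "((\<lambda>z. exp (- \<i> * complex_of_real t * z - z\<^sup>2 / 2)) has_field_derivative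
        (- \<i> * complex_of_real t - complex_of_real x) * exp (- \<i> * complex_of_real t * complex_of_real x - (complex_of_real x)\<^sup>2 / 2))
        (at (complex_of_real x))"
      by (auto intro!: derivative_eq_intros)
    from has_vector_derivative_real_field[OF this]
    have "((\<lambda>x. mgauss t x) has_vector_derivative (- \<i> * complex_of_real t - complex_of_real x) * mgauss t x) (at x)"
      by (simp only: form)
    then show ?thesis by (rule has_vector_derivative_eq_rhs) (simp add: k'_def algebra_simps)
  qed
  have "ft k' x = \<i> * complex_of_real x * ft (mgauss t) x"
  proof (rule ft_deriv[OF i1 _ deriv])
    show "integrable lborel k'" unfolding k'_def
      by (intro Bochner_Integration.integrable_add integrable_mult_right i1 i2)
    show "continuous_on UNIV k'" unfolding k'_def mgauss_def by (intro continuous_intros) auto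
  qed
  moreover have "ft k' x = - \<i> * complex_of_real t * ft (mgauss t) x + (- 1) * ft (\<lambda>x. complex_of_real x * mgauss t x) x"
    unfolding k'_def by (subst ft_add) (auto intro: i1 i2 simp only: ft_cmult integrable_mult_right)
  ultimately show ?thesis by (simp add: algebra_simps)
qed

lemma sq_int_inverse_sqrt: "sq_int (\<lambda>x. complex_of_real (1 / sqrt (1 + x\<^sup>2)))"
  using integrable_inverse_square
  by (simp add: sq_int_def power_divide add_nonneg_nonneg norm_divide)

text \<open>Testing on \<open>L12\<close> instead of Schwartz space admits translated transforms of
  Schwartz functions directly. The norm bound is carried along for the estimate of the derivative in
  \<open>H1_fourier\<close>.\<close>

definition fourier_L2 :: "(real \<Rightarrow> complex) \<Rightarrow> (real \<Rightarrow> complex) \<Rightarrow> bool" where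
  "fourier_L2 u V \<longleftrightarrow> sq_int u \<and> sq_int V \<and> n2 V \<le> 2 * pi * n2 u \<and>
     (\<forall>k. L12 k \<longrightarrow> (LINT x|lborel. u x * ft k x) = (LINT x|lborel. V x * k x))"

lemma fourier_L2_exists: "sq_int u \<Longrightarrow> \<exists>V. fourier_L2 u V"
  using L2_fourier_exists[of u] by (auto simp: fourier_L2_def)

text \<open>Tested on \<open>ft (mgauss t)\<close>, a Schwartz function whose derivative is - \<i>
  times the transform of x \<open>mgauss t\<close>: under the pairing the weak derivative becomes
  multiplication of \<open>V\<close> by \<i> \<xi>.\<close>

lemma fourier_L2_weak_deriv:
  assumes A: "fourier_L2 A V" and B: "fourier_L2 B W"
    and weak: "\<And>\<phi>. \<phi> \<in> schwartz \<Longrightarrow> (LINT x|lborel. B x * \<phi> x) = - (LINT x|lborel. A x * vderiv \<phi> x)"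
  shows "AE \<xi> in lborel. W \<xi> = \<i> * complex_of_real \<xi> * V \<xi>"
proof -
  have V: "sq_int V" and W: "sq_int W" using A B by (auto simp: fourier_L2_def)
  have [measurable]: "V \<in> borel_measurable borel" "W \<in> borel_measurable borel" using V W by auto
  have g: "sq_int (\<lambda>x. complex_of_real (exp (- x\<^sup>2 / 2)))" "sq_int (\<lambda>x. complex_of_real x * complex_of_real (exp (- x\<^sup>2 / 2)))"
    using L12_gauss L12_mult_mgauss[of 0] by (auto simp: L12_def mgauss_def)
  have "AE \<xi> in lborel. W \<xi> - \<i> * complex_of_real \<xi> * V \<xi> = 0"
  proof (rule zero_AE_mgauss)
    have "integrable lborel (\<lambda>x. W x * complex_of_real (exp (- x\<^sup>2 / 2)) - \<i> * (V x * (complex_of_real x * complex_of_real (exp (- x\<^sup>2 / 2)))))"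
      by (intro Bochner_Integration.integrable_diff integrable_mult_right sq_int_mult_integrable V W g)
    then show "integrable lborel (\<lambda>x. (W x - \<i> * complex_of_real x * V x) * complex_of_real (exp (- x\<^sup>2 / 2)))"
      by (simp add: algebra_simps)
    fix t
    have m: "sq_int (mgauss t)" "sq_int (\<lambda>x. complex_of_real x * mgauss t x)"
      using L12_mgauss L12_mult_mgauss by (auto simp: L12_def)
    have G: "ft (mgauss t) = (\<lambda>x. complex_of_real (sqrt (2 * pi)) * complex_of_real (exp (- (t + x)\<^sup>2 / 2)))"
      by (rule ext) (simp only: ft_mgauss of_real_mult)
    have GS: "ft (mgauss t) \<in> schwartz" unfolding G by (intro schwartz_cmult schwartz_gauss)
    have vG: "vderiv (ft (mgauss t)) x = - \<i> * ft (\<lambda>x. complex_of_real x * mgauss t x) x" for x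
    proof -
      have "((\<lambda>x. sqrt (2 * pi) * exp (- (t + x)\<^sup>2 / 2)) has_real_derivative - (t + x) * (sqrt (2 * pi) * exp (- (t + x)\<^sup>2 / 2))) (at x)"
        by (auto intro!: derivative_eq_intros simp: field_simps)
      then have "((\<lambda>x. sqrt (2 * pi) * exp (- (t + x)\<^sup>2 / 2)) has_vector_derivative - (t + x) * (sqrt (2 * pi) * exp (- (t + x)\<^sup>2 / 2))) (at x)"
        by (simp only: has_real_derivative_iff_has_vector_derivative)
      from vector_derivative_at[OF bounded_linear.has_vector_derivative[OF bounded_linear_of_real this]]
      show ?thesis unfolding vderiv_def ft_mult_mgauss ft_mgauss[abs_def]
        by (simp add: algebra_simps)
    qed
    have "(LINT x|lborel. W x * mgauss t x) = (LINT x|lborel. B x * ft (mgauss t) x)"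
      using B L12_mgauss by (auto simp: fourier_L2_def)
    also have "\<dots> = - (LINT x|lborel. A x * vderiv (ft (mgauss t)) x)" by (rule weak[OF GS])
    also have "\<dots> = \<i> * (LINT x|lborel. A x * ft (\<lambda>x. complex_of_real x * mgauss t x) x)"
      by (simp add: vG mult.left_commute[of _ \<i>])
    also have "(LINT x|lborel. A x * ft (\<lambda>x. complex_of_real x * mgauss t x) x) = (LINT x|lborel. V x * (complex_of_real x * mgauss t x))"
      using A L12_mult_mgauss by (auto simp: fourier_L2_def)
    finally have eq: "(LINT x|lborel. W x * mgauss t x) = \<i> * (LINT x|lborel. V x * (complex_of_real x * mgauss t x))" .
    have "(LINT x|lborel. (W x - \<i> * complex_of_real x * V x) * mgauss t x)
        = (LINT x|lborel. W x * mgauss t x - \<i> * (V x * (complex_of_real x * mgauss t x)))"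
      by (simp add: algebra_simps)
    also have "\<dots> = 0"
      using sq_int_mult_integrable[OF W m(1)] sq_int_mult_integrable[OF V m(2)] by (simp add: eq)
    finally show "(LINT x|lborel. (W x - \<i> * complex_of_real x * V x) * mgauss t x) = 0" .
  qed measurable
  then show ?thesis by eventually_elim simp
qed

text \<open>The Sobolev argument: \<open>V\<close> times the weight sqrt (1 + \<xi>^2) and the
  reciprocal of the weight are both square integrable. Hence elements of H^1 have integrable
  transforms.\<close>

lemma integrable_of_weighted:
  assumes V: "sq_int V" and xV: "sq_int (\<lambda>\<xi>. complex_of_real \<xi> * V \<xi>)"
  shows "integrable lborel V"
proof -
  have [measurable]: "V \<in> borel_measurable borel" using V by auto
  have sq: "sq_int (\<lambda>\<xi>. complex_of_real (sqrt (1 + \<xi>\<^sup>2)) * V \<xi>)"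
  proof (rule sq_int_bound)
    show "integrable lborel (\<lambda>\<xi>. (norm (V \<xi>))\<^sup>2 + (norm (complex_of_real \<xi> * V \<xi>))\<^sup>2)"
      using V xV by (intro Bochner_Integration.integrable_add sq_int_integrable)
    show "(norm (complex_of_real (sqrt (1 + \<xi>\<^sup>2)) * V \<xi>))\<^sup>2 \<le> (norm (V \<xi>))\<^sup>2 + (norm (complex_of_real \<xi> * V \<xi>))\<^sup>2" for \<xi>
      by (simp add: norm_mult power_mult_distrib add_nonneg_nonneg algebra_simps)
  qed measurable
  have "complex_of_real (1 / sqrt (1 + \<xi>\<^sup>2)) * (complex_of_real (sqrt (1 + \<xi>\<^sup>2)) * V \<xi>) = V \<xi>" for \<xi>
  proof -
    have "sqrt (1 + \<xi>\<^sup>2) \<noteq> 0" using add_pos_nonneg[of 1 "\<xi>\<^sup>2"] by simp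
    then show ?thesis by (simp del: real_sqrt_eq_zero_cancel_iff)
  qed
  then show ?thesis using sq_int_mult_integrable[OF sq_int_inverse_sqrt sq] by simp
qed

text \<open>The transform of \<open>B\<close> is replaced by the exact product \<i> \<xi>
  \<open>V\<close>, so that later identities hold at every frequency and not just almost
  everywhere.\<close>

lemma H1_fourier:
  assumes A: "sq_int A" and B: "sq_int B"
    and weak: "\<And>\<phi>. \<phi> \<in> schwartz \<Longrightarrow> (LINT x|lborel. B x * \<phi> x) = - (LINT x|lborel. A x * vderiv \<phi> x)"
  obtains V where "fourier_L2 A V" "fourier_L2 B (\<lambda>\<xi>. \<i> * (complex_of_real \<xi> * V \<xi>))" "integrable lborel V"
    "sq_int (\<lambda>\<xi>. complex_of_real \<xi> * V \<xi>)" "n2 (\<lambda>\<xi>. complex_of_real \<xi> * V \<xi>) \<le> 2 * pi * n2 B"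
proof -
  obtain V where V: "fourier_L2 A V" using fourier_L2_exists[OF A] by blast
  obtain W where W: "fourier_L2 B W" using fourier_L2_exists[OF B] by blast
  have [measurable]: "V \<in> borel_measurable borel" "W \<in> borel_measurable borel"
    using V W by (auto simp: fourier_L2_def)
  have ae: "AE \<xi> in lborel. W \<xi> = \<i> * (complex_of_real \<xi> * V \<xi>)"
    using fourier_L2_weak_deriv[OF V W weak] by (simp add: mult.assoc)
  have n_eq: "AE \<xi> in lborel. (norm (W \<xi>))\<^sup>2 = (norm (\<i> * (complex_of_real \<xi> * V \<xi>)))\<^sup>2"
    using ae by eventually_elim simp
  have sq: "sq_int (\<lambda>\<xi>. \<i> * (complex_of_real \<xi> * V \<xi>))"
    using W integrable_cong_AE[OF _ _ n_eq] by (simp add: fourier_L2_def sq_int_def)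
  have n2: "n2 W = n2 (\<lambda>\<xi>. \<i> * (complex_of_real \<xi> * V \<xi>))"
    unfolding n2_def by (intro Bochner_Integration.integral_cong_AE n_eq) measurable
  have pair: "(LINT x|lborel. W x * k x) = (LINT x|lborel. (\<i> * (complex_of_real x * V x)) * k x)" if "L12 k" for k
  proof (rule Bochner_Integration.integral_cong_AE)
    have [measurable]: "k \<in> borel_measurable borel" using that by (auto simp: L12_def)
    show "(\<lambda>x. W x * k x) \<in> borel_measurable lborel" by measurable
    show "(\<lambda>x. (\<i> * (complex_of_real x * V x)) * k x) \<in> borel_measurable lborel" by measurable
    show "AE x in lborel. W x * k x = (\<i> * (complex_of_real x * V x)) * k x" using ae by eventually_elim simp
  qed
  have FB: "fourier_L2 B (\<lambda>\<xi>. \<i> * (complex_of_real \<xi> * V \<xi>))"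
    using W sq pair by (simp add: fourier_L2_def n2)
  have xV: "sq_int (\<lambda>\<xi>. complex_of_real \<xi> * V \<xi>)"
    using sq_int_cmult[OF sq, of "-\<i>"] by (simp add: mult.assoc[symmetric])
  show ?thesis
  proof (rule that[OF V FB _ xV])
    show "integrable lborel V" using V xV by (intro integrable_of_weighted) (auto simp: fourier_L2_def)
    show "n2 (\<lambda>\<xi>. complex_of_real \<xi> * V \<xi>) \<le> 2 * pi * n2 B"
      using W n2 by (simp add: fourier_L2_def n2_cmult)
  qed
qed

text \<open>Makes A, up to a null set, an absolutely convergent Fourier integral. This allows A to
  be multiplied by a function whose transform need not be integrable.\<close>

lemma fourier_L2_inversion:
  assumes A: "fourier_L2 A V" and Vi: "integrable lborel V"
  shows "AE x in lborel. A x = complex_of_real (1 / (2 * pi)) * ft V (- x)"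
proof -
  have V: "L12 V" using A Vi by (simp add: fourier_L2_def L12_def)
  have A2: "sq_int A" using A by (simp add: fourier_L2_def)
  have F: "sq_int (\<lambda>x. ft V (- x))" by (intro sq_int_reflect Bessel V)
  have "AE x in lborel. A x - complex_of_real (1 / (2 * pi)) * ft V (- x) = 0"
  proof (rule zero_AE_mgauss_L2)
    show "sq_int (\<lambda>x. A x - complex_of_real (1 / (2 * pi)) * ft V (- x))"
      by (intro sq_int_diff A2 sq_int_cmult F)
    fix t
    have m: "sq_int (mgauss t)" using L12_mgauss by (simp add: L12_def)
    have K: "L12 (ft (mgauss (- t)))"
      using ft_mgauss_integrable Bessel[OF L12_mgauss] by (simp add: L12_def)
    have mg: "mgauss t x = complex_of_real (1 / (2 * pi)) * ft (ft (mgauss (- t))) x" for x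
      unfolding ft_ft_mgauss mgauss_reflect by simp
    have "(LINT x|lborel. A x * mgauss t x) = complex_of_real (1 / (2 * pi)) * (LINT x|lborel. A x * ft (ft (mgauss (- t))) x)"
      unfolding mg by (simp only: mult.left_commute[of "A _"] integral_mult_right_zero)
    also have "(LINT x|lborel. A x * ft (ft (mgauss (- t))) x) = (LINT x|lborel. V x * ft (mgauss (- t)) x)"
      using A K by (simp add: fourier_L2_def)
    also have "\<dots> = (LINT x|lborel. ft V x * mgauss (- t) x)"
      using Vi L12_mgauss by (intro ft_multiplication[symmetric]) (auto simp: L12_def)
    also have "\<dots> = (LINT x|lborel. ft V (- x) * mgauss t x)"
      using integral_reflect[of "\<lambda>x. ft V x * mgauss (- t) x"] by (simp add: mgauss_reflect)
    finally have *: "(LINT x|lborel. A x * mgauss t x) = complex_of_real (1 / (2 * pi)) * (LINT x|lborel. ft V (- x) * mgauss t x)" .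
    have "(LINT x|lborel. (A x - complex_of_real (1 / (2 * pi)) * ft V (- x)) * mgauss t x)
      = (LINT x|lborel. A x * mgauss t x - complex_of_real (1 / (2 * pi)) * (ft V (- x) * mgauss t x))"
      by (simp add: left_diff_distrib mult.assoc)
    also have "\<dots> = 0"
      using sq_int_mult_integrable[OF A2 m] sq_int_mult_integrable[OF F m] * by simp
    finally show "(LINT x|lborel. (A x - complex_of_real (1 / (2 * pi)) * ft V (- x)) * mgauss t x) = 0" .
  qed
  then show ?thesis by eventually_elim simp
qed

text \<open>The test function is the reflected and translated transform of \<phi>; by inversion, its
  own transform is 2 pi times a character times \<phi>.\<close>

lemma ft_mult_L2:
  assumes u: "fourier_L2 u V" and \<phi>: "L12 \<phi>" "integrable lborel (ft \<phi>)"
  shows "ft (\<lambda>x. u x * \<phi> x) \<zeta> = complex_of_real (1 / (2 * pi)) * (LINT \<xi>|lborel. V \<xi> * ft \<phi> (\<zeta> - \<xi>))"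
proof -
  have F: "L12 (ft \<phi>)" using \<phi>(2) Bessel[OF \<phi>(1)] by (simp add: L12_def)
  have [measurable]: "u \<in> borel_measurable borel" "\<phi> \<in> borel_measurable borel"
    using u \<phi> by (auto simp: fourier_L2_def L12_def)
  define k where "k = (\<lambda>\<xi>. ft \<phi> (\<zeta> - \<xi>))"
  have k: "L12 k"
    using lborel_integrable_real_affine[of "ft \<phi>" "-1" \<zeta>] lborel_integrable_real_affine[of "\<lambda>x. (norm (ft \<phi> x))\<^sup>2" "-1" \<zeta>] F
    by (auto simp: L12_def k_def sq_int_def)
  have ftk: "ft k x = cis (- (\<zeta> * x)) * ft (ft \<phi>) (- x)" for x
  proof -
    have "ft k x = (LINT \<xi>|lborel. cis (- (x * (\<zeta> - \<xi>))) * ft \<phi> \<xi>)"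
      using lborel_integral_real_affine[of "-1" "\<lambda>\<xi>. cis (- (x * \<xi>)) * k \<xi>" \<zeta>]
      unfolding ft_def[of k] by (simp add: k_def)
    also have "\<dots> = (LINT \<xi>|lborel. cis (- (\<zeta> * x)) * (cis (- (- x * \<xi>)) * ft \<phi> \<xi>))"
    proof -
      have "cis (- (x * (\<zeta> - \<xi>))) = cis (- (\<zeta> * x)) * cis (- (- x * \<xi>))" for \<xi>
        by (simp add: cis_mult algebra_simps)
      then show ?thesis by (simp only: mult.assoc)
    qed
    finally show ?thesis by (simp add: ft_def[of "ft \<phi>"])
  qed
  have "AE x in lborel. ft (ft \<phi>) (0 + (-1) * x) = complex_of_real (2 * pi) * \<phi> (- (0 + (-1) * x))"
    by (rule AE_borel_affine[OF _ _ ft_inversion[OF \<phi>]]) auto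
  then have ae: "AE x in lborel. u x * ft k x = complex_of_real (2 * pi) * (cis (- (\<zeta> * x)) * (u x * \<phi> x))"
    by eventually_elim (simp add: ftk mult_ac)
  have "(LINT \<xi>|lborel. V \<xi> * k \<xi>) = (LINT x|lborel. u x * ft k x)"
    using u k by (simp add: fourier_L2_def)
  also have "\<dots> = (LINT x|lborel. complex_of_real (2 * pi) * (cis (- (\<zeta> * x)) * (u x * \<phi> x)))"
    using k by (intro Bochner_Integration.integral_cong_AE ae) (auto simp: L12_def)
  also have "\<dots> = complex_of_real (2 * pi) * ft (\<lambda>x. u x * \<phi> x) \<zeta>"
    by (simp only: integral_mult_right_zero ft_def)
  finally show ?thesis by (simp add: k_def field_simps)
qed

text \<open>The estimates are carried out for Borel functions on \<open>lborel\<close>, where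
  Fubini's theorem and composition are available; this and the next lemma connect them with the
  Lebesgue-measurable functions of the theorem.\<close>

lemma lebesgue_borel_version:
  fixes f :: "real \<Rightarrow> complex"
  assumes f: "f \<in> borel_measurable lebesgue"
  obtains g where "g \<in> borel_measurable borel" "AE x in lebesgue. f x = g x"
proof -
  have "(\<lambda>x. Re (f x)) \<in> borel_measurable lebesgue" "(\<lambda>x. Im (f x)) \<in> borel_measurable lebesgue"
    using f by measurable
  from completion_ex_borel_measurable_real[OF this(1)] completion_ex_borel_measurable_real[OF this(2)]
  obtain r i where ri: "r \<in> borel_measurable lborel" "i \<in> borel_measurable lborel"
    "AE x in lborel. Re (f x) = r x" "AE x in lborel. Im (f x) = i x" by blast
  show ?thesis
  proof (rule that[of "\<lambda>x. complex_of_real (r x) + \<i> * complex_of_real (i x)"])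
    show "(\<lambda>x. complex_of_real (r x) + \<i> * complex_of_real (i x)) \<in> borel_measurable borel"
      using ri(1,2) by simp
    have "AE x in lborel. f x = complex_of_real (r x) + \<i> * complex_of_real (i x)"
      using ri(3,4) by eventually_elim (simp add: complex_eq_iff)
    then show "AE x in lebesgue. f x = complex_of_real (r x) + \<i> * complex_of_real (i x)"
      by (rule AE_completion)
  qed
qed

lemma lebesgue_lborel:
  fixes f g :: "real \<Rightarrow> 'a :: {banach, second_countable_topology}"
  assumes f: "f \<in> borel_measurable lebesgue" and g: "g \<in> borel_measurable borel" and ae: "AE x in lebesgue. f x = g x"
  shows "integrable lebesgue f \<longleftrightarrow> integrable lborel g" "(LINT x|lebesgue. f x) = (LINT x|lborel. g x)"
proof -
  have g': "g \<in> borel_measurable lebesgue" using g by (simp add: measurable_completion)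
  show "integrable lebesgue f \<longleftrightarrow> integrable lborel g"
    using integrable_cong_AE[OF f g' ae] integrable_completion[of g lborel] g by simp
  show "(LINT x|lebesgue. f x) = (LINT x|lborel. g x)"
    using Bochner_Integration.integral_cong_AE[OF f g' ae] integral_completion[of g lborel] g by simp
qed

section \<open>Harmonic extensions\<close>

text \<open>The mean value inequality turns the bound on the derivatives into the same bound on all
  difference quotients, and dominated convergence finishes.\<close>

lemma has_vector_derivative_integral:
  fixes f f' :: "real \<Rightarrow> real \<Rightarrow> complex"
  assumes \<delta>: "0 < \<delta>" and f: "\<And>t. \<bar>t - t0\<bar> < \<delta> \<Longrightarrow> integrable lborel (f t)"
    and deriv: "\<And>t \<xi>. \<bar>t - t0\<bar> < \<delta> \<Longrightarrow> ((\<lambda>t. f t \<xi>) has_vector_derivative f' t \<xi>) (at t)"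
    and g: "integrable lborel g" and bound: "\<And>t \<xi>. \<bar>t - t0\<bar> < \<delta> \<Longrightarrow> norm (f' t \<xi>) \<le> g \<xi>"
    and f'm [measurable]: "f' t0 \<in> borel_measurable borel"
  shows "((\<lambda>t. LINT \<xi>|lborel. f t \<xi>) has_vector_derivative (LINT \<xi>|lborel. f' t0 \<xi>)) (at t0)"
proof -
  have f'0: "integrable lborel (f' t0)"
    by (rule Bochner_Integration.integrable_bound[OF g])
       (use bound[of t0] \<delta> in \<open>auto intro!: AE_I2 order_trans[OF _ abs_ge_self]\<close>)
  have lip: "norm (f t \<xi> - f t0 \<xi>) \<le> \<bar>t - t0\<bar> * g \<xi>" if "\<bar>t - t0\<bar> < \<delta>" for t \<xi>
  proof -
    have "norm (f t \<xi> - f t0 \<xi>) \<le> g \<xi> * norm (t - t0)"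
    proof (rule differentiable_bound[of "ball t0 \<delta>"])
      show "((\<lambda>t. f t \<xi>) has_derivative (\<lambda>h. h *\<^sub>R f' s \<xi>)) (at s within ball t0 \<delta>)" if "s \<in> ball t0 \<delta>" for s
        using deriv[of s \<xi>] that
        by (auto simp: has_vector_derivative_def dist_real_def abs_minus_commute intro: has_derivative_at_withinI)
      show "onorm (\<lambda>h. h *\<^sub>R f' s \<xi>) \<le> g \<xi>" if "s \<in> ball t0 \<delta>" for s
        using bound[of s \<xi>] that by (intro onorm_le) (auto simp: dist_real_def abs_minus_commute mult.commute[of "g _"] mult_left_mono)
    qed (use that \<delta> in \<open>auto simp: dist_real_def abs_minus_commute\<close>)
    then show ?thesis by (simp add: mult.commute)
  qed
  have "((\<lambda>h. norm ((LINT \<xi>|lborel. f (t0 + h) \<xi>) - (LINT \<xi>|lborel. f t0 \<xi>) - h *\<^sub>R (LINT \<xi>|lborel. f' t0 \<xi>)) / norm h) \<longlongrightarrow> 0) (at 0)"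
    unfolding tendsto_at_iff_sequentially o_def
  proof (intro allI impI)
    fix h :: "nat \<Rightarrow> real"
    assume h0: "\<forall>i. h i \<in> UNIV - {0}" and hlim: "h \<longlonglongrightarrow> 0"
    have ev: "eventually (\<lambda>n. \<bar>h n\<bar> < \<delta>) sequentially"
      using tendstoD[OF hlim \<delta>] by (simp add: dist_real_def)
    \<comment> \<open>Dropping the first N terms keeps every increment within \<delta>, where
      integrability and the bound are available.\<close>
    then obtain N where N: "\<And>n. n \<ge> N \<Longrightarrow> \<bar>h n\<bar> < \<delta>" by (auto simp: eventually_sequentially)
    define q where "q = (\<lambda>n \<xi>. (f (t0 + h (n + N)) \<xi> - f t0 \<xi>) /\<^sub>R h (n + N) - f' t0 \<xi>)"
    have hN: "\<bar>h (n + N)\<bar> < \<delta>" "h (n + N) \<noteq> 0" for n using N h0 by auto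
    have fi: "integrable lborel (f (t0 + h (n + N)))" for n by (intro f) (use hN[of n] in auto)
    have f0: "integrable lborel (f t0)" by (intro f) (use \<delta> in auto)
    have [measurable]: "f (t0 + h (n + N)) \<in> borel_measurable borel" "f t0 \<in> borel_measurable borel" for n
      using fi[of n] f0 by auto
    have lim: "(\<lambda>n. LINT \<xi>|lborel. q n \<xi>) \<longlonglongrightarrow> integral\<^sup>L (lborel :: real measure) (\<lambda>_. 0)"
    proof (rule integral_dominated_convergence[where s = q and f = "\<lambda>_. 0" and w = "\<lambda>\<xi>. 2 * g \<xi>"])
      show "integrable lborel (\<lambda>\<xi>. 2 * g \<xi>)" using g by simp
      show "AE \<xi> in lborel. norm (q n \<xi>) \<le> 2 * g \<xi>" for n
      proof (rule AE_I2)
        fix \<xi>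
        have "norm (q n \<xi>) \<le> norm ((f (t0 + h (n + N)) \<xi> - f t0 \<xi>) /\<^sub>R h (n + N)) + norm (f' t0 \<xi>)"
          unfolding q_def by (rule norm_triangle_ineq4)
        also have "norm ((f (t0 + h (n + N)) \<xi> - f t0 \<xi>) /\<^sub>R h (n + N)) \<le> g \<xi>"
          using lip[of "t0 + h (n + N)" \<xi>] hN[of n] by (simp add: divide_simps mult.commute)
        also have "norm (f' t0 \<xi>) \<le> g \<xi>" using bound[of t0 \<xi>] \<delta> by simp
        finally show "norm (q n \<xi>) \<le> 2 * g \<xi>" by simp
      qed
      show "AE \<xi> in lborel. (\<lambda>n. q n \<xi>) \<longlonglongrightarrow> 0"
      proof (rule AE_I2)
        fix \<xi>
        have "((\<lambda>t. f t \<xi>) has_derivative (\<lambda>h. h *\<^sub>R f' t0 \<xi>)) (at t0)"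
          using deriv[of t0 \<xi>] \<delta> by (simp add: has_vector_derivative_def)
        then have "((\<lambda>h. norm (f (t0 + h) \<xi> - f t0 \<xi> - h *\<^sub>R f' t0 \<xi>) / norm h) \<longlongrightarrow> 0) (at 0)"
          by (simp add: has_derivative_at)
        then have "(\<lambda>n. norm (f (t0 + h n) \<xi> - f t0 \<xi> - h n *\<^sub>R f' t0 \<xi>) / norm (h n)) \<longlonglongrightarrow> 0"
          unfolding tendsto_at_iff_sequentially o_def using h0 hlim by blast
        then have "(\<lambda>n. norm (f (t0 + h (n + N)) \<xi> - f t0 \<xi> - h (n + N) *\<^sub>R f' t0 \<xi>) / norm (h (n + N))) \<longlonglongrightarrow> 0"
          by (rule LIMSEQ_ignore_initial_segment)
        moreover have "norm (f (t0 + h (n + N)) \<xi> - f t0 \<xi> - h (n + N) *\<^sub>R f' t0 \<xi>) / norm (h (n + N)) = norm (q n \<xi>)" for n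
        proof -
          have "f (t0 + h (n + N)) \<xi> - f t0 \<xi> - h (n + N) *\<^sub>R f' t0 \<xi> = h (n + N) *\<^sub>R q n \<xi>"
            using hN(2)[of n] by (simp add: q_def scaleR_diff_right)
          then show ?thesis using hN(2)[of n] by simp
        qed
        ultimately show "(\<lambda>n. q n \<xi>) \<longlonglongrightarrow> 0" by (simp add: tendsto_norm_zero_iff)
      qed
    qed (unfold q_def, measurable)
    have "norm (LINT \<xi>|lborel. q n \<xi>)
        = norm ((LINT \<xi>|lborel. f (t0 + h (n + N)) \<xi>) - (LINT \<xi>|lborel. f t0 \<xi>) - h (n + N) *\<^sub>R (LINT \<xi>|lborel. f' t0 \<xi>)) / norm (h (n + N))" for n
    proof -
      have "(LINT \<xi>|lborel. f (t0 + h (n + N)) \<xi>) - (LINT \<xi>|lborel. f t0 \<xi>) - h (n + N) *\<^sub>R (LINT \<xi>|lborel. f' t0 \<xi>) = h (n + N) *\<^sub>R (LINT \<xi>|lborel. q n \<xi>)"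
        unfolding q_def using fi[of n] f0 f'0 hN(2)[of n] by (simp add: scaleR_diff_right)
      then show ?thesis using hN(2)[of n] by simp
    qed
    with tendsto_norm[OF lim]
    have "(\<lambda>n. norm ((LINT \<xi>|lborel. f (t0 + h (n + N)) \<xi>) - (LINT \<xi>|lborel. f t0 \<xi>) - h (n + N) *\<^sub>R (LINT \<xi>|lborel. f' t0 \<xi>)) / norm (h (n + N))) \<longlonglongrightarrow> 0"
      by simp
    then show "(\<lambda>n. norm ((LINT \<xi>|lborel. f (t0 + h n) \<xi>) - (LINT \<xi>|lborel. f t0 \<xi>) - h n *\<^sub>R (LINT \<xi>|lborel. f' t0 \<xi>)) / norm (h n)) \<longlonglongrightarrow> 0"
      by (rule LIMSEQ_offset)
  qed
  then show ?thesis unfolding has_vector_derivative_def has_derivative_at by (auto intro: bounded_linear_scaleR_left)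
qed

definition damp :: "real \<Rightarrow> (real \<Rightarrow> complex) \<Rightarrow> real \<Rightarrow> complex" where
  "damp y W \<xi> = complex_of_real (exp (- (y * \<bar>\<xi>\<bar>))) * W \<xi>"

text \<open>\<open>PE W\<close> is the harmonic extension to the upper half plane of the Fourier transform of \<open>W\<close>. Since \<open>ft\<close> is
  applied twice, \<open>PE (ft f)\<close> is \<open>2 pi\<close> times the Poisson extension of the reflection of \<open>f\<close>.\<close>

definition PE :: "(real \<Rightarrow> complex) \<Rightarrow> real \<Rightarrow> real \<Rightarrow> complex" where
  "PE W y x = ft (damp y W) x"

text \<open>Integrability after any positive amount of damping. The class contains the bounded and
  the square-integrable functions and is stable under multipliers of linear growth, so the extension
  has derivatives of all orders at positive height.\<close>

definition exp_int :: "(real \<Rightarrow> complex) \<Rightarrow> bool" where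
  "exp_int W \<longleftrightarrow> W \<in> borel_measurable borel \<and> (\<forall>y>0. integrable lborel (damp y W))"

lemma exp_int_measurable [measurable_dest]: "exp_int W \<Longrightarrow> W \<in> borel_measurable borel"
  by (simp add: exp_int_def)

lemma damp_measurable [measurable]: "W \<in> borel_measurable borel \<Longrightarrow> damp y W \<in> borel_measurable borel"
  unfolding damp_def[abs_def] by measurable

lemma norm_damp: "norm (damp y W \<xi>) = exp (- (y * \<bar>\<xi>\<bar>)) * norm (W \<xi>)"
  by (simp add: damp_def norm_mult)

lemma L12_exp:
  assumes y: "0 < y" shows "L12 (\<lambda>\<xi>. complex_of_real (exp (- (y * \<bar>\<xi>\<bar>))))"
proof (rule L12_quadratic_decay)
  fix \<xi> :: real
  have t: "0 \<le> y * \<bar>\<xi>\<bar>" using y by simp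
  have 1: "1 + (y * \<bar>\<xi>\<bar>)\<^sup>2 / 2 \<le> exp (y * \<bar>\<xi>\<bar>)" using exp_lower_Taylor_quadratic[OF t] t by simp
  have "1 + \<xi>\<^sup>2 \<le> (1 + 2 / y\<^sup>2) * (1 + (y * \<bar>\<xi>\<bar>)\<^sup>2 / 2)"
    using y by (simp add: power_mult_distrib field_simps)
  also have "\<dots> \<le> (1 + 2 / y\<^sup>2) * exp (y * \<bar>\<xi>\<bar>)" using 1 by (intro mult_left_mono) auto
  finally have "exp (- (y * \<bar>\<xi>\<bar>)) * (1 + \<xi>\<^sup>2) \<le> exp (- (y * \<bar>\<xi>\<bar>)) * ((1 + 2 / y\<^sup>2) * exp (y * \<bar>\<xi>\<bar>))"
    by (intro mult_left_mono) auto
  also have "\<dots> = 1 + 2 / y\<^sup>2" by (simp add: exp_minus)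
  finally have "exp (- (y * \<bar>\<xi>\<bar>)) * (1 + \<xi>\<^sup>2) \<le> 1 + 2 / y\<^sup>2" .
  moreover have "0 < 1 + \<xi>\<^sup>2" by (simp add: add_pos_nonneg)
  ultimately show "norm (complex_of_real (exp (- (y * \<bar>\<xi>\<bar>)))) \<le> (1 + 2 / y\<^sup>2) / (1 + \<xi>\<^sup>2)"
    by (simp add: pos_le_divide_eq)
qed measurable

lemma exp_int_sq_int: "sq_int W \<Longrightarrow> exp_int W"
  unfolding exp_int_def damp_def[abs_def]
  using L12_exp by (auto intro!: sq_int_mult_integrable simp: L12_def)

lemma exp_int_bounded:
  assumes [measurable]: "W \<in> borel_measurable borel" and K: "\<And>\<xi>. norm (W \<xi>) \<le> K"
  shows "exp_int W"
  unfolding exp_int_def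
proof (intro conjI allI impI)
  fix y :: real assume y: "0 < y"
  have "integrable lborel (\<lambda>\<xi>. complex_of_real (exp (- (y * \<bar>\<xi>\<bar>))) * complex_of_real K)"
    using L12_exp[OF y] by (intro integrable_mult_left) (simp add: L12_def)
  then show "integrable lborel (damp y W)"
    by (rule Bochner_Integration.integrable_bound)
       (auto intro!: AE_I2 mult_left_mono order_trans[OF K abs_ge_self] simp: norm_damp norm_mult)
qed measurable

text \<open>Half of the damping absorbs one frequency, at the price 2 / y.\<close>

lemma mult_exp_le: "0 < y \<Longrightarrow> \<bar>\<xi>\<bar> * exp (- (y * \<bar>\<xi>\<bar>)) \<le> 2 / y * exp (- (y / 2 * \<bar>\<xi>\<bar>))" for y \<xi> :: real
proof -
  assume y: "0 < y"
  have "y / 2 * \<bar>\<xi>\<bar> \<le> exp (y / 2 * \<bar>\<xi>\<bar>)" using exp_ge_add_one_self[of "y / 2 * \<bar>\<xi>\<bar>"] by linarith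
  then have "\<bar>\<xi>\<bar> \<le> 2 / y * exp (y / 2 * \<bar>\<xi>\<bar>)" using y by (simp add: field_simps)
  then have "\<bar>\<xi>\<bar> * exp (- (y * \<bar>\<xi>\<bar>)) \<le> 2 / y * exp (y / 2 * \<bar>\<xi>\<bar>) * exp (- (y * \<bar>\<xi>\<bar>))"
    by (intro mult_right_mono) auto
  also have "\<dots> = 2 / y * exp (- (y / 2 * \<bar>\<xi>\<bar>))" by (simp add: mult.assoc mult_exp_exp)
  finally show ?thesis .
qed

lemma damp_mult_le:
  assumes y: "0 < y" and m: "norm (m \<xi>) \<le> \<bar>\<xi>\<bar>"
  shows "norm (damp y (\<lambda>\<xi>. m \<xi> * W \<xi>) \<xi>) \<le> 2 / y * norm (damp (y / 2) W \<xi>)"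
proof -
  have "norm (damp y (\<lambda>\<xi>. m \<xi> * W \<xi>) \<xi>) = (norm (m \<xi>) * exp (- (y * \<bar>\<xi>\<bar>))) * norm (W \<xi>)"
    by (simp add: norm_damp norm_mult)
  also have "\<dots> \<le> (\<bar>\<xi>\<bar> * exp (- (y * \<bar>\<xi>\<bar>))) * norm (W \<xi>)"
    using m by (intro mult_right_mono) auto
  also have "\<dots> \<le> (2 / y * exp (- (y / 2 * \<bar>\<xi>\<bar>))) * norm (W \<xi>)"
    by (intro mult_right_mono mult_exp_le y) auto
  finally show ?thesis by (simp add: norm_damp)
qed

lemma exp_int_mult:
  assumes W: "exp_int W" and m [measurable]: "m \<in> borel_measurable borel" and le: "\<And>\<xi>. norm (m \<xi>) \<le> \<bar>\<xi>\<bar>"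
  shows "exp_int (\<lambda>\<xi>. m \<xi> * W \<xi>)"
  unfolding exp_int_def
proof (intro conjI allI impI)
  have [measurable]: "W \<in> borel_measurable borel" using W by auto
  show "(\<lambda>\<xi>. m \<xi> * W \<xi>) \<in> borel_measurable borel" by measurable
  fix y :: real assume y: "0 < y"
  have le': "norm (damp y (\<lambda>\<xi>. m \<xi> * W \<xi>) \<xi>) \<le> norm (2 / y * norm (damp (y / 2) W \<xi>))" for \<xi>
    using order_trans[OF damp_mult_le[OF y, of m, OF le] abs_ge_self] by simp
  have "integrable lborel (\<lambda>\<xi>. 2 / y * norm (damp (y / 2) W \<xi>))"
    using W y by (intro integrable_mult_right integrable_norm) (simp add: exp_int_def)
  then show "integrable lborel (damp y (\<lambda>\<xi>. m \<xi> * W \<xi>))"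
    by (rule Bochner_Integration.integrable_bound)
       (use le' in auto)
qed

lemma PE_x_deriv:
  assumes W: "exp_int W" and y: "0 < y"
  shows "(PE W y has_vector_derivative PE (\<lambda>\<xi>. - \<i> * complex_of_real \<xi> * W \<xi>) y x) (at x)"
  unfolding PE_def[abs_def] ft_def
proof (rule has_vector_derivative_integral[of 1])
  have W': "exp_int (\<lambda>\<xi>. - \<i> * complex_of_real \<xi> * W \<xi>)"
    by (intro exp_int_mult W) (auto simp: norm_mult)
  have [measurable]: "W \<in> borel_measurable borel" using W by auto
  show "integrable lborel (\<lambda>\<xi>. cis (- (t * \<xi>)) * damp y W \<xi>)" for t
    using W y by (intro ft_integrable) (simp add: exp_int_def)
  show "integrable lborel (\<lambda>\<xi>. norm (damp y (\<lambda>\<xi>. - \<i> * complex_of_real \<xi> * W \<xi>) \<xi>))"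
    using W' y by (intro integrable_norm) (simp add: exp_int_def)
  show "norm (cis (- (t * \<xi>)) * damp y (\<lambda>\<xi>. - \<i> * complex_of_real \<xi> * W \<xi>) \<xi>) \<le> norm (damp y (\<lambda>\<xi>. - \<i> * complex_of_real \<xi> * W \<xi>) \<xi>)" for t \<xi>
    by (simp add: norm_mult)
  show "((\<lambda>t. cis (- (t * \<xi>)) * damp y W \<xi>) has_vector_derivative cis (- (t * \<xi>)) * damp y (\<lambda>\<xi>. - \<i> * complex_of_real \<xi> * W \<xi>) \<xi>) (at t)" for t \<xi>
  proof -
    have "((\<lambda>z. exp (- \<i> * complex_of_real \<xi> * z) * damp y W \<xi>) has_field_derivative
        - \<i> * complex_of_real \<xi> * exp (- \<i> * complex_of_real \<xi> * complex_of_real t) * damp y W \<xi>) (at (complex_of_real t))"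
      by (auto intro!: derivative_eq_intros)
    from has_vector_derivative_real_field[OF this] show ?thesis
      by (simp add: cis_conv_exp damp_def mult_ac)
  qed
qed (use assms in \<open>auto simp: exp_int_def\<close>)

lemma PE_y_deriv:
  assumes W: "exp_int W" and y: "0 < y"
  shows "((\<lambda>y. PE W y x) has_vector_derivative PE (\<lambda>\<xi>. - complex_of_real \<bar>\<xi>\<bar> * W \<xi>) y x) (at y)"
  unfolding PE_def[abs_def] ft_def
\<comment> \<open>Within distance y / 2 the height stays above y / 2, where the damping gives one
  majorant for all parameters.\<close>
proof (rule has_vector_derivative_integral[of "y / 2"])
  have W': "exp_int (\<lambda>\<xi>. - complex_of_real \<bar>\<xi>\<bar> * W \<xi>)"
    by (intro exp_int_mult W) (auto simp: norm_mult)
  have [measurable]: "W \<in> borel_measurable borel" using W by auto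
  show "integrable lborel (\<lambda>\<xi>. cis (- (x * \<xi>)) * damp t W \<xi>)" if "\<bar>t - y\<bar> < y / 2" for t
    using W that by (intro ft_integrable) (auto simp: exp_int_def abs_if split: if_splits)
  show "integrable lborel (\<lambda>\<xi>. norm (damp (y / 2) (\<lambda>\<xi>. - complex_of_real \<bar>\<xi>\<bar> * W \<xi>) \<xi>))"
    using W' y by (intro integrable_norm) (simp add: exp_int_def)
  show "norm (cis (- (x * \<xi>)) * damp t (\<lambda>\<xi>. - complex_of_real \<bar>\<xi>\<bar> * W \<xi>) \<xi>) \<le> norm (damp (y / 2) (\<lambda>\<xi>. - complex_of_real \<bar>\<xi>\<bar> * W \<xi>) \<xi>)"
    if "\<bar>t - y\<bar> < y / 2" for t \<xi>
  proof -
    have "y / 2 \<le> t" using that by (auto simp: abs_if split: if_splits)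
    then have "y / 2 * \<bar>\<xi>\<bar> \<le> t * \<bar>\<xi>\<bar>" by (intro mult_right_mono) auto
    then show ?thesis by (simp add: norm_mult norm_damp mult_right_mono)
  qed
  show "((\<lambda>t. cis (- (x * \<xi>)) * damp t W \<xi>) has_vector_derivative cis (- (x * \<xi>)) * damp t (\<lambda>\<xi>. - complex_of_real \<bar>\<xi>\<bar> * W \<xi>) \<xi>) (at t)" for t \<xi>
  proof -
    have "((\<lambda>z. cis (- (x * \<xi>)) * (exp (- (z * complex_of_real \<bar>\<xi>\<bar>)) * W \<xi>)) has_field_derivative
        cis (- (x * \<xi>)) * (- complex_of_real \<bar>\<xi>\<bar> * exp (- (complex_of_real t * complex_of_real \<bar>\<xi>\<bar>)) * W \<xi>)) (at (complex_of_real t))"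
      by (auto intro!: derivative_eq_intros)
    from has_vector_derivative_real_field[OF this] show ?thesis
      by (simp add: damp_def mult_ac flip: exp_of_real)
  qed
qed (use assms in \<open>auto simp: exp_int_def\<close>)

lemma PE_measurable [measurable]:
  assumes [measurable]: "W \<in> borel_measurable borel"
  shows "case_prod (PE W) \<in> borel_measurable (lborel \<Otimes>\<^sub>M lborel)"
  unfolding PE_def[abs_def] ft_def[abs_def] damp_def[abs_def] by measurable

lemma PE_norm_le: "norm (PE W y x) \<le> (LINT \<xi>|lborel. norm (damp y W \<xi>))"
  unfolding PE_def by (rule norm_ft_le)

lemma PE_norm_mono:
  assumes W: "exp_int W" and e: "0 < e" "e \<le> y"
  shows "norm (PE W y x) \<le> (LINT \<xi>|lborel. norm (damp e W \<xi>))"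
proof (rule order_trans[OF PE_norm_le integral_mono])
  show "integrable lborel (\<lambda>\<xi>. norm (damp y W \<xi>))" "integrable lborel (\<lambda>\<xi>. norm (damp e W \<xi>))"
    using W e by (auto simp: exp_int_def intro!: integrable_norm)
  show "norm (damp y W \<xi>) \<le> norm (damp e W \<xi>)" for \<xi>
    using e by (simp add: norm_damp mult_right_mono)
qed

section \<open>The Poisson kernel and boundedness of the extension\<close>

lemma poisson_kernel:
  assumes y: "0 < y"
  shows "ft (\<lambda>\<xi>. complex_of_real (exp (- (y * \<bar>\<xi>\<bar>)))) x = complex_of_real (2 * y / (x\<^sup>2 + y\<^sup>2))"
proof -
  \<comment> \<open>With c = y + \<i> x the integrand is exp (- c \<xi>) on the right half line and
    exp (cnj c \<xi>) on the left. The two integrals are 1 / c and 1 / cnj c, with sum 2 Re c /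
    |c|^2.\<close>
  define c where "c = Complex y x"
  have c0: "c \<noteq> 0" "cnj c \<noteq> 0" using y by (auto simp: c_def complex_eq_iff)
  define h where "h = (\<lambda>\<xi>. cis (- (x * \<xi>)) * complex_of_real (exp (- (y * \<bar>\<xi>\<bar>))))"
  have hi: "integrable lborel h" unfolding h_def using L12_exp[OF y] by (intro ft_integrable) (simp add: L12_def)
  have [measurable]: "h \<in> borel_measurable borel" using hi by auto
  have h_pos: "h \<xi> = exp (- (c * complex_of_real \<xi>))" if "0 \<le> \<xi>" for \<xi>
    using that by (simp add: h_def c_def cis_conv_exp Complex_eq mult_exp_exp algebra_simps flip: exp_of_real)
  have h_neg: "h \<xi> = exp (cnj c * complex_of_real \<xi>)" if "\<xi> \<le> 0" for \<xi>
    using that by (simp add: h_def c_def cis_conv_exp Complex_eq mult_exp_exp algebra_simps flip: exp_of_real)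
  have FT1: "(LINT \<xi>|lborel. indicator {0..real n} \<xi> *\<^sub>R h \<xi>) = (1 - exp (- (c * complex_of_real (real n)))) / c" for n
  proof -
    have "(LINT \<xi>|lborel. indicator {0..real n} \<xi> *\<^sub>R h \<xi>) = - exp (- (c * complex_of_real (real n))) / c - (- exp (- (c * complex_of_real 0)) / c)"
    proof (rule integral_FTC_Icc)
      fix \<xi> assume \<xi>: "0 \<le> \<xi>" "\<xi> \<le> real n"
      have "((\<lambda>z. - exp (- (c * z)) / c) has_field_derivative exp (- (c * complex_of_real \<xi>))) (at (complex_of_real \<xi>))"
        using c0 by (auto intro!: derivative_eq_intros)
      from has_vector_derivative_real_field[OF this]
      show "((\<lambda>\<xi>. - exp (- (c * complex_of_real \<xi>)) / c) has_vector_derivative h \<xi>) (at \<xi> within {0..real n})"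
        using \<xi> by (simp add: h_pos)
    qed (auto simp: h_def intro!: continuous_intros)
    then show ?thesis by (simp add: diff_divide_distrib)
  qed
  have FT2: "(LINT \<xi>|lborel. indicator {- real n..0} \<xi> *\<^sub>R h \<xi>) = (1 - exp (cnj c * complex_of_real (- real n))) / cnj c" for n
  proof -
    have "(LINT \<xi>|lborel. indicator {- real n..0} \<xi> *\<^sub>R h \<xi>) = exp (cnj c * complex_of_real 0) / cnj c - exp (cnj c * complex_of_real (- real n)) / cnj c"
    proof (rule integral_FTC_Icc)
      fix \<xi> assume \<xi>: "- real n \<le> \<xi>" "\<xi> \<le> 0"
      have "((\<lambda>z. exp (cnj c * z) / cnj c) has_field_derivative exp (cnj c * complex_of_real \<xi>)) (at (complex_of_real \<xi>))"
        using c0 by (auto intro!: derivative_eq_intros)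
      from has_vector_derivative_real_field[OF this]
      show "((\<lambda>\<xi>. exp (cnj c * complex_of_real \<xi>) / cnj c) has_vector_derivative h \<xi>) (at \<xi> within {- real n..0})"
        using \<xi> by (simp add: h_neg)
    qed (auto simp: h_def intro!: continuous_intros)
    then show ?thesis by (simp add: diff_divide_distrib)
  qed
  have e0: "(\<lambda>n. exp (- (y * real n))) \<longlonglongrightarrow> 0"
  proof -
    have "(\<lambda>n. exp (- y) ^ n) \<longlonglongrightarrow> 0" using y by (intro LIMSEQ_realpow_zero) auto
    then show ?thesis by (simp add: exp_of_nat_mult[symmetric] mult.commute)
  qed
  have l1: "(\<lambda>n. (1 - exp (- (c * complex_of_real (real n)))) / c) \<longlonglongrightarrow> (1 - 0) / c"
  proof (rule tendsto_divide[OF tendsto_diff[OF tendsto_const] tendsto_const c0(1)])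
    show "(\<lambda>n. exp (- (c * complex_of_real (real n)))) \<longlonglongrightarrow> 0"
      by (rule tendsto_norm_zero_cancel) (use e0 in \<open>simp add: c_def\<close>)
  qed
  have l2: "(\<lambda>n. (1 - exp (cnj c * complex_of_real (- real n))) / cnj c) \<longlonglongrightarrow> (1 - 0) / cnj c"
  proof (rule tendsto_divide[OF tendsto_diff[OF tendsto_const] tendsto_const c0(2)])
    show "(\<lambda>n. exp (cnj c * complex_of_real (- real n))) \<longlonglongrightarrow> 0"
      by (rule tendsto_norm_zero_cancel) (use e0 in \<open>simp add: c_def\<close>)
  qed
  have "(\<lambda>n. LINT \<xi>|lborel. (indicator {0..real n} \<xi> + indicator {- real n..0} \<xi>) *\<^sub>R h \<xi>) \<longlonglongrightarrow> (LINT \<xi>|lborel. h \<xi>)"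
  proof (rule integral_dominated_convergence)
    show "integrable lborel (\<lambda>\<xi>. 2 * norm (h \<xi>))" using hi by auto
    show "AE \<xi> in lborel. norm ((indicator {0..real n} \<xi> + indicator {- real n..0} \<xi>) *\<^sub>R h \<xi>) \<le> 2 * norm (h \<xi>)" for n
      by (intro AE_I2) (auto simp: indicator_def norm_mult intro!: mult_right_mono)
    \<comment> \<open>Both indicators count the point 0, so convergence can fail there.\<close>
    have "AE \<xi> in lborel. \<xi> \<noteq> (0::real)" by (rule AE_lborel_singleton)
    then show "AE \<xi> in lborel. (\<lambda>n. (indicator {0..real n} \<xi> + indicator {- real n..0} \<xi>) *\<^sub>R h \<xi>) \<longlonglongrightarrow> h \<xi>"
    proof eventually_elim
      case (elim \<xi>)
      obtain N :: nat where N: "\<bar>\<xi>\<bar> \<le> real N" using real_arch_simple by blast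
      have "eventually (\<lambda>n. h \<xi> = (indicator {0..real n} \<xi> + indicator {- real n..0} \<xi>) *\<^sub>R h \<xi>) sequentially"
        using eventually_ge_at_top[of N]
      proof eventually_elim
        case (elim n)
        then show ?case using N \<open>\<xi> \<noteq> 0\<close> by (auto simp: indicator_def)
      qed
      then show ?case by (rule Lim_transform_eventually[OF tendsto_const])
    qed
  qed measurable
  moreover have "(LINT \<xi>|lborel. (indicator {0..real n} \<xi> + indicator {- real n..0} \<xi>) *\<^sub>R h \<xi>)
      = (1 - exp (- (c * complex_of_real (real n)))) / c + (1 - exp (cnj c * complex_of_real (- real n))) / cnj c" for n
    unfolding FT1[symmetric] FT2[symmetric] scaleR_add_left
    by (intro Bochner_Integration.integral_add integrable_mult_indicator hi) auto
  ultimately have "(LINT \<xi>|lborel. h \<xi>) = (1 - 0) / c + (1 - 0) / cnj c"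
    using tendsto_add[OF l1 l2] LIMSEQ_unique by fastforce
  also have "\<dots> = (cnj c + c) / (c * cnj c)" using c0 by (simp add: field_simps)
  also have "\<dots> = complex_of_real (2 * y / (x\<^sup>2 + y\<^sup>2))"
    unfolding complex_mult_cnj by (simp add: c_def complex_eq_iff add.commute)
  finally show ?thesis by (simp add: ft_def h_def)
qed

lemma poisson_kernel_integral:
  assumes y: "0 < y"
  shows "has_bochner_integral lborel (\<lambda>x. 2 * y / (x\<^sup>2 + y\<^sup>2)) (2 * pi)"
proof -
  have "has_bochner_integral lborel (\<lambda>x. inverse (1 + x\<^sup>2)) pi"
    using integrable_inverse_1_plus_square LBINT_inverse_1_plus_square
    by (simp add: has_bochner_integral_iff set_integrable_def interval_lebesgue_integral_def set_lebesgue_integral_def)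
  then have "has_bochner_integral lborel (\<lambda>x. inverse (1 + (0 + (1 / y) * x)\<^sup>2)) (pi /\<^sub>R \<bar>1 / y\<bar>)"
    using y by (subst lborel_has_bochner_integral_real_affine_iff[symmetric]) auto
  then have "has_bochner_integral lborel (\<lambda>x. (2 / y) * inverse (1 + (0 + (1 / y) * x)\<^sup>2)) ((2 / y) * (pi /\<^sub>R \<bar>1 / y\<bar>))"
    by (rule has_bochner_integral_mult_right)
  also have "(\<lambda>x. (2 / y) * inverse (1 + (0 + (1 / y) * x)\<^sup>2)) = (\<lambda>x. 2 * y / (x\<^sup>2 + y\<^sup>2))"
  proof
    fix x
    have "x\<^sup>2 + y\<^sup>2 > 0" "y \<noteq> 0" "1 + (x / y)\<^sup>2 > 0" using y by (simp_all add: add_nonneg_pos add_pos_nonneg)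
    then show "(2 / y) * inverse (1 + (0 + (1 / y) * x)\<^sup>2) = 2 * y / (x\<^sup>2 + y\<^sup>2)"
      by (simp add: divide_simps) (simp add: power2_eq_square algebra_simps)
  qed
  finally show ?thesis using y by simp
qed

text \<open>The extension is a convolution with a positive kernel of mass 2 pi. This is how the
  supremum of f enters the estimate.\<close>

lemma PE_ft_bound:
  assumes f: "integrable lborel f" and M: "\<And>x. norm (f x) \<le> M" and y: "0 < y"
  shows "norm (PE (ft f) y x) \<le> 2 * pi * M"
proof -
  have e: "integrable lborel (\<lambda>\<xi>. complex_of_real (exp (- (y * \<bar>\<xi>\<bar>))))" using L12_exp[OF y] by (simp add: L12_def)
  define P where "P = (\<lambda>x. 2 * y / (x\<^sup>2 + y\<^sup>2))"
  have P: "integrable lborel P" "(LINT x|lborel. P x) = 2 * pi"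
    using poisson_kernel_integral[OF y] by (auto simp: P_def has_bochner_integral_iff)
  have P0: "0 \<le> P t" for t using y by (simp add: P_def add_nonneg_nonneg)
  have PE: "PE (ft f) y x = (LINT t|lborel. f t * complex_of_real (P (x + t)))"
    unfolding PE_def damp_def[abs_def] ft_mult_ft[OF e f] poisson_kernel[OF y] P_def ..
  have MP: "integrable lborel (\<lambda>t. M * P (x + t))" using integrable_shift[OF P(1), of x] by simp
  have le: "norm (f t * complex_of_real (P (x + t))) \<le> M * P (x + t)" for t
    using P0 by (simp add: norm_mult mult_right_mono M)
  have "norm (PE (ft f) y x) \<le> (LINT t|lborel. norm (f t * complex_of_real (P (x + t))))"
    unfolding PE by (rule integral_norm_bound)
  also have "\<dots> \<le> (LINT t|lborel. M * P (x + t))"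
  proof (rule integral_mono[OF _ MP le])
    show "integrable lborel (\<lambda>t. norm (f t * complex_of_real (P (x + t))))"
      by (rule Bochner_Integration.integrable_bound[OF MP])
         (use f P(1) order_trans[OF le abs_ge_self] in \<open>auto simp: P_def\<close>)
  qed
  also have "\<dots> = 2 * pi * M" using integral_shift[of P x] P(2) by simp
  finally show ?thesis .
qed

section \<open>A Carleson estimate for bounded functions\<close>

definition halfplane_integral :: "(real \<Rightarrow> real \<Rightarrow> real) \<Rightarrow> ennreal" where
  "halfplane_integral H = (\<integral>\<^sup>+y. \<integral>\<^sup>+x. ennreal (y * H y x) * indicator {0<..} y \<partial>lborel \<partial>lborel)"

text \<open>Square integrability is added to \<open>exp_int\<close> so that Bessel's inequality
  applies to the extension on each horizontal line.\<close>

definition exp_L12 :: "(real \<Rightarrow> complex) \<Rightarrow> bool" where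
  "exp_L12 W \<longleftrightarrow> W \<in> borel_measurable borel \<and> (\<forall>y>0. L12 (damp y W))"

lemma exp_L12_measurable [measurable_dest]: "exp_L12 W \<Longrightarrow> W \<in> borel_measurable borel"
  by (simp add: exp_L12_def)

lemma exp_L12_exp_int: "exp_L12 W \<Longrightarrow> exp_int W"
  by (simp add: exp_L12_def exp_int_def L12_def)

lemma exp_L12_sq_int:
  assumes W: "sq_int W" shows "exp_L12 W"
  unfolding exp_L12_def L12_def
proof (intro conjI allI impI)
  show [measurable]: "W \<in> borel_measurable borel" using W by auto
  fix y :: real assume y: "0 < y"
  show "integrable lborel (damp y W)" using exp_int_sq_int[OF W] y by (simp add: exp_int_def)
  show "sq_int (damp y W)"
    using y by (intro sq_int_mono[OF _ W]) (auto simp: norm_damp mult_left_le_one_le)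
qed

lemma exp_L12_bounded:
  assumes [measurable]: "W \<in> borel_measurable borel" and K: "\<And>\<xi>. norm (W \<xi>) \<le> K"
  shows "exp_L12 W"
  unfolding exp_L12_def
proof (intro conjI allI impI)
  fix y :: real assume y: "0 < y"
  show "L12 (damp y W)"
  proof (rule L12_bounded)
    show "integrable lborel (damp y W)" using exp_int_bounded[OF assms] y by (simp add: exp_int_def)
    have "0 \<le> K" using order_trans[OF norm_ge_zero K[of 0]] .
    then show "norm (damp y W \<xi>) \<le> K" for \<xi>
      using y mult_mono[of "exp (- (y * \<bar>\<xi>\<bar>))" 1 "norm (W \<xi>)" K] K[of \<xi>] by (simp add: norm_damp)
  qed
qed measurable

lemma exp_L12_mult:
  assumes W: "exp_L12 W" and m [measurable]: "m \<in> borel_measurable borel" and le: "\<And>\<xi>. norm (m \<xi>) \<le> \<bar>\<xi>\<bar>"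
  shows "exp_L12 (\<lambda>\<xi>. m \<xi> * W \<xi>)"
  unfolding exp_L12_def L12_def
proof (intro conjI allI impI)
  have [measurable]: "W \<in> borel_measurable borel" using W by auto
  show "(\<lambda>\<xi>. m \<xi> * W \<xi>) \<in> borel_measurable borel" by measurable
  fix y :: real assume y: "0 < y"
  show "integrable lborel (damp y (\<lambda>\<xi>. m \<xi> * W \<xi>))"
    using exp_int_mult[OF exp_L12_exp_int[OF W] m le] y by (simp add: exp_int_def)
  have 1: "sq_int (\<lambda>\<xi>. complex_of_real (2 / y) * damp (y / 2) W \<xi>)"
    using W y by (intro sq_int_cmult) (simp add: exp_L12_def L12_def)
  show "sq_int (damp y (\<lambda>\<xi>. m \<xi> * W \<xi>))"
  proof (rule sq_int_mono[OF _ 1])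
    show "norm (damp y (\<lambda>\<xi>. m \<xi> * W \<xi>) \<xi>) \<le> norm (complex_of_real (2 / y) * damp (y / 2) W \<xi>)" for \<xi>
      using damp_mult_le[OF y, of m \<xi> W, OF le] y by (simp add: norm_mult norm_divide)
  qed measurable
qed

section \<open>Plancherel on horizontal lines and square functions\<close>

lemma PE_L2:
  assumes "exp_L12 W" "0 < y"
  shows "sq_int (PE W y)" "n2 (PE W y) \<le> 2 * pi * n2 (damp y W)"
  using Bessel[of "damp y W"] assms by (auto simp: PE_def[abs_def] exp_L12_def)

lemma PE_L2_mono:
  assumes W: "exp_L12 W" and e: "0 < e" "e \<le> y"
  shows "n2 (PE W y) \<le> 2 * pi * n2 (damp e W)"
proof -
  have "n2 (damp y W) \<le> n2 (damp e W)"
    using W e by (intro n2_mono) (auto simp: exp_L12_def L12_def norm_damp mult_right_mono)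
  then have "2 * pi * n2 (damp y W) \<le> 2 * pi * n2 (damp e W)" by simp
  with PE_L2(2)[OF W] e show ?thesis by (meson le_less_trans less_le_trans order_trans)
qed

lemma n2_damp_le: "sq_int W \<Longrightarrow> 0 < y \<Longrightarrow> n2 (damp y W) \<le> n2 W"
  by (intro n2_mono) (auto simp: norm_damp mult_left_le_one_le)

text \<open>The value does not depend on a: the weight y balances exactly two frequency factors.
  Both the square function estimate and the formula for 1 / s^2 rest on this scale
  invariance.\<close>

lemma nn_integral_weight:
  assumes a: "0 < (a :: real)"
  shows "(\<integral>\<^sup>+y. ennreal (y * (a\<^sup>2 * exp (- (2 * y * a)))) * indicator {0..} y \<partial>lborel) = ennreal (1/4)"
proof -
  define F where "F = (\<lambda>y. - (1/4 * (2 * a * y) + 1/4) * exp (- (2 * a * y)))"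
  have "(\<integral>\<^sup>+y. ennreal (y * (a\<^sup>2 * exp (- (2 * y * a)))) * indicator {0..} y \<partial>lborel) = ennreal (0 - F 0)"
  proof (rule nn_integral_FTC_atLeast)
    show "DERIV F y :> y * (a\<^sup>2 * exp (- (2 * y * a)))" for y
      unfolding F_def by (auto intro!: derivative_eq_intros simp: power2_eq_square field_simps)
    have lin: "filterlim (\<lambda>y. 2 * a * y) at_top at_top"
      using a by (intro filterlim_tendsto_pos_mult_at_top[OF tendsto_const] filterlim_ident) auto
    have "((\<lambda>s. - (1/4 * (s ^ 1 / exp s) + 1/4 * (s ^ 0 / exp s))) \<longlongrightarrow> - (1/4 * 0 + 1/4 * 0)) (at_top :: real filter)"
      by (intro tendsto_intros tendsto_power_div_exp_0)
    from filterlim_compose[OF this lin]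
    show "(F \<longlongrightarrow> 0) at_top"
      by (simp add: F_def exp_minus field_simps)
  qed (auto simp: a)
  then show ?thesis by (simp add: F_def)
qed

text \<open>Bessel's inequality on each horizontal line, then Fubini. The integral in y contributes
  at most 1/4 at each frequency, whence the constant 2 pi / 4.\<close>

lemma halfplane_integral_square:
  assumes W: "sq_int W" and m [measurable]: "m \<in> borel_measurable borel" and le: "\<And>\<xi>. norm (m \<xi>) \<le> \<bar>\<xi>\<bar>"
  shows "halfplane_integral (\<lambda>y x. (norm (PE (\<lambda>\<xi>. m \<xi> * W \<xi>) y x))\<^sup>2) \<le> ennreal (pi / 2 * n2 W)"
proof -
  have [measurable]: "W \<in> borel_measurable borel" using W by auto
  define Z where "Z = (\<lambda>\<xi>. m \<xi> * W \<xi>)"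
  have Z: "exp_L12 Z" unfolding Z_def by (intro exp_L12_mult exp_L12_sq_int W m le)
  then have [measurable]: "Z \<in> borel_measurable borel" by auto
  define k where "k = (\<lambda>y \<xi>::real. y * (\<bar>\<xi>\<bar>\<^sup>2 * exp (- (2 * y * \<bar>\<xi>\<bar>))))"
  have inner: "(\<integral>\<^sup>+x. ennreal (y * (norm (PE Z y x))\<^sup>2) * indicator {0<..} y \<partial>lborel)
      \<le> (\<integral>\<^sup>+\<xi>. ennreal (2 * pi) * (ennreal ((norm (W \<xi>))\<^sup>2) * (ennreal (k y \<xi>) * indicator {0..} y)) \<partial>lborel)" for y
  proof (cases "0 < y")
    case y: True
    have "(\<integral>\<^sup>+x. ennreal (y * (norm (PE Z y x))\<^sup>2) * indicator {0<..} y \<partial>lborel) = ennreal (y * n2 (PE Z y))"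
      using y nn_integral_n2[OF PE_L2(1)[OF Z y]] PE_L2(1)[OF Z y]
      by (simp add: ennreal_mult nn_integral_cmult)
    also have "\<dots> \<le> ennreal (y * (2 * pi * n2 (damp y Z)))"
      using y by (intro ennreal_leI mult_left_mono PE_L2 Z) auto
    also have "\<dots> = ennreal (2 * pi * y) * (\<integral>\<^sup>+\<xi>. ennreal ((norm (damp y Z \<xi>))\<^sup>2) \<partial>lborel)"
      using y Z by (subst nn_integral_n2) (auto simp: exp_L12_def L12_def ennreal_mult[symmetric] mult_ac)
    also have "\<dots> = (\<integral>\<^sup>+\<xi>. ennreal (2 * pi * y) * ennreal ((norm (damp y Z \<xi>))\<^sup>2) \<partial>lborel)"
      by (subst nn_integral_cmult) auto
    also have "\<dots> \<le> (\<integral>\<^sup>+\<xi>. ennreal (2 * pi) * (ennreal ((norm (W \<xi>))\<^sup>2) * (ennreal (k y \<xi>) * indicator {0..} y)) \<partial>lborel)"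
    proof (rule nn_integral_mono)
      fix \<xi>
      have "(norm (damp y Z \<xi>))\<^sup>2 = exp (- (2 * y * \<bar>\<xi>\<bar>)) * ((norm (m \<xi>))\<^sup>2 * (norm (W \<xi>))\<^sup>2)"
        by (simp add: norm_damp Z_def norm_mult power_mult_distrib exp_double[symmetric] mult_ac)
      also have "\<dots> \<le> exp (- (2 * y * \<bar>\<xi>\<bar>)) * (\<bar>\<xi>\<bar>\<^sup>2 * (norm (W \<xi>))\<^sup>2)"
        using le[of \<xi>] by (intro mult_left_mono mult_right_mono power_mono) auto
      finally have "2 * pi * y * (norm (damp y Z \<xi>))\<^sup>2 \<le> 2 * pi * y * (exp (- (2 * y * \<bar>\<xi>\<bar>)) * (\<bar>\<xi>\<bar>\<^sup>2 * (norm (W \<xi>))\<^sup>2))"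
        using y by (intro mult_left_mono) auto
      also have "\<dots> = 2 * pi * ((norm (W \<xi>))\<^sup>2 * k y \<xi>)" by (simp add: k_def mult_ac)
      finally have "2 * pi * y * (norm (damp y Z \<xi>))\<^sup>2 \<le> 2 * pi * ((norm (W \<xi>))\<^sup>2 * k y \<xi>)" .
      moreover have "0 \<le> k y \<xi>" using y by (simp add: k_def)
      ultimately show "ennreal (2 * pi * y) * ennreal ((norm (damp y Z \<xi>))\<^sup>2)
          \<le> ennreal (2 * pi) * (ennreal ((norm (W \<xi>))\<^sup>2) * (ennreal (k y \<xi>) * indicator {0..} y))"
        using y by (simp add: ennreal_mult[symmetric] ennreal_leI del: ennreal_le_iff)
    qed
    finally show ?thesis .
  qed (simp add: indicator_def)
  have "halfplane_integral (\<lambda>y x. (norm (PE Z y x))\<^sup>2)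
      \<le> (\<integral>\<^sup>+y. \<integral>\<^sup>+\<xi>. ennreal (2 * pi) * (ennreal ((norm (W \<xi>))\<^sup>2) * (ennreal (k y \<xi>) * indicator {0..} y)) \<partial>lborel \<partial>lborel)"
    unfolding halfplane_integral_def by (intro nn_integral_mono inner)
  also have "\<dots> = (\<integral>\<^sup>+\<xi>. \<integral>\<^sup>+y. ennreal (2 * pi) * (ennreal ((norm (W \<xi>))\<^sup>2) * (ennreal (k y \<xi>) * indicator {0..} y)) \<partial>lborel \<partial>lborel)"
    unfolding k_def by (rule lborel_pair.Fubini') measurable
  also have "\<dots> \<le> (\<integral>\<^sup>+\<xi>. ennreal (2 * pi) * (ennreal ((norm (W \<xi>))\<^sup>2) * ennreal (1/4)) \<partial>lborel)"
  proof (rule nn_integral_mono)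
    fix \<xi> :: real
    have "(\<integral>\<^sup>+y. ennreal (k y \<xi>) * indicator {0..} y \<partial>lborel) \<le> ennreal (1/4)"
    proof (cases "\<xi> = 0")
      case False
      then show ?thesis using nn_integral_weight[of "\<bar>\<xi>\<bar>"] by (simp add: k_def)
    qed (simp add: k_def)
    moreover have "(\<integral>\<^sup>+y. ennreal (2 * pi) * (ennreal ((norm (W \<xi>))\<^sup>2) * (ennreal (k y \<xi>) * indicator {0..} y)) \<partial>lborel)
        = ennreal (2 * pi) * (ennreal ((norm (W \<xi>))\<^sup>2) * (\<integral>\<^sup>+y. ennreal (k y \<xi>) * indicator {0..} y \<partial>lborel))"
    proof -
      have [measurable]: "(\<lambda>y. k y \<xi>) \<in> borel_measurable borel" unfolding k_def by measurable
      show ?thesis by (simp add: nn_integral_cmult)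
    qed
    ultimately show "(\<integral>\<^sup>+y. ennreal (2 * pi) * (ennreal ((norm (W \<xi>))\<^sup>2) * (ennreal (k y \<xi>) * indicator {0..} y)) \<partial>lborel)
        \<le> ennreal (2 * pi) * (ennreal ((norm (W \<xi>))\<^sup>2) * ennreal (1/4))"
      by (auto intro!: mult_left_mono)
  qed
  also have "\<dots> = ennreal (2 * pi) * (ennreal (n2 W) * ennreal (1/4))"
    using nn_integral_n2[OF W] by (simp add: nn_integral_cmult nn_integral_multc)
  also have "\<dots> = ennreal (2 * pi * (n2 W * (1/4)))"
    by (subst ennreal_mult[symmetric] | simp)+
  finally show ?thesis by (simp add: Z_def mult_ac)
qed

text \<open>\<open>sq_d1\<close> and \<open>sq_d2\<close> are the first and second derivatives of \<open>|p|\<^sup>2 |q|\<^sup>2\<close> along a curve.\<close>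

definition sq_d1 :: "complex \<Rightarrow> complex \<Rightarrow> complex \<Rightarrow> complex \<Rightarrow> real" where
  "sq_d1 p p' q q' = 2 * (p \<bullet> p') * (q \<bullet> q) + 2 * (p \<bullet> p) * (q \<bullet> q')"

definition sq_d2 :: "complex \<Rightarrow> complex \<Rightarrow> complex \<Rightarrow> complex \<Rightarrow> complex \<Rightarrow> complex \<Rightarrow> real" where
  "sq_d2 p p' p'' q q' q'' = 2 * (p' \<bullet> p' + p \<bullet> p'') * (q \<bullet> q) + 8 * (p \<bullet> p') * (q \<bullet> q') + 2 * (p \<bullet> p) * (q' \<bullet> q' + q \<bullet> q'')"

lemma has_real_derivative_inner:
  fixes p q :: "real \<Rightarrow> complex"
  assumes "(p has_vector_derivative p') (at t)" "(q has_vector_derivative q') (at t)"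
  shows "((\<lambda>t. p t \<bullet> q t) has_real_derivative (p t \<bullet> q' + p' \<bullet> q t)) (at t)"
  using bounded_bilinear.has_vector_derivative[OF bounded_bilinear_inner assms]
  by (simp add: has_real_derivative_iff_has_vector_derivative)

lemma sq_d1_deriv:
  assumes "(p has_vector_derivative p') (at t)" "(q has_vector_derivative q') (at t)"
  shows "((\<lambda>t. (p t \<bullet> p t) * (q t \<bullet> q t)) has_real_derivative sq_d1 (p t) p' (q t) q') (at t)"
  by (rule DERIV_cong[OF DERIV_mult[OF has_real_derivative_inner[OF assms(1) assms(1)] has_real_derivative_inner[OF assms(2) assms(2)]]])
     (simp add: sq_d1_def inner_commute algebra_simps)

lemma sq_d2_deriv:
  assumes p: "(p has_vector_derivative p' t) (at t)" "(p' has_vector_derivative p'') (at t)"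
    and q: "(q has_vector_derivative q' t) (at t)" "(q' has_vector_derivative q'') (at t)"
  shows "((\<lambda>t. sq_d1 (p t) (p' t) (q t) (q' t)) has_real_derivative sq_d2 (p t) (p' t) p'' (q t) (q' t) q'') (at t)"
proof -
  note d = has_real_derivative_inner
  show ?thesis unfolding sq_d1_def
    by (rule DERIV_cong[OF DERIV_add[OF DERIV_mult[OF DERIV_cmult[OF d[OF p(1) p(2)]] d[OF q(1) q(1)]]
            DERIV_mult[OF DERIV_cmult[OF d[OF p(1) p(1)]] d[OF q(1) q(2)]]]])
       (simp add: sq_d2_def inner_commute algebra_simps)
qed

lemma norm_inner_self: "z \<bullet> z = (norm z)\<^sup>2" for z :: complex
  by (simp add: power2_norm_eq_inner)

lemma abs_inner_le: "\<bar>a \<bullet> b\<bar> \<le> norm a * norm b" for a b :: complex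
  by (rule Cauchy_Schwarz_ineq2)

text \<open>Makes the integrals in Green's formula absolutely convergent; this constant does not
  reach the final estimate.\<close>

lemma sq_d2_bound:
  assumes N: "norm p \<le> N" "norm p' \<le> K1" "norm p'' \<le> K2"
  shows "\<bar>sq_d2 p p' p'' q q' q''\<bar> \<le> (2 * (K1\<^sup>2 + N * K2) + 8 * N * K1 + 4 * N\<^sup>2) * ((norm q)\<^sup>2 + (norm q')\<^sup>2 + (norm q'')\<^sup>2)"
proof -
  define B where "B = (norm q)\<^sup>2 + (norm q')\<^sup>2 + (norm q'')\<^sup>2"
  have nn: "0 \<le> N" "0 \<le> K1" "0 \<le> K2" using N norm_ge_zero order_trans by blast+
  have B0: "0 \<le> B" by (simp add: B_def)
  have ab: "a * b \<le> a\<^sup>2 + b\<^sup>2" for a b :: real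
    using sum_squares_bound[of a b] zero_le_power2[of a] zero_le_power2[of b] by linarith
  have B1: "(norm q)\<^sup>2 \<le> B" "(norm q')\<^sup>2 \<le> B" "norm q * norm q' \<le> B" "norm q * norm q'' \<le> B"
    using ab[of "norm q" "norm q'"] ab[of "norm q" "norm q''"]
      zero_le_power2[of "norm q"] zero_le_power2[of "norm q'"] zero_le_power2[of "norm q''"]
    unfolding B_def by linarith+
  have p1: "norm p * norm p' \<le> N * K1" "norm p * norm p'' \<le> N * K2" "(norm p)\<^sup>2 \<le> N\<^sup>2" "(norm p')\<^sup>2 \<le> K1\<^sup>2"
    using N nn by (auto intro!: mult_mono power_mono)
  have t1: "\<bar>2 * (p' \<bullet> p' + p \<bullet> p'') * (q \<bullet> q)\<bar> \<le> 2 * (K1\<^sup>2 + N * K2) * B"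
  proof -
    have "\<bar>p' \<bullet> p' + p \<bullet> p''\<bar> \<le> K1\<^sup>2 + N * K2"
      using abs_inner_le[of p p''] p1 zero_le_power2[of "norm p'"] unfolding norm_inner_self by linarith
    then have "\<bar>p' \<bullet> p' + p \<bullet> p''\<bar> * (norm q)\<^sup>2 \<le> (K1\<^sup>2 + N * K2) * B"
      using B1 by (intro mult_mono) auto
    then show ?thesis unfolding norm_inner_self abs_mult abs_numeral abs_power2 mult.assoc by linarith
  qed
  have t2: "\<bar>8 * (p \<bullet> p') * (q \<bullet> q')\<bar> \<le> 8 * N * K1 * B"
  proof -
    have "\<bar>p \<bullet> p'\<bar> * \<bar>q \<bullet> q'\<bar> \<le> (N * K1) * B"
      using order_trans[OF abs_inner_le p1(1)] order_trans[OF abs_inner_le B1(3)] nn by (intro mult_mono) auto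
    then show ?thesis by (simp add: abs_mult mult.assoc)
  qed
  have t3: "\<bar>2 * (p \<bullet> p) * (q' \<bullet> q' + q \<bullet> q'')\<bar> \<le> 4 * N\<^sup>2 * B"
  proof -
    have "\<bar>q' \<bullet> q' + q \<bullet> q''\<bar> \<le> 2 * B"
      using abs_inner_le[of q q''] B1 zero_le_power2[of "norm q'"] unfolding norm_inner_self by linarith
    then have "(norm p)\<^sup>2 * \<bar>q' \<bullet> q' + q \<bullet> q''\<bar> \<le> N\<^sup>2 * (2 * B)"
      using p1 by (intro mult_mono) auto
    then show ?thesis by (simp add: abs_mult norm_inner_self mult_ac)
  qed
  have "\<bar>sq_d2 p p' p'' q q' q''\<bar> \<le> 2 * (K1\<^sup>2 + N * K2) * B + 8 * N * K1 * B + 4 * N\<^sup>2 * B"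
    unfolding sq_d2_def using t1 t2 t3 by linarith
  then show ?thesis by (simp add: B_def ring_distribs)
qed

text \<open>The Laplacian of \<open>|u|\<^sup>2 |w|\<^sup>2\<close> for harmonic \<open>u\<close>, \<open>w\<close>; the cross terms are absorbed by the arithmetic-geometric
  mean inequality.\<close>

lemma laplace_lower:
  "(norm ux)\<^sup>2 * (norm w)\<^sup>2 + (norm uy)\<^sup>2 * (norm w)\<^sup>2 - 16 * (norm u)\<^sup>2 * ((norm wx)\<^sup>2 + (norm wy)\<^sup>2)
    \<le> sq_d2 u ux uxx w wx wxx + sq_d2 u uy (- uxx) w wy (- wxx)"
proof -
  \<comment> \<open>8 a b \<le> a^2 + 16 b^2: the cross terms use up one of the two copies of
    |\<nabla> u|^2 |w|^2 in the Laplacian, and this is the origin of the 16.\<close>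
  have cross: "- ((norm v)\<^sup>2 * (norm w)\<^sup>2 + 16 * ((norm u)\<^sup>2 * (norm z)\<^sup>2)) \<le> 8 * (u \<bullet> v) * (w \<bullet> z)" for v z
  proof -
    have "8 * ((norm v * norm w) * (norm u * norm z)) \<le> (norm v * norm w)\<^sup>2 + 16 * (norm u * norm z)\<^sup>2"
      using zero_le_power2[of "norm v * norm w - 4 * (norm u * norm z)"] by (simp add: power2_diff power_mult_distrib)
    moreover have "\<bar>u \<bullet> v\<bar> * \<bar>w \<bullet> z\<bar> \<le> (norm u * norm v) * (norm w * norm z)"
      by (intro mult_mono abs_inner_le) auto
    moreover have "- (8 * (\<bar>u \<bullet> v\<bar> * \<bar>w \<bullet> z\<bar>)) \<le> 8 * (u \<bullet> v) * (w \<bullet> z)"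
      using abs_ge_minus_self[of "(u \<bullet> v) * (w \<bullet> z)"] by (simp add: abs_mult)
    ultimately show ?thesis by (simp add: power_mult_distrib mult_ac)
  qed
  have "0 \<le> (norm u)\<^sup>2 * ((norm wx)\<^sup>2 + (norm wy)\<^sup>2)" by simp
  moreover have "(norm u)\<^sup>2 * ((norm wx)\<^sup>2 + (norm wy)\<^sup>2) = (norm u)\<^sup>2 * (norm wx)\<^sup>2 + (norm u)\<^sup>2 * (norm wy)\<^sup>2"
    by (rule distrib_left)
  moreover have "sq_d2 u ux uxx w wx wxx + sq_d2 u uy (- uxx) w wy (- wxx)
      = 2 * ((norm ux)\<^sup>2 * (norm w)\<^sup>2) + 2 * ((norm uy)\<^sup>2 * (norm w)\<^sup>2)
        + 8 * (u \<bullet> ux) * (w \<bullet> wx) + 8 * (u \<bullet> uy) * (w \<bullet> wy) + 2 * ((norm u)\<^sup>2 * ((norm wx)\<^sup>2 + (norm wy)\<^sup>2))"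
    by (simp add: sq_d2_def norm_inner_self algebra_simps)
  ultimately show ?thesis using cross[of ux wx] cross[of uy wy] by linarith
qed

text \<open>The symbols of the two partial derivatives of the extension.\<close>

definition dx :: "(real \<Rightarrow> complex) \<Rightarrow> real \<Rightarrow> complex" where
  "dx W \<xi> = - \<i> * complex_of_real \<xi> * W \<xi>"

definition dy :: "(real \<Rightarrow> complex) \<Rightarrow> real \<Rightarrow> complex" where
  "dy W \<xi> = - complex_of_real \<bar>\<xi>\<bar> * W \<xi>"

lemma dx_measurable [measurable]: "W \<in> borel_measurable borel \<Longrightarrow> dx W \<in> borel_measurable borel"
  unfolding dx_def[abs_def] by measurable

lemma dy_measurable [measurable]: "W \<in> borel_measurable borel \<Longrightarrow> dy W \<in> borel_measurable borel"
  unfolding dy_def[abs_def] by measurable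

lemma exp_L12_dx: "exp_L12 W \<Longrightarrow> exp_L12 (dx W)"
  unfolding dx_def[abs_def] by (intro exp_L12_mult) (auto simp: norm_mult)

lemma exp_L12_dy: "exp_L12 W \<Longrightarrow> exp_L12 (dy W)"
  unfolding dy_def[abs_def] by (intro exp_L12_mult) (auto simp: norm_mult)

lemma PE_dx: "exp_L12 W \<Longrightarrow> 0 < y \<Longrightarrow> (PE W y has_vector_derivative PE (dx W) y x) (at x)"
  using PE_x_deriv[OF exp_L12_exp_int] unfolding dx_def[abs_def] .

lemma PE_dy: "exp_L12 W \<Longrightarrow> 0 < y \<Longrightarrow> ((\<lambda>y. PE W y x) has_vector_derivative PE (dy W) y x) (at y)"
  using PE_y_deriv[OF exp_L12_exp_int] unfolding dy_def[abs_def] .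

text \<open>Harmonicity, from |\<xi>|^2 = \<xi>^2; it makes the second derivatives cancel in the
  Laplacian.\<close>

lemma PE_laplace: "PE (dy (dy W)) y x = - PE (dx (dx W)) y x"
proof -
  have "complex_of_real \<bar>\<xi>\<bar> * complex_of_real \<bar>\<xi>\<bar> = complex_of_real \<xi> * complex_of_real \<xi>" for \<xi> :: real
    by (simp flip: of_real_mult)
  then have "damp y (dy (dy W)) = (\<lambda>\<xi>. (- 1) * damp y (dx (dx W)) \<xi>)"
    by (auto simp: damp_def dx_def dy_def fun_eq_iff algebra_simps)
  then show ?thesis unfolding PE_def by (simp only: ft_cmult) simp
qed

lemma PE_continuous_x: "exp_L12 W \<Longrightarrow> 0 < y \<Longrightarrow> continuous_on UNIV (PE W y)"
  by (intro continuous_at_imp_continuous_on ballI has_vector_derivative_continuous[OF PE_dx])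

lemma PE_continuous_y: "exp_L12 W \<Longrightarrow> 0 < e \<Longrightarrow> continuous_on {e..r} (\<lambda>y. PE W y x)"
  by (intro continuous_at_imp_continuous_on ballI has_vector_derivative_continuous[OF PE_dy]) auto

text \<open>Green's formula for \<open>F = |u|\<^sup>2 |w|\<^sup>2\<close>, where \<open>u\<close> and \<open>w\<close> are the extensions of \<open>R\<close> and \<open>W\<close>. Integrating the
  Laplacian against the weight \<open>y\<close> leaves the boundary value \<open>\<integral> F(0, x) dx\<close>, which only sees the supremum of \<open>u\<close>.
  The bound \<open>K\<close> is qualitative: it does not enter the final estimate.\<close>

locale green =
  fixes R W :: "real \<Rightarrow> complex" and K N :: real
  assumes R_meas [measurable]: "R \<in> borel_measurable borel" and R_bound: "\<And>\<xi>. norm (R \<xi>) \<le> K"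
    and u_bound: "\<And>y x. 0 < y \<Longrightarrow> norm (PE R y x) \<le> N" and W: "sq_int W"
begin

lemma W_meas [measurable]: "W \<in> borel_measurable borel"
  using W by auto

lemma R_exp: "exp_L12 R"
  by (rule exp_L12_bounded[OF R_meas R_bound])

lemma W_exp: "exp_L12 W"
  by (rule exp_L12_sq_int[OF W])

lemma N0: "0 \<le> N"
  using order_trans[OF norm_ge_zero u_bound[of 1 0]] by simp

lemma K0: "0 \<le> K"
  using order_trans[OF norm_ge_zero R_bound[of 0]] .

definition F where "F y x = (PE R y x \<bullet> PE R y x) * (PE W y x \<bullet> PE W y x)"
definition Fx where "Fx y x = sq_d1 (PE R y x) (PE (dx R) y x) (PE W y x) (PE (dx W) y x)"
definition Fy where "Fy y x = sq_d1 (PE R y x) (PE (dy R) y x) (PE W y x) (PE (dy W) y x)"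
definition Fxx where "Fxx y x = sq_d2 (PE R y x) (PE (dx R) y x) (PE (dx (dx R)) y x) (PE W y x) (PE (dx W) y x) (PE (dx (dx W)) y x)"
definition Fyy where "Fyy y x = sq_d2 (PE R y x) (PE (dy R) y x) (PE (dy (dy R)) y x) (PE W y x) (PE (dy W) y x) (PE (dy (dy W)) y x)"
definition grad_u where "grad_u y x = (norm (PE (dx R) y x))\<^sup>2 * (norm (PE W y x))\<^sup>2 + (norm (PE (dy R) y x))\<^sup>2 * (norm (PE W y x))\<^sup>2"
definition grad_w where "grad_w y x = (norm (PE (dx W) y x))\<^sup>2 + (norm (PE (dy W) y x))\<^sup>2"
text \<open>One integrable majorant, up to constants, for everything that occurs in Green's formula.
  The second y-derivative of the extension is covered because of \<open>PE_laplace\<close>.\<close>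

definition b where "b y x = (norm (PE W y x))\<^sup>2 + (norm (PE (dx W) y x))\<^sup>2 + (norm (PE (dy W) y x))\<^sup>2 + (norm (PE (dx (dx W)) y x))\<^sup>2"

section \<open>Regularity and integrability on strips away from the boundary\<close>

lemma measurable2 [measurable]:
  "case_prod Fx \<in> borel_measurable (lborel \<Otimes>\<^sub>M lborel)"
  "case_prod Fy \<in> borel_measurable (lborel \<Otimes>\<^sub>M lborel)"
  "case_prod Fxx \<in> borel_measurable (lborel \<Otimes>\<^sub>M lborel)"
  "case_prod Fyy \<in> borel_measurable (lborel \<Otimes>\<^sub>M lborel)"
  "case_prod grad_u \<in> borel_measurable (lborel \<Otimes>\<^sub>M lborel)"
  "case_prod grad_w \<in> borel_measurable (lborel \<Otimes>\<^sub>M lborel)"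
  "case_prod b \<in> borel_measurable (lborel \<Otimes>\<^sub>M lborel)"
  unfolding Fx_def[abs_def] Fy_def[abs_def] Fxx_def[abs_def] Fyy_def[abs_def] sq_d1_def[abs_def] sq_d2_def[abs_def]
    grad_u_def[abs_def] grad_w_def[abs_def] b_def[abs_def] by measurable

lemma F_y: "0 < y \<Longrightarrow> ((\<lambda>y. F y x) has_real_derivative Fy y x) (at y)"
  unfolding F_def[abs_def] Fy_def by (intro sq_d1_deriv PE_dy R_exp W_exp)

lemma F_xx: "0 < y \<Longrightarrow> (Fx y has_real_derivative Fxx y x) (at x)"
  unfolding Fx_def[abs_def] Fxx_def by (intro sq_d2_deriv PE_dx R_exp W_exp exp_L12_dx)

lemma F_yy: "0 < y \<Longrightarrow> ((\<lambda>y. Fy y x) has_real_derivative Fyy y x) (at y)"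
  unfolding Fy_def[abs_def] Fyy_def by (intro sq_d2_deriv PE_dy R_exp W_exp exp_L12_dy)

lemma Fxx_continuous: "0 < y \<Longrightarrow> continuous_on UNIV (Fxx y)"
  unfolding Fxx_def[abs_def] sq_d2_def by (intro continuous_intros PE_continuous_x R_exp W_exp exp_L12_dx)

lemma Fyy_continuous: "0 < e \<Longrightarrow> continuous_on {e..r} (\<lambda>y. Fyy y x)"
  unfolding Fyy_def[abs_def] sq_d2_def by (intro continuous_intros PE_continuous_y R_exp W_exp exp_L12_dy)

lemma laplace: "grad_u y x - 16 * (norm (PE R y x))\<^sup>2 * grad_w y x \<le> Fxx y x + Fyy y x"
  unfolding grad_u_def grad_w_def Fxx_def Fyy_def PE_laplace by (rule laplace_lower)

lemma b_nonneg: "0 \<le> b y x"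
  by (simp add: b_def)

lemma b_integrable:
  assumes e: "0 < e"
  shows "\<exists>D. \<forall>y\<ge>e. integrable lborel (b y) \<and> (LINT x|lborel. b y x) \<le> D"
proof (intro exI allI impI)
  fix y assume y: "e \<le> y"
  then have y0: "0 < y" using e by simp
  have w: "exp_L12 W" "exp_L12 (dx W)" "exp_L12 (dy W)" "exp_L12 (dx (dx W))"
    by (intro W_exp exp_L12_dx exp_L12_dy)+
  have i: "integrable lborel (\<lambda>x. (norm (PE Z y x))\<^sup>2)" if "exp_L12 Z" for Z
    using PE_L2(1)[OF that y0] by (rule sq_int_integrable)
  show "integrable lborel (b y) \<and> (LINT x|lborel. b y x)
      \<le> 2 * pi * n2 (damp e W) + 2 * pi * n2 (damp e (dx W)) + 2 * pi * n2 (damp e (dy W)) + 2 * pi * n2 (damp e (dx (dx W)))"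
  proof
    show "integrable lborel (b y)" unfolding b_def[abs_def] by (intro Bochner_Integration.integrable_add i w)
    have "(LINT x|lborel. b y x) = n2 (PE W y) + n2 (PE (dx W) y) + n2 (PE (dy W) y) + n2 (PE (dx (dx W)) y)"
      unfolding b_def[abs_def] n2_def using i[OF w(1)] i[OF w(2)] i[OF w(3)] i[OF w(4)] by simp
    also have "\<dots> \<le> 2 * pi * n2 (damp e W) + 2 * pi * n2 (damp e (dx W)) + 2 * pi * n2 (damp e (dy W)) + 2 * pi * n2 (damp e (dx (dx W)))"
      by (intro add_mono PE_L2_mono w e y)
    finally show "(LINT x|lborel. b y x) \<le> \<dots>" .
  qed
qed

text \<open>At height at least e, damped integrals of \<open>R\<close> bound the derivatives of u.
  The resulting constant depends on e and K; it justifies Fubini's theorem and integration by parts,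
  and then drops out.\<close>

lemma F_bounds:
  assumes e: "0 < e"
  shows "\<exists>C. \<forall>y\<ge>e. \<forall>x. \<bar>Fxx y x\<bar> \<le> C * b y x \<and> \<bar>Fyy y x\<bar> \<le> C * b y x \<and> \<bar>Fx y x\<bar> \<le> C * b y x
    \<and> \<bar>grad_u y x\<bar> \<le> C * b y x \<and> \<bar>grad_w y x\<bar> \<le> C * b y x \<and> \<bar>16 * (norm (PE R y x))\<^sup>2 * grad_w y x\<bar> \<le> C * b y x"
proof -
  define K1 where "K1 = (LINT \<xi>|lborel. norm (damp e (dx R) \<xi>)) + (LINT \<xi>|lborel. norm (damp e (dy R) \<xi>))"
  define K2 where "K2 = (LINT \<xi>|lborel. norm (damp e (dx (dx R)) \<xi>))"
  have K10: "0 \<le> K1" and K20: "0 \<le> K2" unfolding K1_def K2_def by (auto intro!: add_nonneg_nonneg)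
  define C1 where "C1 = 2 * (K1\<^sup>2 + N * K2) + 8 * N * K1 + 4 * N\<^sup>2"
  define C where "C = C1 + 2 * K1\<^sup>2 + 16 * N\<^sup>2 + 1 + (2 * N * K1 + 4 * N\<^sup>2)"
  have C10: "0 \<le> C1" unfolding C1_def using N0 K10 K20 by simp
  have CC: "C1 \<le> C" "2 * K1\<^sup>2 \<le> C" "16 * N\<^sup>2 \<le> C" "1 \<le> C" "2 * N * K1 + 4 * N\<^sup>2 \<le> C"
    unfolding C_def using C10 N0 K10 mult_nonneg_nonneg[OF N0 K10] zero_le_power2[of K1] zero_le_power2[of N] by linarith+
  show ?thesis
  proof (intro exI[of _ C] allI impI conjI)
    fix y x assume y: "e \<le> y"
    then have y0: "0 < y" using e by simp
    have u: "norm (PE R y x) \<le> N" by (rule u_bound[OF y0])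
    have "0 \<le> (LINT \<xi>|lborel. norm (damp e (dx R) \<xi>))" "0 \<le> (LINT \<xi>|lborel. norm (damp e (dy R) \<xi>))" by simp_all
    then have ux: "norm (PE (dx R) y x) \<le> K1" "norm (PE (dy R) y x) \<le> K1"
      using PE_norm_mono[OF exp_L12_exp_int[OF exp_L12_dx[OF R_exp]] e y, of x]
        PE_norm_mono[OF exp_L12_exp_int[OF exp_L12_dy[OF R_exp]] e y, of x]
      unfolding K1_def by linarith+
    have uxx: "norm (PE (dx (dx R)) y x) \<le> K2" "norm (PE (dy (dy R)) y x) \<le> K2"
      using PE_norm_mono[OF exp_L12_exp_int[OF exp_L12_dx[OF exp_L12_dx[OF R_exp]]] e y, of x]
      unfolding K2_def PE_laplace by auto
    have b0: "0 \<le> b y x" by (rule b_nonneg)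
    have up: "z \<le> C' * q \<Longrightarrow> C' \<le> C \<Longrightarrow> q \<le> b y x \<Longrightarrow> 0 \<le> q \<Longrightarrow> 0 \<le> C' \<Longrightarrow> z \<le> C * b y x" for z C' q
      using mult_mono[of C' C q "b y x"] by linarith
    have Fb: "\<bar>Fxx y x\<bar> \<le> C1 * ((norm (PE W y x))\<^sup>2 + (norm (PE (dx W) y x))\<^sup>2 + (norm (PE (dx (dx W)) y x))\<^sup>2)"
      "\<bar>Fyy y x\<bar> \<le> C1 * ((norm (PE W y x))\<^sup>2 + (norm (PE (dy W) y x))\<^sup>2 + (norm (PE (dy (dy W)) y x))\<^sup>2)"
      unfolding Fxx_def Fyy_def C1_def
      by (rule sq_d2_bound[OF u ux(1) uxx(1)], rule sq_d2_bound[OF u ux(2) uxx(2)])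
    show "\<bar>Fxx y x\<bar> \<le> C * b y x"
      by (rule up[OF Fb(1) CC(1)]) (use C10 in \<open>auto simp: b_def\<close>)
    show "\<bar>Fyy y x\<bar> \<le> C * b y x"
      by (rule up[OF Fb(2) CC(1)]) (use C10 in \<open>auto simp: b_def PE_laplace\<close>)
    have gw: "0 \<le> grad_w y x" "grad_w y x \<le> b y x" by (auto simp: grad_w_def b_def)
    have u2: "(norm (PE R y x))\<^sup>2 \<le> N\<^sup>2" using u by (intro power_mono) auto
    show "\<bar>grad_w y x\<bar> \<le> C * b y x" using gw by (intro up[of _ 1 "grad_w y x"] CC) auto
    show "\<bar>16 * (norm (PE R y x))\<^sup>2 * grad_w y x\<bar> \<le> C * b y x"
      using gw u2 by (intro up[of _ "16 * N\<^sup>2" "grad_w y x"] CC) (auto simp: abs_mult intro!: mult_mono)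
    show "\<bar>grad_u y x\<bar> \<le> C * b y x"
    proof (rule up[of _ "2 * K1\<^sup>2" "(norm (PE W y x))\<^sup>2"])
      have "(norm (PE (dx R) y x))\<^sup>2 \<le> K1\<^sup>2" "(norm (PE (dy R) y x))\<^sup>2 \<le> K1\<^sup>2" using ux by (auto intro: power_mono)
      then have "((norm (PE (dx R) y x))\<^sup>2 + (norm (PE (dy R) y x))\<^sup>2) * (norm (PE W y x))\<^sup>2 \<le> 2 * K1\<^sup>2 * (norm (PE W y x))\<^sup>2"
        by (intro mult_right_mono) auto
      then show "\<bar>grad_u y x\<bar> \<le> 2 * K1\<^sup>2 * (norm (PE W y x))\<^sup>2" by (simp add: grad_u_def ring_distribs)
    qed (use CC in \<open>auto simp: b_def\<close>)
    show "\<bar>Fx y x\<bar> \<le> C * b y x"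
    proof (rule up[of _ "2 * N * K1 + 4 * N\<^sup>2" "b y x"])
      have 1: "\<bar>PE R y x \<bullet> PE (dx R) y x\<bar> \<le> N * K1"
        by (rule order_trans[OF abs_inner_le]) (use u ux N0 in \<open>auto intro!: mult_mono\<close>)
      have 2: "\<bar>PE W y x \<bullet> PE (dx W) y x\<bar> \<le> b y x"
      proof (rule order_trans[OF abs_inner_le])
        have "c * d \<le> c\<^sup>2 + d\<^sup>2" for c d :: real
          using sum_squares_bound[of c d] zero_le_power2[of c] zero_le_power2[of d] by linarith
        from this[of "norm (PE W y x)" "norm (PE (dx W) y x)"]
        show "norm (PE W y x) * norm (PE (dx W) y x) \<le> b y x"
          unfolding b_def using zero_le_power2[of "norm (PE (dy W) y x)"] zero_le_power2[of "norm (PE (dx (dx W)) y x)"] by linarith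
      qed
      have "\<bar>PE R y x \<bullet> PE (dx R) y x\<bar> * (norm (PE W y x))\<^sup>2 \<le> (N * K1) * b y x"
        using 1 b0 N0 K10 by (intro mult_mono) (auto simp: b_def)
      moreover have "(norm (PE R y x))\<^sup>2 * \<bar>PE W y x \<bullet> PE (dx W) y x\<bar> \<le> N\<^sup>2 * b y x"
        using 2 u2 b0 by (intro mult_mono) auto
      moreover have "\<bar>Fx y x\<bar> \<le> 2 * (\<bar>PE R y x \<bullet> PE (dx R) y x\<bar> * (norm (PE W y x))\<^sup>2) + 2 * ((norm (PE R y x))\<^sup>2 * \<bar>PE W y x \<bullet> PE (dx W) y x\<bar>)"
        unfolding Fx_def sq_d1_def norm_inner_self
        by (rule order_trans[OF abs_triangle_ineq]) (simp add: abs_mult)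
      moreover have "0 \<le> N\<^sup>2 * b y x" using b0 by simp
      ultimately show "\<bar>Fx y x\<bar> \<le> (2 * N * K1 + 4 * N\<^sup>2) * b y x"
        by (simp add: ring_distribs mult.assoc)
    qed (use CC b0 N0 K10 in auto)
  qed
qed

text \<open>The weight y shifted so as to vanish at height e: the lower edge then contributes the
  value of \<open>F\<close> but not its derivative. A positive e keeps away from the boundary, where
  derivatives of the extensions are not controlled.\<close>

definition wt :: "real \<Rightarrow> real \<Rightarrow> real \<Rightarrow> real" where
  "wt e r y = indicator {e..r} y * (y - e)"

lemma wt_measurable [measurable]: "wt e r \<in> borel_measurable borel"
  unfolding wt_def[abs_def] by measurable

lemma wt_integrable: "integrable lborel (wt e r)"
  using borel_integrable_compact[of "{e..r}" "\<lambda>y. y - e"]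
  by (simp add: wt_def[abs_def] continuous_intros)

lemma wt_zero: "y < e \<Longrightarrow> wt e r y = 0"
  by (simp add: wt_def)

lemma wt_nonneg: "0 \<le> wt e r y"
  by (simp add: wt_def indicator_def)

lemma strip_integrable:
  assumes e: "0 < e" and H [measurable]: "case_prod H \<in> borel_measurable (lborel \<Otimes>\<^sub>M lborel)"
    and C: "\<And>y x. e \<le> y \<Longrightarrow> \<bar>H y x\<bar> \<le> C * b y x"
  shows "integrable (lborel \<Otimes>\<^sub>M lborel) (\<lambda>(y, x). wt e r y * H y x)"
    and "e \<le> y \<Longrightarrow> integrable lborel (H y)"
proof -
  obtain D where D: "\<And>y. e \<le> y \<Longrightarrow> integrable lborel (b y)" "\<And>y. e \<le> y \<Longrightarrow> (LINT x|lborel. b y x) \<le> D"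
    using b_integrable[OF e] by blast
  have Hi: "integrable lborel (H y)" if y: "e \<le> y" for y
  proof (rule Bochner_Integration.integrable_bound)
    show "integrable lborel (\<lambda>x. C * b y x)" using D(1)[OF y] by simp
    show "AE x in lborel. norm (H y x) \<le> norm (C * b y x)"
      using order_trans[OF C[OF y] abs_ge_self] by simp
  qed measurable
  then show "e \<le> y \<Longrightarrow> integrable lborel (H y)" .
  have C0: "LINT x|lborel. norm (H y x) \<le> \<bar>C\<bar> * D" if y: "e \<le> y" for y
  proof -
    have "(LINT x|lborel. norm (H y x)) \<le> (LINT x|lborel. \<bar>C\<bar> * b y x)"
    proof (rule integral_mono)
      show "norm (H y x) \<le> \<bar>C\<bar> * b y x" for x
        using C[OF y, of x] mult_right_mono[OF abs_ge_self[of C] b_nonneg[of y x]] by simp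
    qed (use Hi[OF y] D(1)[OF y] in auto)
    also have "\<dots> \<le> \<bar>C\<bar> * D" using D(2)[OF y] by (simp add: mult_left_mono)
    finally show ?thesis .
  qed
  show "integrable (lborel \<Otimes>\<^sub>M lborel) (\<lambda>(y, x). wt e r y * H y x)"
  proof (rule lborel_pair.Fubini_integrable)
    show "integrable lborel (\<lambda>y. LINT x|lborel. norm (case (y, x) of (y, x) \<Rightarrow> wt e r y * H y x))"
    proof (rule Bochner_Integration.integrable_bound)
      show "integrable lborel (\<lambda>y. wt e r y * (\<bar>C\<bar> * D))" using wt_integrable by simp
      show "AE y in lborel. norm (LINT x|lborel. norm (case (y, x) of (y, x) \<Rightarrow> wt e r y * H y x)) \<le> norm (wt e r y * (\<bar>C\<bar> * D))"
      proof (rule AE_I2)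
        fix y
        show "norm (LINT x|lborel. norm (case (y, x) of (y, x) \<Rightarrow> wt e r y * H y x)) \<le> norm (wt e r y * (\<bar>C\<bar> * D))"
        proof (cases "e \<le> y")
          case True
          have "norm (LINT x|lborel. norm (H y x)) \<le> norm (\<bar>C\<bar> * D)"
            using C0[OF True] by simp
          then have "\<bar>wt e r y\<bar> * norm (LINT x|lborel. norm (H y x)) \<le> \<bar>wt e r y\<bar> * norm (\<bar>C\<bar> * D)"
            by (intro mult_left_mono) auto
          then show ?thesis by (simp add: abs_mult)
        qed (simp add: wt_zero)
      qed
    qed measurable
    show "AE y in lborel. integrable lborel (\<lambda>x. case (y, x) of (y, x) \<Rightarrow> wt e r y * H y x)"
    proof (rule AE_I2)
      fix y show "integrable lborel (\<lambda>x. case (y, x) of (y, x) \<Rightarrow> wt e r y * H y x)"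
        using Hi[of y] by (cases "e \<le> y") (auto simp: wt_zero)
    qed
  qed measurable
qed

section \<open>Green's formula: interior and boundary terms\<close>

lemma integral_Fxx:
  assumes e: "0 < e"
  shows "(LINT z|(lborel \<Otimes>\<^sub>M lborel). (case z of (y, x) \<Rightarrow> wt e r y * Fxx y x)) = 0"
proof -
  obtain C where C: "\<And>y x. e \<le> y \<Longrightarrow> \<bar>Fxx y x\<bar> \<le> C * b y x" "\<And>y x. e \<le> y \<Longrightarrow> \<bar>Fx y x\<bar> \<le> C * b y x"
    using F_bounds[OF e] by blast
  have "(LINT z|(lborel \<Otimes>\<^sub>M lborel). (case z of (y, x) \<Rightarrow> wt e r y * Fxx y x)) = (LINT y|lborel. LINT x|lborel. wt e r y * Fxx y x)"
    by (rule lborel_pair.integral_fst[symmetric, OF strip_integrable(1)[OF e _ C(1)]]) measurable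
  also have "\<dots> = (LINT y|(lborel :: real measure). 0)"
  proof (intro Bochner_Integration.integral_cong refl)
    fix y
    show "(LINT x|lborel. wt e r y * Fxx y x) = 0"
    proof (cases "e \<le> y")
      case True
      then have y: "0 < y" using e by simp
      \<comment> \<open>No boundary terms arise in x, since each line is integrated over
        completely.\<close>
      have "(LINT x|lborel. Fxx y x) = 0"
      proof (rule integral_derivative_eq_0)
        show "integrable lborel (Fx y)" "integrable lborel (Fxx y)"
          using strip_integrable(2)[OF e _ C(2) True] strip_integrable(2)[OF e _ C(1) True] by simp_all
        show "(Fx y has_vector_derivative Fxx y x) (at x)" for x
          using F_xx[OF y] by (simp add: has_real_derivative_iff_has_vector_derivative)
      qed (rule Fxx_continuous[OF y])
      then show ?thesis by simp
    qed (simp add: wt_zero)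
  qed
  finally show ?thesis by simp
qed

text \<open>One frequency costs 2 / r, and the remaining half of the damping integrates to 4 / r.
  This decay makes the contribution of K at the top of the strip vanish in the limit.\<close>

lemma PE_dy_R_bound:
  assumes r: "0 < r" shows "norm (PE (dy R) r x) \<le> 8 * K / r\<^sup>2"
proof -
  have i: "integrable lborel (\<lambda>\<xi>. exp (- (r / 2 * \<bar>\<xi>\<bar>)) :: real)"
    using integrable_norm[of lborel "\<lambda>\<xi>. complex_of_real (exp (- (r / 2 * \<bar>\<xi>\<bar>)))"] L12_exp[of "r / 2"] r
    by (simp add: L12_def)
  have "complex_of_real (LINT \<xi>|lborel. exp (- (r / 2 * \<bar>\<xi>\<bar>))) = complex_of_real (4 / r)"
    using poisson_kernel[of "r / 2" 0] r unfolding ft_def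
    by (simp add: power2_eq_square flip: integral_complex_of_real)
  then have I: "(LINT \<xi>|lborel. exp (- (r / 2 * \<bar>\<xi>\<bar>))) = 4 / r" by (simp only: of_real_eq_iff)
  have "norm (PE (dy R) r x) \<le> (LINT \<xi>|lborel. norm (damp r (dy R) \<xi>))" by (rule PE_norm_le)
  also have "\<dots> \<le> (LINT \<xi>|lborel. 2 / r * K * exp (- (r / 2 * \<bar>\<xi>\<bar>)))"
  proof (rule integral_mono)
    show "integrable lborel (\<lambda>\<xi>. norm (damp r (dy R) \<xi>))"
      using exp_L12_dy[OF R_exp] r by (intro integrable_norm) (simp add: exp_L12_def L12_def)
    show "integrable lborel (\<lambda>\<xi>. 2 / r * K * exp (- (r / 2 * \<bar>\<xi>\<bar>)))" using i by (intro integrable_mult_right)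
    fix \<xi>
    have "norm (damp r (dy R) \<xi>) \<le> 2 / r * norm (damp (r / 2) R \<xi>)"
      unfolding dy_def[abs_def] by (rule damp_mult_le[OF r]) simp
    also have "\<dots> \<le> 2 / r * (exp (- (r / 2 * \<bar>\<xi>\<bar>)) * K)"
      using r by (intro mult_left_mono) (auto simp: norm_damp intro!: mult_left_mono R_bound)
    finally show "norm (damp r (dy R) \<xi>) \<le> 2 / r * K * exp (- (r / 2 * \<bar>\<xi>\<bar>))" by (simp add: mult_ac)
  qed
  also have "\<dots> = 8 * K / r\<^sup>2" using I by (simp add: power2_eq_square)
  finally show ?thesis .
qed

lemma n2_PE_dy_W:
  assumes r: "0 < r" shows "n2 (PE (dy W) r) \<le> 2 * pi * n2 W / r\<^sup>2"
proof -
  have "n2 (damp r (dy W)) \<le> n2 (\<lambda>\<xi>. complex_of_real (1 / r) * W \<xi>)"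
  proof (rule n2_mono[OF _ sq_int_cmult[OF W]])
    fix \<xi>
    have "r * \<bar>\<xi>\<bar> \<le> exp (r * \<bar>\<xi>\<bar>)" using exp_ge_add_one_self[of "r * \<bar>\<xi>\<bar>"] by linarith
    then have "\<bar>\<xi>\<bar> * exp (- (r * \<bar>\<xi>\<bar>)) \<le> 1 / r" using r by (simp add: exp_minus field_simps)
    then have "(\<bar>\<xi>\<bar> * exp (- (r * \<bar>\<xi>\<bar>))) * norm (W \<xi>) \<le> (1 / r) * norm (W \<xi>)" by (intro mult_right_mono) auto
    then show "norm (damp r (dy W) \<xi>) \<le> norm (complex_of_real (1 / r) * W \<xi>)"
      using r by (simp add: norm_damp dy_def norm_mult norm_divide mult_ac)
  qed measurable
  also have "\<dots> = n2 W / r\<^sup>2" unfolding n2_cmult using r by (simp add: norm_divide power_divide)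
  finally have "2 * pi * n2 (damp r (dy W)) \<le> 2 * pi * (n2 W / r\<^sup>2)" by (intro mult_left_mono) auto
  then show ?thesis using PE_L2(2)[OF exp_L12_dy[OF W_exp] r] by simp
qed

lemma n2_PE_W: "0 < r \<Longrightarrow> n2 (PE W r) \<le> 2 * pi * n2 W"
  using order_trans[OF PE_L2(2)[OF W_exp] mult_left_mono[OF n2_damp_le[OF W]]] by simp

text \<open>(y - e) \<open>Fy\<close> - \<open>F\<close> is an antiderivative in y. Of its boundary
  values, - F at height r has a good sign, and F at height e gives 2 pi N^2 \<open>n2 W\<close>. The
  term (r - e) \<open>Fy\<close> at height r gives 4 pi N^2 \<open>n2 W\<close> from the derivative
  of w, which stays bounded, and the term with K from the derivative of u, which decays.\<close>

lemma integral_Fyy: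
  assumes e: "0 < e" and r: "e \<le> r"
  shows "(LINT z|(lborel \<Otimes>\<^sub>M lborel). (case z of (y, x) \<Rightarrow> wt e r y * Fyy y x))
    \<le> 6 * pi * N\<^sup>2 * n2 W + 32 * pi * N * K * n2 W / r"
proof -
  have r0: "0 < r" using e r by simp
  obtain C where C: "\<And>y x. e \<le> y \<Longrightarrow> \<bar>Fyy y x\<bar> \<le> C * b y x" using F_bounds[OF e] by blast
  have int: "integrable (lborel \<Otimes>\<^sub>M lborel) (\<lambda>(y, x). wt e r y * Fyy y x)"
    by (rule strip_integrable(1)[OF e _ C]) measurable
  have inner: "(LINT y|lborel. wt e r y * Fyy y x) = (r - e) * Fy r x - F r x + F e x" for x
  proof -
    have "(LINT y|lborel. indicator {e..r} y *\<^sub>R ((y - e) * Fyy y x)) = ((r - e) * Fy r x - F r x) - ((e - e) * Fy e x - F e x)"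
    proof (rule integral_FTC_Icc[OF r])
      fix y assume y: "e \<le> y" "y \<le> r"
      then have y0: "0 < y" using e by simp
      have "((\<lambda>y. (y - e) * Fy y x - F y x) has_real_derivative (1 - 0) * Fy y x + Fyy y x * (y - e) - Fy y x) (at y)"
        by (intro DERIV_diff DERIV_mult DERIV_ident DERIV_const F_yy F_y y0)
      then have "((\<lambda>y. (y - e) * Fy y x - F y x) has_real_derivative (y - e) * Fyy y x) (at y)"
        by (simp add: mult.commute)
      then show "((\<lambda>y. (y - e) * Fy y x - F y x) has_vector_derivative (y - e) * Fyy y x) (at y within {e..r})"
        by (rule has_vector_derivative_at_within[OF iffD1[OF has_real_derivative_iff_has_vector_derivative]])
    qed (intro continuous_intros Fyy_continuous e)
    then show ?thesis by (simp add: wt_def mult.assoc)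
  qed
  define A where "A = (\<lambda>x. 2 * N * (8 * K / r) * (norm (PE W r x))\<^sup>2)"
  define B where "B = (\<lambda>x. 2 * N\<^sup>2 * r * (norm (PE W r x) * norm (PE (dy W) r x)))"
  define D where "D = (\<lambda>x. N\<^sup>2 * (norm (PE W e x))\<^sup>2)"
  have w: "sq_int (PE W r)" "sq_int (PE (dy W) r)" "sq_int (PE W e)"
    by (intro PE_L2 W_exp exp_L12_dy r0 e)+
  have wi: "integrable lborel (\<lambda>x. norm (PE W r x) * norm (PE (dy W) r x))"
    using integrable_norm[OF sq_int_mult_integrable[OF w(1,2)]] by (simp add: norm_mult)
  have Ai: "integrable lborel A" and Bi: "integrable lborel B" and Di: "integrable lborel D"
    unfolding A_def B_def D_def using w wi by (auto intro!: integrable_mult_right sq_int_integrable)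
  have le: "(r - e) * Fy r x - F r x + F e x \<le> A x + B x + D x" for x
  proof -
    have u: "norm (PE R r x) \<le> N" "norm (PE R e x) \<le> N" by (intro u_bound r0 e)+
    have uy: "norm (PE (dy R) r x) \<le> 8 * K / r\<^sup>2" by (rule PE_dy_R_bound[OF r0])
    have F0: "0 \<le> F r x" by (simp add: F_def norm_inner_self)
    have Fe: "F e x \<le> D x" unfolding F_def D_def norm_inner_self using u by (intro mult_right_mono power_mono) auto
    have 1: "\<bar>PE R r x \<bullet> PE (dy R) r x\<bar> * (norm (PE W r x))\<^sup>2 \<le> (N * (8 * K / r\<^sup>2)) * (norm (PE W r x))\<^sup>2"
      using u uy N0 by (intro mult_right_mono order_trans[OF abs_inner_le] mult_mono) auto
    have 2: "(norm (PE R r x))\<^sup>2 * \<bar>PE W r x \<bullet> PE (dy W) r x\<bar> \<le> N\<^sup>2 * (norm (PE W r x) * norm (PE (dy W) r x))"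
      using u by (intro mult_mono abs_inner_le power_mono) auto
    have "\<bar>Fy r x\<bar> \<le> 2 * (\<bar>PE R r x \<bullet> PE (dy R) r x\<bar> * (norm (PE W r x))\<^sup>2) + 2 * ((norm (PE R r x))\<^sup>2 * \<bar>PE W r x \<bullet> PE (dy W) r x\<bar>)"
      unfolding Fy_def sq_d1_def norm_inner_self
      by (rule order_trans[OF abs_triangle_ineq]) (simp add: abs_mult)
    also have "\<dots> \<le> 2 * ((N * (8 * K / r\<^sup>2)) * (norm (PE W r x))\<^sup>2) + 2 * (N\<^sup>2 * (norm (PE W r x) * norm (PE (dy W) r x)))"
      by (intro add_mono mult_left_mono 1 2) auto
    finally have "r * \<bar>Fy r x\<bar> \<le> r * (2 * ((N * (8 * K / r\<^sup>2)) * (norm (PE W r x))\<^sup>2) + 2 * (N\<^sup>2 * (norm (PE W r x) * norm (PE (dy W) r x))))"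
      using r0 by (intro mult_left_mono) auto
    also have "\<dots> = A x + B x"
      using r0 by (simp add: A_def B_def field_simps power2_eq_square)
    finally have "r * \<bar>Fy r x\<bar> \<le> A x + B x" .
    moreover have "(r - e) * Fy r x \<le> r * \<bar>Fy r x\<bar>"
      by (rule order_trans[OF mult_left_mono[OF abs_ge_self] mult_right_mono]) (use e r in auto)
    ultimately show ?thesis using F0 Fe by linarith
  qed
  have "(LINT z|(lborel \<Otimes>\<^sub>M lborel). (case z of (y, x) \<Rightarrow> wt e r y * Fyy y x)) = (LINT x|lborel. LINT y|lborel. wt e r y * Fyy y x)"
    by (rule lborel_pair.integral_snd[symmetric, OF int])
  also have "\<dots> \<le> (LINT x|lborel. A x + B x + D x)"
  proof (rule integral_mono)
    show "integrable lborel (\<lambda>x. LINT y|lborel. wt e r y * Fyy y x)" by (rule lborel_pair.integrable_snd[OF int])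
    show "integrable lborel (\<lambda>x. A x + B x + D x)" by (intro Bochner_Integration.integrable_add Ai Bi Di)
  qed (simp add: inner le)
  also have "\<dots> = (LINT x|lborel. A x) + (LINT x|lborel. B x) + (LINT x|lborel. D x)" using Ai Bi Di by simp
  also have "(LINT x|lborel. A x) \<le> 2 * N * (8 * K / r) * (2 * pi * n2 W)"
  proof -
    have "(LINT x|lborel. A x) = 2 * N * (8 * K / r) * n2 (PE W r)" unfolding A_def n2_def by simp
    also have "\<dots> \<le> 2 * N * (8 * K / r) * (2 * pi * n2 W)"
      using N0 K0 r0 by (intro mult_left_mono n2_PE_W) auto
    finally show ?thesis .
  qed
  also have "(LINT x|lborel. B x) \<le> 2 * N\<^sup>2 * r * (2 * pi * n2 W / r)"
  proof -
    have "(LINT x|lborel. norm (PE W r x) * norm (PE (dy W) r x)) \<le> sqrt (n2 (PE W r)) * sqrt (n2 (PE (dy W) r))"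
      by (rule Cauchy_Schwarz_L2_abs[OF w(1,2)])
    also have "\<dots> \<le> sqrt (2 * pi * n2 W) * sqrt (2 * pi * n2 W / r\<^sup>2)"
      by (intro mult_mono real_sqrt_le_mono n2_PE_W n2_PE_dy_W r0) auto
    also have "\<dots> = 2 * pi * n2 W / r"
      using r0 by (simp add: real_sqrt_divide real_sqrt_mult[symmetric])
    finally have "2 * N\<^sup>2 * r * (LINT x|lborel. norm (PE W r x) * norm (PE (dy W) r x)) \<le> 2 * N\<^sup>2 * r * (2 * pi * n2 W / r)"
      using r0 by (intro mult_left_mono) auto
    then show ?thesis by (simp add: B_def)
  qed
  also have "(LINT x|lborel. D x) \<le> N\<^sup>2 * (2 * pi * n2 W)"
    unfolding D_def using n2_PE_W[OF e] by (simp add: n2_def mult_left_mono)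
  finally show ?thesis using r0 by (simp add: field_simps)
qed

lemma wt_grad_w:
  assumes e: "0 < e"
  shows "(LINT z|(lborel \<Otimes>\<^sub>M lborel). (case z of (y, x) \<Rightarrow> wt e r y * grad_w y x)) \<le> pi * n2 W"
proof -
  obtain C where C: "\<And>y x. e \<le> y \<Longrightarrow> \<bar>grad_w y x\<bar> \<le> C * b y x" using F_bounds[OF e] by blast
  have int: "integrable (lborel \<Otimes>\<^sub>M lborel) (\<lambda>(y, x). wt e r y * grad_w y x)"
    by (rule strip_integrable(1)[OF e _ C]) measurable
  have g0: "0 \<le> grad_w y x" for y x by (simp add: grad_w_def)
  have "ennreal (LINT z|(lborel \<Otimes>\<^sub>M lborel). (case z of (y, x) \<Rightarrow> wt e r y * grad_w y x))
      = (\<integral>\<^sup>+z. ennreal (case z of (y, x) \<Rightarrow> wt e r y * grad_w y x) \<partial>(lborel \<Otimes>\<^sub>M lborel))"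
    by (rule nn_integral_eq_integral[symmetric, OF int]) (auto simp: wt_nonneg g0)
  also have "\<dots> = (\<integral>\<^sup>+y. \<integral>\<^sup>+x. ennreal (wt e r y * grad_w y x) \<partial>lborel \<partial>lborel)"
    by (subst lborel.nn_integral_fst[symmetric]) (auto simp: case_prod_unfold)
  also have "\<dots> \<le> (\<integral>\<^sup>+y. \<integral>\<^sup>+x. ennreal (y * (norm (PE (dx W) y x))\<^sup>2) * indicator {0<..} y
      + ennreal (y * (norm (PE (dy W) y x))\<^sup>2) * indicator {0<..} y \<partial>lborel \<partial>lborel)"
  proof (intro nn_integral_mono)
    fix y x
    show "ennreal (wt e r y * grad_w y x) \<le> ennreal (y * (norm (PE (dx W) y x))\<^sup>2) * indicator {0<..} y
      + ennreal (y * (norm (PE (dy W) y x))\<^sup>2) * indicator {0<..} y"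
    proof (cases "e \<le> y")
      case True
      then have "wt e r y * grad_w y x \<le> y * grad_w y x" using e g0 by (intro mult_right_mono) (auto simp: wt_def indicator_def)
      then show ?thesis using True e by (simp add: grad_w_def ring_distribs ennreal_leI flip: ennreal_plus)
    qed (simp add: wt_zero)
  qed
  also have "\<dots> = halfplane_integral (\<lambda>y x. (norm (PE (dx W) y x))\<^sup>2) + halfplane_integral (\<lambda>y x. (norm (PE (dy W) y x))\<^sup>2)"
    unfolding halfplane_integral_def by (simp add: nn_integral_add)
  also have "\<dots> \<le> ennreal (pi / 2 * n2 W) + ennreal (pi / 2 * n2 W)"
    unfolding dx_def[abs_def] dy_def[abs_def]
    by (intro add_mono halfplane_integral_square W) (auto simp: norm_mult)
  also have "\<dots> = ennreal (pi * n2 W)" by (simp flip: ennreal_plus)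
  finally show ?thesis by simp
qed

text \<open>Green's formula with the lower bound for the Laplacian: 6 pi N^2 comes from the
  boundary, and 16 N^2 times pi from the two square functions of w.\<close>

lemma wt_grad_u:
  assumes e: "0 < e" and r: "e \<le> r"
  shows "(\<integral>\<^sup>+y. \<integral>\<^sup>+x. ennreal (wt e r y * grad_u y x) \<partial>lborel \<partial>lborel)
    \<le> ennreal (22 * pi * N\<^sup>2 * n2 W + 32 * pi * N * K * n2 W / r)"
proof -
  obtain C where C: "\<And>y x. e \<le> y \<Longrightarrow> \<bar>Fxx y x\<bar> \<le> C * b y x" "\<And>y x. e \<le> y \<Longrightarrow> \<bar>Fyy y x\<bar> \<le> C * b y x"
    "\<And>y x. e \<le> y \<Longrightarrow> \<bar>grad_u y x\<bar> \<le> C * b y x" "\<And>y x. e \<le> y \<Longrightarrow> \<bar>grad_w y x\<bar> \<le> C * b y x"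
    using F_bounds[OF e] by blast
  have ixx: "integrable (lborel \<Otimes>\<^sub>M lborel) (\<lambda>(y, x). wt e r y * Fxx y x)" by (rule strip_integrable(1)[OF e _ C(1)]) measurable
  have iyy: "integrable (lborel \<Otimes>\<^sub>M lborel) (\<lambda>(y, x). wt e r y * Fyy y x)" by (rule strip_integrable(1)[OF e _ C(2)]) measurable
  have iu: "integrable (lborel \<Otimes>\<^sub>M lborel) (\<lambda>(y, x). wt e r y * grad_u y x)" by (rule strip_integrable(1)[OF e _ C(3)]) measurable
  have iw: "integrable (lborel \<Otimes>\<^sub>M lborel) (\<lambda>(y, x). wt e r y * grad_w y x)" by (rule strip_integrable(1)[OF e _ C(4)]) measurable
  have g0: "0 \<le> grad_u y x" "0 \<le> grad_w y x" for y x by (simp_all add: grad_u_def grad_w_def)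
  have "(LINT z|(lborel \<Otimes>\<^sub>M lborel). (case z of (y, x) \<Rightarrow> wt e r y * grad_u y x))
      \<le> (LINT z|(lborel \<Otimes>\<^sub>M lborel). (case z of (y, x) \<Rightarrow> wt e r y * Fxx y x) + (case z of (y, x) \<Rightarrow> wt e r y * Fyy y x)
          + 16 * N\<^sup>2 * (case z of (y, x) \<Rightarrow> wt e r y * grad_w y x))"
  proof (rule integral_mono)
    fix z :: "real \<times> real"
    obtain y x where z: "z = (y, x)" by fastforce
    have "wt e r y * grad_u y x \<le> wt e r y * (Fxx y x + Fyy y x + 16 * N\<^sup>2 * grad_w y x)"
    proof (cases "e \<le> y")
      case True
      then have "(norm (PE R y x))\<^sup>2 \<le> N\<^sup>2" using e by (intro power_mono u_bound) auto
      then have "16 * (norm (PE R y x))\<^sup>2 * grad_w y x \<le> 16 * N\<^sup>2 * grad_w y x" using g0 by (intro mult_right_mono) auto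
      then have "grad_u y x \<le> Fxx y x + Fyy y x + 16 * N\<^sup>2 * grad_w y x" using laplace[of y x] by linarith
      then show ?thesis by (intro mult_left_mono wt_nonneg)
    qed (simp add: wt_zero)
    then show "(case z of (y, x) \<Rightarrow> wt e r y * grad_u y x) \<le> (case z of (y, x) \<Rightarrow> wt e r y * Fxx y x)
        + (case z of (y, x) \<Rightarrow> wt e r y * Fyy y x) + 16 * N\<^sup>2 * (case z of (y, x) \<Rightarrow> wt e r y * grad_w y x)"
      by (simp add: z algebra_simps)
  qed (use ixx iyy iu iw in auto)
  also have "\<dots> = (LINT z|(lborel \<Otimes>\<^sub>M lborel). (case z of (y, x) \<Rightarrow> wt e r y * Fxx y x)) + (LINT z|(lborel \<Otimes>\<^sub>M lborel). (case z of (y, x) \<Rightarrow> wt e r y * Fyy y x))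
      + 16 * N\<^sup>2 * (LINT z|(lborel \<Otimes>\<^sub>M lborel). (case z of (y, x) \<Rightarrow> wt e r y * grad_w y x))"
    using ixx iyy iw by simp
  also have "\<dots> \<le> 0 + (6 * pi * N\<^sup>2 * n2 W + 32 * pi * N * K * n2 W / r) + 16 * N\<^sup>2 * (pi * n2 W)"
    by (intro add_mono mult_left_mono integral_Fyy wt_grad_w e r) (auto simp: integral_Fxx[OF e])
  also have "\<dots> = 22 * pi * N\<^sup>2 * n2 W + 32 * pi * N * K * n2 W / r" by (simp add: algebra_simps)
  finally have le: "(LINT z|(lborel \<Otimes>\<^sub>M lborel). (case z of (y, x) \<Rightarrow> wt e r y * grad_u y x)) \<le> \<dots>" .
  have "(\<integral>\<^sup>+y. \<integral>\<^sup>+x. ennreal (wt e r y * grad_u y x) \<partial>lborel \<partial>lborel)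
      = (\<integral>\<^sup>+z. ennreal (case z of (y, x) \<Rightarrow> wt e r y * grad_u y x) \<partial>(lborel \<Otimes>\<^sub>M lborel))"
    by (subst lborel.nn_integral_fst[symmetric]) (auto simp: case_prod_unfold)
  also have "\<dots> = ennreal (LINT z|(lborel \<Otimes>\<^sub>M lborel). (case z of (y, x) \<Rightarrow> wt e r y * grad_u y x))"
    by (rule nn_integral_eq_integral[OF iu]) (auto simp: wt_nonneg g0)
  also have "\<dots> \<le> ennreal (22 * pi * N\<^sup>2 * n2 W + 32 * pi * N * K * n2 W / r)" by (rule ennreal_leI[OF le])
  finally show ?thesis .
qed

text \<open>Fatou's lemma along strips that exhaust the half plane: the shifted weights tend to y,
  and the term with K disappears because the height r tends to infinity.\<close>

theorem carleson: "halfplane_integral grad_u \<le> ennreal (22 * pi * N\<^sup>2 * n2 W)"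
proof -
  define e where "e = (\<lambda>n. 1 / real (Suc n))"
  define r where "r = (\<lambda>n. real (Suc n))"
  have er: "0 < e n" "e n \<le> r n" for n
  proof -
    have "e n \<le> 1" "1 \<le> r n" by (auto simp: e_def r_def)
    then show "e n \<le> r n" by linarith
  qed (simp add: e_def)
  define d where "d = 32 * pi * N * K * n2 W"
  have g0: "0 \<le> grad_u y x" for y x by (simp add: grad_u_def)
  have e0: "e \<longlonglongrightarrow> 0" unfolding e_def using LIMSEQ_Suc[OF lim_1_over_n] by simp
  have "halfplane_integral grad_u = (\<integral>\<^sup>+z. ennreal (fst z * grad_u (fst z) (snd z)) * indicator {0<..} (fst z) \<partial>(lborel \<Otimes>\<^sub>M lborel))"
    unfolding halfplane_integral_def by (subst lborel.nn_integral_fst[symmetric]) auto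
  also have "\<dots> = (\<integral>\<^sup>+z. liminf (\<lambda>n. ennreal (wt (e n) (r n) (fst z) * grad_u (fst z) (snd z))) \<partial>(lborel \<Otimes>\<^sub>M lborel))"
  proof (rule nn_integral_cong)
    fix z :: "real \<times> real"
    obtain y x where z: "z = (y, x)" by fastforce
    have "(\<lambda>n. ennreal (wt (e n) (r n) y * grad_u y x)) \<longlonglongrightarrow> ennreal (y * grad_u y x) * indicator {0<..} y"
    proof (cases "0 < y")
      case True
      obtain M :: nat where M: "y \<le> real M" using real_arch_simple by blast
      have "eventually (\<lambda>n. ennreal ((y - e n) * grad_u y x) = ennreal (wt (e n) (r n) y * grad_u y x)) sequentially"
        using order_tendstoD(2)[OF e0 True] eventually_ge_at_top[of M]
        by eventually_elim (use M in \<open>auto simp: wt_def indicator_def r_def\<close>)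
      moreover have "(\<lambda>n. ennreal ((y - e n) * grad_u y x)) \<longlonglongrightarrow> ennreal ((y - 0) * grad_u y x)"
        by (intro tendsto_ennrealI tendsto_intros e0)
      ultimately show ?thesis using True by (auto intro: Lim_transform_eventually)
    next
      case False
      then have "wt (e n) (r n) y = 0" for n using er(1)[of n] by (intro wt_zero) linarith
      then show ?thesis using False by simp
    qed
    then show "ennreal (fst z * grad_u (fst z) (snd z)) * indicator {0<..} (fst z)
        = liminf (\<lambda>n. ennreal (wt (e n) (r n) (fst z) * grad_u (fst z) (snd z)))"
      unfolding z by (intro lim_imp_Liminf[symmetric]) auto
  qed
  also have "\<dots> \<le> liminf (\<lambda>n. \<integral>\<^sup>+z. ennreal (wt (e n) (r n) (fst z) * grad_u (fst z) (snd z)) \<partial>(lborel \<Otimes>\<^sub>M lborel))"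
    by (intro nn_integral_liminf) measurable
  also have "\<dots> \<le> liminf (\<lambda>n. ennreal (22 * pi * N\<^sup>2 * n2 W + d / r n))"
  proof (intro Liminf_mono always_eventually allI)
    fix n
    have "(\<integral>\<^sup>+z. ennreal (wt (e n) (r n) (fst z) * grad_u (fst z) (snd z)) \<partial>(lborel \<Otimes>\<^sub>M lborel))
        = (\<integral>\<^sup>+y. \<integral>\<^sup>+x. ennreal (wt (e n) (r n) y * grad_u y x) \<partial>lborel \<partial>lborel)"
      by (subst lborel.nn_integral_fst[symmetric]) auto
    also have "\<dots> \<le> ennreal (22 * pi * N\<^sup>2 * n2 W + d / r n)" unfolding d_def by (rule wt_grad_u[OF er])
    finally show "(\<integral>\<^sup>+z. ennreal (wt (e n) (r n) (fst z) * grad_u (fst z) (snd z)) \<partial>(lborel \<Otimes>\<^sub>M lborel))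
        \<le> ennreal (22 * pi * N\<^sup>2 * n2 W + d / r n)" .
  qed
  also have "\<dots> = ennreal (22 * pi * N\<^sup>2 * n2 W)"
  proof (rule lim_imp_Liminf)
    have "(\<lambda>n. d * e n) \<longlonglongrightarrow> d * 0" by (intro tendsto_intros e0)
    then have "(\<lambda>n. 22 * pi * N\<^sup>2 * n2 W + d / r n) \<longlonglongrightarrow> 22 * pi * N\<^sup>2 * n2 W + 0"
      by (intro tendsto_add tendsto_const) (simp add: e_def r_def)
    then show "(\<lambda>n. ennreal (22 * pi * N\<^sup>2 * n2 W + d / r n)) \<longlonglongrightarrow> ennreal (22 * pi * N\<^sup>2 * n2 W)"
      by (intro tendsto_ennrealI) simp
  qed simp
  finally show ?thesis .
qed

end

section \<open>The trilinear form of the commutator\<close>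

text \<open>The three frequencies add up to zero, as they do when a product of three transforms is
  integrated over x.\<close>

definition tri :: "(real \<Rightarrow> complex) \<Rightarrow> (real \<Rightarrow> complex) \<Rightarrow> (real \<Rightarrow> complex) \<Rightarrow> real \<times> real \<Rightarrow> complex" where
  "tri P Q R z = P (fst z) * Q (snd z) * R (- fst z - snd z)"

lemma tri_measurable [measurable]:
  assumes [measurable]: "P \<in> borel_measurable borel" "Q \<in> borel_measurable borel" "R \<in> borel_measurable borel"
  shows "tri P Q R \<in> borel_measurable (lborel \<Otimes>\<^sub>M lborel)"
  unfolding tri_def[abs_def] by measurable

lemma integral_affine_reflect:
  fixes f :: "real \<Rightarrow> 'a :: {banach, second_countable_topology}"
  shows "(LINT x|lborel. f (t - x)) = (LINT x|lborel. f x)"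
  using lborel_integral_real_affine[of "-1" f t] by simp

lemma integrable_affine_reflect:
  fixes f :: "real \<Rightarrow> 'a :: {banach, second_countable_topology}"
  shows "integrable lborel f \<Longrightarrow> integrable lborel (\<lambda>x. f (t - x))"
  using lborel_integrable_real_affine[of f "-1" t] by simp

lemma sq_int_affine_reflect: "sq_int f \<Longrightarrow> sq_int (\<lambda>x. f (t - x))"
  using integrable_affine_reflect[of "\<lambda>x. (norm (f x))\<^sup>2"] by (auto simp: sq_int_def)

lemma n2_affine_reflect: "n2 (\<lambda>x. f (t - x)) = n2 f"
  using integral_affine_reflect[of "\<lambda>x. (norm (f x))\<^sup>2"] by (auto simp: n2_def)

lemma tri_integrable:
  assumes P: "integrable lborel P" and Q: "sq_int Q" and R: "sq_int R"
  shows "integrable (lborel \<Otimes>\<^sub>M lborel) (tri P Q R)"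
proof (rule lborel_pair.Fubini_integrable)
  have [measurable]: "P \<in> borel_measurable borel" "Q \<in> borel_measurable borel" "R \<in> borel_measurable borel"
    using P Q R by auto
  show "tri P Q R \<in> borel_measurable (lborel \<Otimes>\<^sub>M lborel)" by measurable
  have R': "sq_int (\<lambda>\<eta>. R (- \<xi> - \<eta>))" for \<xi> using sq_int_affine_reflect[OF R, of "- \<xi>"] by simp
  show "AE \<xi> in lborel. integrable lborel (\<lambda>\<eta>. tri P Q R (\<xi>, \<eta>))"
    using sq_int_mult_integrable[OF Q R'] by (simp add: tri_def mult.assoc)
  show "integrable lborel (\<lambda>\<xi>. LINT \<eta>|lborel. norm (tri P Q R (\<xi>, \<eta>)))"
  proof (rule Bochner_Integration.integrable_bound)
    show "integrable lborel (\<lambda>\<xi>. norm (P \<xi>) * (sqrt (n2 Q) * sqrt (n2 R)))" using P by (intro integrable_mult_left integrable_norm)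
    have "(LINT \<eta>|lborel. norm (tri P Q R (\<xi>, \<eta>))) \<le> norm (P \<xi>) * (sqrt (n2 Q) * sqrt (n2 R))" for \<xi>
      using Cauchy_Schwarz_L2_abs[OF Q R'[of \<xi>]] n2_affine_reflect[of R "- \<xi>"]
      by (simp add: tri_def norm_mult mult.assoc mult_left_mono)
    then show "AE \<xi> in lborel. norm (LINT \<eta>|lborel. norm (tri P Q R (\<xi>, \<eta>))) \<le> norm (norm (P \<xi>) * (sqrt (n2 Q) * sqrt (n2 R)))"
      by (intro AE_I2) simp
  qed measurable
qed

lemma tri_integrable_swap:
  assumes P: "sq_int P" and Q: "integrable lborel Q" and R: "sq_int R"
  shows "integrable (lborel \<Otimes>\<^sub>M lborel) (tri P Q R)"
proof -
  have "integrable (lborel \<Otimes>\<^sub>M lborel) (\<lambda>(x, y). tri Q P R (y, x))"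
    by (rule lborel_pair.integrable_product_swap[OF tri_integrable[OF Q P R]])
  moreover have "(\<lambda>(x, y). tri Q P R (y, x)) = tri P Q R"
  proof
    fix z :: "real \<times> real"
    have "- snd z - fst z = - fst z - snd z" by simp
    then show "(case z of (x, y) \<Rightarrow> tri Q P R (y, x)) = tri P Q R z"
      unfolding tri_def case_prod_unfold fst_conv snd_conv by (simp only: mult_ac)
  qed
  ultimately show ?thesis by simp
qed

text \<open>The convolution of \<open>P\<close> and \<open>Q\<close> is integrable, bounded by
  Cauchy-Schwarz, and has the product of the transforms as its transform, so Parseval's formula
  applies to it and \<open>R\<close>.\<close>

lemma triple_product:
  assumes P: "L12 P" and Q: "L12 Q" and R: "L12 R"
  shows "(LINT x|lborel. ft P x * ft Q x * ft R x) = complex_of_real (2 * pi) * (LINT z|(lborel \<Otimes>\<^sub>M lborel). tri P Q R z)"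
proof -
  have Pi: "integrable lborel P" and Qi: "integrable lborel Q" and P2: "sq_int P" and Q2: "sq_int Q" and R2: "sq_int R"
    using P Q R by (auto simp: L12_def)
  have [measurable]: "P \<in> borel_measurable borel" "Q \<in> borel_measurable borel" "R \<in> borel_measurable borel"
    using P2 Q2 R2 by auto
  have Qs: "integrable lborel (\<lambda>\<zeta>. Q (\<zeta> - \<xi>))" for \<xi> using integrable_shift[OF Qi, of "- \<xi>"] by simp
  have Qss: "(LINT \<zeta>|lborel. norm (Q (\<zeta> - \<xi>))) = (LINT \<zeta>|lborel. norm (Q \<zeta>))" for \<xi>
    using integral_shift[of "\<lambda>\<zeta>. norm (Q \<zeta>)" "- \<xi>"] by simp
  define Z where "Z = (\<lambda>\<zeta>. LINT \<xi>|lborel. P \<xi> * Q (\<zeta> - \<xi>))"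
  \<comment> \<open>\<open>k\<close> is the constant 1 for the integrability of \<open>Z\<close> and
    a character for its transform.\<close>
  have int: "integrable (lborel \<Otimes>\<^sub>M lborel) (\<lambda>(\<xi>, \<zeta>). k \<zeta> * (P \<xi> * Q (\<zeta> - \<xi>)))"
    if [measurable]: "k \<in> borel_measurable borel" and k: "\<And>\<zeta>. norm (k \<zeta>) \<le> 1" for k
  proof (rule lborel_pair.Fubini_integrable)
    have ki: "integrable lborel (\<lambda>\<zeta>. k \<zeta> * (P \<xi> * Q (\<zeta> - \<xi>)))" for \<xi>
      by (rule Bochner_Integration.integrable_bound[of _ "\<lambda>\<zeta>. P \<xi> * Q (\<zeta> - \<xi>)"])
         (use Qs k in \<open>auto simp: norm_mult mult_left_le_one_le\<close>)
    then show "AE \<xi> in lborel. integrable lborel (\<lambda>\<zeta>. case (\<xi>, \<zeta>) of (\<xi>, \<zeta>) \<Rightarrow> k \<zeta> * (P \<xi> * Q (\<zeta> - \<xi>)))" by simp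
    show "integrable lborel (\<lambda>\<xi>. LINT \<zeta>|lborel. norm (case (\<xi>, \<zeta>) of (\<xi>, \<zeta>) \<Rightarrow> k \<zeta> * (P \<xi> * Q (\<zeta> - \<xi>))))"
    proof (rule Bochner_Integration.integrable_bound)
      show "integrable lborel (\<lambda>\<xi>. norm (P \<xi>) * (LINT \<zeta>|lborel. norm (Q \<zeta>)))"
        using Pi by (intro integrable_mult_left integrable_norm)
      have le1: "(LINT \<zeta>|lborel. norm (k \<zeta> * (P \<xi> * Q (\<zeta> - \<xi>)))) \<le> (LINT \<zeta>|lborel. norm (P \<xi>) * norm (Q (\<zeta> - \<xi>)))" for \<xi>
        by (rule integral_mono[OF integrable_norm[OF ki]])
           (use Qs k in \<open>auto simp: norm_mult mult_left_le_one_le\<close>)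
      have "(LINT \<zeta>|lborel. norm (k \<zeta> * (P \<xi> * Q (\<zeta> - \<xi>)))) \<le> norm (P \<xi>) * (LINT \<zeta>|lborel. norm (Q \<zeta>))" for \<xi>
        using le1[of \<xi>] Qss[of \<xi>] by simp
      then show "AE \<xi> in lborel. norm (LINT \<zeta>|lborel. norm (case (\<xi>, \<zeta>) of (\<xi>, \<zeta>) \<Rightarrow> k \<zeta> * (P \<xi> * Q (\<zeta> - \<xi>))))
          \<le> norm (norm (P \<xi>) * (LINT \<zeta>|lborel. norm (Q \<zeta>)))"
        by (intro AE_I2) simp
    qed measurable
  qed measurable
  have Zi: "integrable lborel Z"
    using lborel_pair.integrable_snd[OF int[of "\<lambda>_. 1"]] by (simp add: Z_def)
  have Z_bound: "norm (Z \<zeta>) \<le> sqrt (n2 P) * sqrt (n2 Q)" for \<zeta>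
    unfolding Z_def using Cauchy_Schwarz_L2[OF P2 sq_int_affine_reflect[OF Q2, of \<zeta>]] by (simp add: n2_affine_reflect)
  have Z: "L12 Z" by (rule L12_bounded[OF Zi Z_bound])
  have ftZ: "ft Z x = ft P x * ft Q x" for x
  proof -
    have "ft Z x = (LINT \<zeta>|lborel. LINT \<xi>|lborel. cis (- (x * \<zeta>)) * (P \<xi> * Q (\<zeta> - \<xi>)))"
      by (simp add: ft_def Z_def)
    also have "\<dots> = (LINT \<xi>|lborel. LINT \<zeta>|lborel. cis (- (x * \<zeta>)) * (P \<xi> * Q (\<zeta> - \<xi>)))"
      by (rule lborel_pair.Fubini_integral[OF int]) auto
    also have "\<dots> = (LINT \<xi>|lborel. cis (- (x * \<xi>)) * P \<xi> * ft Q x)"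
    proof (intro Bochner_Integration.integral_cong refl)
      fix \<xi>
      have "(LINT \<zeta>|lborel. cis (- (x * \<zeta>)) * (P \<xi> * Q (\<zeta> - \<xi>))) = (LINT \<zeta>|lborel. cis (- (x * (\<xi> + \<zeta>))) * (P \<xi> * Q ((\<xi> + \<zeta>) - \<xi>)))"
        by (rule integral_shift[symmetric])
      also have "\<dots> = (LINT \<zeta>|lborel. (cis (- (x * \<xi>)) * P \<xi>) * (cis (- (x * \<zeta>)) * Q \<zeta>))"
      proof -
        have "cis (- (x * (\<xi> + \<zeta>))) = cis (- (x * \<xi>)) * cis (- (x * \<zeta>))" for \<zeta> by (simp add: cis_mult algebra_simps)
        then show ?thesis by (simp add: mult_ac)
      qed
      finally show "(LINT \<zeta>|lborel. cis (- (x * \<zeta>)) * (P \<xi> * Q (\<zeta> - \<xi>))) = cis (- (x * \<xi>)) * P \<xi> * ft Q x"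
        by (simp add: ft_def)
    qed
    also have "\<dots> = ft P x * ft Q x" by (simp add: ft_def)
    finally show ?thesis .
  qed
  have tri_eq: "(LINT \<eta>|lborel. tri P Q R (\<xi>, \<eta>)) = (LINT \<zeta>|lborel. R (- \<zeta>) * (P \<xi> * Q (\<zeta> - \<xi>)))" for \<xi>
  proof -
    have "tri P Q R (\<xi>, - \<xi> + \<zeta>) = R (- \<zeta>) * (P \<xi> * Q (\<zeta> - \<xi>))" for \<zeta>
      by (simp add: tri_def)
    with integral_shift[of "\<lambda>\<eta>. tri P Q R (\<xi>, \<eta>)" "- \<xi>"] show ?thesis by simp
  qed
  have int2: "integrable (lborel \<Otimes>\<^sub>M lborel) (\<lambda>(\<xi>, \<zeta>). R (- \<zeta>) * (P \<xi> * Q (\<zeta> - \<xi>)))"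
  proof (rule lborel_pair.Fubini_integrable)
    have Rr: "sq_int (\<lambda>\<zeta>. R (- \<zeta>))" by (rule sq_int_reflect[OF R2])
    have Qr: "sq_int (\<lambda>\<zeta>. Q (\<zeta> - \<xi>))" for \<xi>
      using integrable_shift[of "\<lambda>\<zeta>. (norm (Q \<zeta>))\<^sup>2" "- \<xi>"] Q2 by (simp add: sq_int_def)
    have n2Qr: "n2 (\<lambda>\<zeta>. Q (\<zeta> - \<xi>)) = n2 Q" for \<xi>
      using integral_shift[of "\<lambda>\<zeta>. (norm (Q \<zeta>))\<^sup>2" "- \<xi>"] by (simp add: n2_def)
    show "AE \<xi> in lborel. integrable lborel (\<lambda>\<zeta>. case (\<xi>, \<zeta>) of (\<xi>, \<zeta>) \<Rightarrow> R (- \<zeta>) * (P \<xi> * Q (\<zeta> - \<xi>)))"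
      using integrable_mult_right[OF sq_int_mult_integrable[OF Rr Qr]] by (simp add: mult.left_commute)
    show "integrable lborel (\<lambda>\<xi>. LINT \<zeta>|lborel. norm (case (\<xi>, \<zeta>) of (\<xi>, \<zeta>) \<Rightarrow> R (- \<zeta>) * (P \<xi> * Q (\<zeta> - \<xi>))))"
    proof (rule Bochner_Integration.integrable_bound)
      show "integrable lborel (\<lambda>\<xi>. norm (P \<xi>) * (sqrt (n2 R) * sqrt (n2 Q)))" using Pi by (intro integrable_mult_left integrable_norm)
      have "(LINT \<zeta>|lborel. norm (R (- \<zeta>) * (P \<xi> * Q (\<zeta> - \<xi>)))) \<le> norm (P \<xi>) * (sqrt (n2 R) * sqrt (n2 Q))" for \<xi>
        using Cauchy_Schwarz_L2_abs[OF Rr Qr[of \<xi>]]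
        by (simp add: norm_mult mult.left_commute[of _ "norm (P \<xi>)"] n2Qr n2_reflect mult_left_mono)
      then show "AE \<xi> in lborel. norm (LINT \<zeta>|lborel. norm (case (\<xi>, \<zeta>) of (\<xi>, \<zeta>) \<Rightarrow> R (- \<zeta>) * (P \<xi> * Q (\<zeta> - \<xi>))))
          \<le> norm (norm (P \<xi>) * (sqrt (n2 R) * sqrt (n2 Q)))"
        by (intro AE_I2) simp
    qed measurable
  qed measurable
  have "(LINT x|lborel. ft P x * ft Q x * ft R x) = (LINT x|lborel. ft R x * ft Z x)"
    by (simp add: ftZ mult.commute)
  also have "\<dots> = complex_of_real (2 * pi) * (LINT \<zeta>|lborel. R (- \<zeta>) * Z \<zeta>)" by (rule Parseval[OF Z R])
  also have "(LINT \<zeta>|lborel. R (- \<zeta>) * Z \<zeta>) = (LINT \<zeta>|lborel. LINT \<xi>|lborel. R (- \<zeta>) * (P \<xi> * Q (\<zeta> - \<xi>)))"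
    by (simp add: Z_def)
  also have "\<dots> = (LINT \<xi>|lborel. LINT \<zeta>|lborel. R (- \<zeta>) * (P \<xi> * Q (\<zeta> - \<xi>)))"
    by (rule lborel_pair.Fubini_integral[OF int2])
  also have "\<dots> = (LINT \<xi>|lborel. LINT \<eta>|lborel. tri P Q R (\<xi>, \<eta>))" by (simp only: tri_eq)
  also have "\<dots> = (LINT z|(lborel \<Otimes>\<^sub>M lborel). tri P Q R z)"
    by (rule lborel_pair.integral_fst'[OF tri_integrable[OF Pi Q2 R2]])
  finally show ?thesis .
qed

section \<open>Division by the square of the frequency sum\<close>

definition freq_sum :: "real \<times> real \<Rightarrow> real" where
  "freq_sum z = \<bar>fst z\<bar> + \<bar>snd z\<bar> + \<bar>fst z + snd z\<bar>"

lemma freq_sum_measurable [measurable]: "freq_sum \<in> borel_measurable (lborel \<Otimes>\<^sub>M lborel)"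
  unfolding freq_sum_def[abs_def] by measurable

lemma freq_sum_AE: "AE z in lborel \<Otimes>\<^sub>M lborel. 0 < freq_sum z"
proof -
  have "AE z in lborel \<Otimes>\<^sub>M (lborel :: real measure). fst z \<noteq> (0::real)"
  proof (rule lborel_pair.AE_pair_measure)
    have "AE x in lborel. x \<noteq> (0::real)" by (rule AE_lborel_singleton)
    then show "AE x in lborel. AE y in lborel. fst (x, y :: real) \<noteq> (0::real)" by eventually_elim simp
  qed measurable
  then show ?thesis by eventually_elim (auto simp: freq_sum_def)
qed

lemma tri_damp: "tri (damp y P) (damp y Q) (damp y R) z = complex_of_real (exp (- (y * freq_sum z))) * tri P Q R z"
proof -
  have "exp (- (y * freq_sum z)) = exp (- (y * \<bar>fst z\<bar>)) * exp (- (y * \<bar>snd z\<bar>)) * exp (- (y * \<bar>- fst z - snd z\<bar>))"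
    by (simp add: freq_sum_def mult_exp_exp algebra_simps abs_minus_commute)
  then show ?thesis by (simp add: tri_def damp_def mult_ac)
qed

lemma integral_weight:
  fixes s :: real
  assumes s: "0 < s"
  shows "has_bochner_integral lborel (\<lambda>y. indicator {0..} y * (y * exp (- (y * s)))) (1 / s\<^sup>2)"
proof (rule has_bochner_integral_nn_integral)
  \<comment> \<open>The scale-invariant integral at a = s / 2, to be divided by (s / 2)^2.\<close>
  have "(\<integral>\<^sup>+y. ennreal (y * ((s/2)\<^sup>2 * exp (- (2 * y * (s/2))))) * indicator {0..} y \<partial>lborel) = ennreal (1/4)"
    using s by (intro nn_integral_weight) simp
  also have "(\<lambda>y. ennreal (y * ((s/2)\<^sup>2 * exp (- (2 * y * (s/2))))) * indicator {0..} y)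
      = (\<lambda>y. ennreal ((s/2)\<^sup>2) * ennreal (indicator {0..} y * (y * exp (- (y * s)))))"
    by (auto simp: fun_eq_iff indicator_def ennreal_mult[symmetric] mult_ac)
  also have "(\<integral>\<^sup>+y. ennreal ((s/2)\<^sup>2) * ennreal (indicator {0..} y * (y * exp (- (y * s)))) \<partial>lborel)
      = ennreal ((s/2)\<^sup>2) * (\<integral>\<^sup>+y. ennreal (indicator {0..} y * (y * exp (- (y * s)))) \<partial>lborel)"
    by (intro nn_integral_cmult) measurable
  finally have *: "ennreal ((s/2)\<^sup>2) * (\<integral>\<^sup>+y. ennreal (indicator {0..} y * (y * exp (- (y * s)))) \<partial>lborel) = ennreal (1/4)" .
  have "(\<integral>\<^sup>+y. ennreal (indicator {0..} y * (y * exp (- (y * s)))) \<partial>lborel)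
      = ennreal (1 / (s/2)\<^sup>2) * (ennreal ((s/2)\<^sup>2) * (\<integral>\<^sup>+y. ennreal (indicator {0..} y * (y * exp (- (y * s)))) \<partial>lborel))"
    using s by (simp add: mult.assoc[symmetric] ennreal_mult[symmetric])
  also have "\<dots> = ennreal (1 / s\<^sup>2)" unfolding * using s by (simp add: ennreal_mult[symmetric] power_divide)
  finally show "(\<integral>\<^sup>+y. ennreal (indicator {0..} y * (y * exp (- (y * s)))) \<partial>lborel) = ennreal (1 / s\<^sup>2)" .
qed (auto simp: indicator_def)

lemma norm_integral_le_nn:
  fixes f :: "'b \<Rightarrow> complex"
  shows "ennreal (norm (integral\<^sup>L M f)) \<le> (\<integral>\<^sup>+x. ennreal (norm (f x)) \<partial>M)"
  by (cases "integrable M f") (auto simp: integral_norm_bound_ennreal not_integrable_integral_eq)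

text \<open>The symbol \<open>1 / s\<^sup>2\<close> is \<open>\<integral> y exp (- y s) dy\<close>, and \<open>exp (- y s)\<close> splits into the three damping factors of
  the harmonic extensions.\<close>

lemma tri_halfplane:
  assumes P: "exp_L12 P" and Q: "exp_L12 Q" and R: "exp_L12 R"
    and int: "integrable (lborel \<Otimes>\<^sub>M lborel) (\<lambda>z. tri P Q R z / complex_of_real ((freq_sum z)\<^sup>2))"
  shows "ennreal (norm (LINT z|(lborel \<Otimes>\<^sub>M lborel). tri P Q R z / complex_of_real ((freq_sum z)\<^sup>2)))
    \<le> ennreal (1 / (2 * pi)) * halfplane_integral (\<lambda>y x. norm (PE P y x) * norm (PE Q y x) * norm (PE R y x))"
proof -
  have [measurable]: "P \<in> borel_measurable borel" "Q \<in> borel_measurable borel" "R \<in> borel_measurable borel"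
    using P Q R by auto
  interpret LL: sigma_finite_measure "lborel \<Otimes>\<^sub>M lborel :: (real \<times> real) measure"
    by (intro sigma_finite_pair_measure sigma_finite_lborel)
  interpret PP: pair_sigma_finite "lborel \<Otimes>\<^sub>M lborel :: (real \<times> real) measure" "lborel :: real measure" ..
  define k where "k = (\<lambda>(s::real) y. indicator {0..} y * (y * exp (- (y * s))) :: real)"
  have [measurable]: "(\<lambda>(s, y). k s y) \<in> borel_measurable (borel \<Otimes>\<^sub>M borel)" unfolding k_def by measurable
  define \<Phi> where "\<Phi> = (\<lambda>z y. complex_of_real (k (freq_sum z) y) * tri P Q R z)"
  have k: "integrable lborel (k s)" "(LINT y|lborel. k s y) = 1 / s\<^sup>2" if "0 < s" for s
    using integral_weight[OF that] by (auto simp: k_def has_bochner_integral_iff)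
  have k0: "0 \<le> k s y" for s y by (simp add: k_def indicator_def)
  have [measurable]: "case_prod \<Phi> \<in> borel_measurable ((lborel \<Otimes>\<^sub>M lborel) \<Otimes>\<^sub>M lborel)"
    unfolding \<Phi>_def k_def by measurable
  \<comment> \<open>The kernel \<open>k\<close> is nonnegative, so the y-integral of the modulus is
    the modulus of the integrand in \<open>int\<close>, and Fubini's theorem applies.\<close>
  have \<Phi>int: "integrable ((lborel \<Otimes>\<^sub>M lborel) \<Otimes>\<^sub>M lborel) (case_prod \<Phi>)"
  proof (rule PP.Fubini_integrable)
    have "AE z in lborel \<Otimes>\<^sub>M lborel. (LINT y|lborel. norm (\<Phi> z y)) = norm (tri P Q R z / complex_of_real ((freq_sum z)\<^sup>2))"
      using freq_sum_AE
    proof eventually_elim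
      case (elim z)
      then show ?case using k[OF elim] k0 by (simp add: \<Phi>_def norm_mult norm_divide norm_power)
    qed
    then have "integrable (lborel \<Otimes>\<^sub>M lborel) (\<lambda>z. LINT y|lborel. norm (\<Phi> z y))
        \<longleftrightarrow> integrable (lborel \<Otimes>\<^sub>M lborel) (\<lambda>z. norm (tri P Q R z / complex_of_real ((freq_sum z)\<^sup>2)))"
      by (intro integrable_cong_AE) measurable
    then show "integrable (lborel \<Otimes>\<^sub>M lborel) (\<lambda>z. LINT y|lborel. norm (case_prod \<Phi> (z, y)))"
      using integrable_norm[OF int] by simp
    show "AE z in lborel \<Otimes>\<^sub>M lborel. integrable lborel (\<lambda>y. case_prod \<Phi> (z, y))"
      using freq_sum_AE
    proof eventually_elim
      case (elim z)
      then show ?case using k[OF elim] by (simp add: \<Phi>_def)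
    qed
  qed measurable
  have "(LINT z|(lborel \<Otimes>\<^sub>M lborel). tri P Q R z / complex_of_real ((freq_sum z)\<^sup>2)) = (LINT z|(lborel \<Otimes>\<^sub>M lborel). LINT y|lborel. \<Phi> z y)"
  proof (rule Bochner_Integration.integral_cong_AE)
    show "AE z in lborel \<Otimes>\<^sub>M lborel. tri P Q R z / complex_of_real ((freq_sum z)\<^sup>2) = (LINT y|lborel. \<Phi> z y)"
      using freq_sum_AE
    proof eventually_elim
      case (elim z)
      then show ?case using k[OF elim] by (simp add: \<Phi>_def)
    qed
  qed measurable
  also have "\<dots> = (LINT y|lborel. LINT z|(lborel \<Otimes>\<^sub>M lborel). \<Phi> z y)"
    by (rule PP.Fubini_integral[OF \<Phi>int, symmetric])
  finally have eq: "(LINT z|(lborel \<Otimes>\<^sub>M lborel). tri P Q R z / complex_of_real ((freq_sum z)\<^sup>2)) = (LINT y|lborel. LINT z|(lborel \<Otimes>\<^sub>M lborel). \<Phi> z y)" .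
  have inner: "ennreal (norm (LINT z|(lborel \<Otimes>\<^sub>M lborel). \<Phi> z y))
      \<le> ennreal (1 / (2 * pi)) * (\<integral>\<^sup>+x. ennreal (y * (norm (PE P y x) * norm (PE Q y x) * norm (PE R y x))) * indicator {0<..} y \<partial>lborel)" for y
  proof (cases "0 < y")
    case y: True
    have L: "L12 (damp y P)" "L12 (damp y Q)" "L12 (damp y R)" using P Q R y by (auto simp: exp_L12_def)
    have "(LINT z|(lborel \<Otimes>\<^sub>M lborel). \<Phi> z y) = (LINT z|(lborel \<Otimes>\<^sub>M lborel). complex_of_real y * tri (damp y P) (damp y Q) (damp y R) z)"
      unfolding tri_damp using y by (simp add: \<Phi>_def k_def mult.assoc)
    also have "\<dots> = complex_of_real y * (LINT z|(lborel \<Otimes>\<^sub>M lborel). tri (damp y P) (damp y Q) (damp y R) z)" by simp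
    also have "(LINT z|(lborel \<Otimes>\<^sub>M lborel). tri (damp y P) (damp y Q) (damp y R) z) = complex_of_real (1 / (2 * pi)) * (LINT x|lborel. PE P y x * PE Q y x * PE R y x)"
      using triple_product[OF L] by (simp add: PE_def)
    finally have "ennreal (norm (LINT z|(lborel \<Otimes>\<^sub>M lborel). \<Phi> z y)) = ennreal (1 / (2 * pi)) * (ennreal y * ennreal (norm (LINT x|lborel. PE P y x * PE Q y x * PE R y x)))"
      using y by (simp add: norm_mult norm_divide ennreal_mult[symmetric] mult_ac)
    also have "\<dots> \<le> ennreal (1 / (2 * pi)) * (ennreal y * (\<integral>\<^sup>+x. ennreal (norm (PE P y x * PE Q y x * PE R y x)) \<partial>lborel))"
      by (intro mult_left_mono norm_integral_le_nn) auto
    also have "ennreal y * (\<integral>\<^sup>+x. ennreal (norm (PE P y x * PE Q y x * PE R y x)) \<partial>lborel)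
        = (\<integral>\<^sup>+x. ennreal (y * (norm (PE P y x) * norm (PE Q y x) * norm (PE R y x))) * indicator {0<..} y \<partial>lborel)"
      using y by (subst nn_integral_cmult[symmetric]) (auto simp: norm_mult ennreal_mult)
    finally show ?thesis .
  next
    case False
    then have "\<Phi> z y = 0" for z by (auto simp: \<Phi>_def k_def indicator_def)
    then show ?thesis by simp
  qed
  have "ennreal (norm (LINT y|lborel. LINT z|(lborel \<Otimes>\<^sub>M lborel). \<Phi> z y)) \<le> (\<integral>\<^sup>+y. ennreal (norm (LINT z|(lborel \<Otimes>\<^sub>M lborel). \<Phi> z y)) \<partial>lborel)"
    by (rule norm_integral_le_nn)
  also have "\<dots> \<le> (\<integral>\<^sup>+y. ennreal (1 / (2 * pi)) * (\<integral>\<^sup>+x. ennreal (y * (norm (PE P y x) * norm (PE Q y x) * norm (PE R y x))) * indicator {0<..} y \<partial>lborel) \<partial>lborel)"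
    by (intro nn_integral_mono inner)
  also have "\<dots> = ennreal (1 / (2 * pi)) * halfplane_integral (\<lambda>y x. norm (PE P y x) * norm (PE Q y x) * norm (PE R y x))"
    unfolding halfplane_integral_def by (rule nn_integral_cmult) measurable
  finally show ?thesis unfolding eq .
qed

lemma halfplane_Cauchy_Schwarz:
  assumes [measurable]: "case_prod G \<in> borel_measurable (lborel \<Otimes>\<^sub>M lborel)" "case_prod H \<in> borel_measurable (lborel \<Otimes>\<^sub>M lborel)"
    and G0: "\<And>y x. 0 \<le> G y x" and H0: "\<And>y x. 0 \<le> H y x"
    and a: "halfplane_integral (\<lambda>y x. (G y x)\<^sup>2) \<le> ennreal a" "0 \<le> a"
    and b: "halfplane_integral (\<lambda>y x. (H y x)\<^sup>2) \<le> ennreal b" "0 \<le> b"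
  shows "halfplane_integral (\<lambda>y x. G y x * H y x) \<le> ennreal (sqrt a * sqrt b)"
proof -
  have hp: "halfplane_integral K = (\<integral>\<^sup>+z. ennreal (fst z * K (fst z) (snd z)) * indicator {0<..} (fst z) \<partial>(lborel \<Otimes>\<^sub>M lborel))"
    if [measurable]: "case_prod K \<in> borel_measurable (lborel \<Otimes>\<^sub>M lborel)" for K
    unfolding halfplane_integral_def by (subst lborel.nn_integral_fst[symmetric]) auto
  \<comment> \<open>The weight y is divided evenly between the two factors.\<close>
  define g where "g = (\<lambda>z. ennreal (sqrt (fst z) * G (fst z) (snd z)) * indicator {0<..} (fst z))"
  define h where "h = (\<lambda>z. ennreal (sqrt (fst z) * H (fst z) (snd z)) * indicator {0<..} (fst z))"
  have [measurable]: "g \<in> borel_measurable (lborel \<Otimes>\<^sub>M lborel)" "h \<in> borel_measurable (lborel \<Otimes>\<^sub>M lborel)"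
    unfolding g_def h_def by measurable
  have gh: "g z * h z = ennreal (fst z * (G (fst z) (snd z) * H (fst z) (snd z))) * indicator {0<..} (fst z)" for z
  proof (cases "0 < fst z")
    case True
    have "(sqrt (fst z) * G (fst z) (snd z)) * (sqrt (fst z) * H (fst z) (snd z))
        = (sqrt (fst z) * sqrt (fst z)) * (G (fst z) (snd z) * H (fst z) (snd z))" by (simp only: mult_ac)
    also have "\<dots> = fst z * (G (fst z) (snd z) * H (fst z) (snd z))" using True by simp
    finally show ?thesis using True G0 H0 by (simp add: g_def h_def flip: ennreal_mult)
  qed (simp add: g_def h_def)
  have gg: "(g z)\<^sup>2 = ennreal (fst z * (G (fst z) (snd z))\<^sup>2) * indicator {0<..} (fst z)" for z
    using G0 by (auto simp: g_def indicator_def ennreal_power power_mult_distrib)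
  have hh: "(h z)\<^sup>2 = ennreal (fst z * (H (fst z) (snd z))\<^sup>2) * indicator {0<..} (fst z)" for z
    using H0 by (auto simp: h_def indicator_def ennreal_power power_mult_distrib)
  have "(halfplane_integral (\<lambda>y x. G y x * H y x))\<^sup>2 = (\<integral>\<^sup>+z. g z * h z \<partial>(lborel \<Otimes>\<^sub>M lborel))\<^sup>2"
    by (subst hp) (auto simp: gh)
  also have "\<dots> \<le> (\<integral>\<^sup>+z. (g z)\<^sup>2 \<partial>(lborel \<Otimes>\<^sub>M lborel)) * (\<integral>\<^sup>+z. (h z)\<^sup>2 \<partial>(lborel \<Otimes>\<^sub>M lborel))"
    by (rule Cauchy_Schwarz_nn_integral) measurable
  also have "\<dots> = halfplane_integral (\<lambda>y x. (G y x)\<^sup>2) * halfplane_integral (\<lambda>y x. (H y x)\<^sup>2)"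
    by (subst (1 2) hp) (auto simp: gg hh)
  also have "\<dots> \<le> ennreal a * ennreal b" by (intro mult_mono a b) auto
  also have "\<dots> = (ennreal (sqrt a * sqrt b))\<^sup>2" using a b by (simp add: ennreal_mult ennreal_power power_mult_distrib)
  finally have sq: "(halfplane_integral (\<lambda>y x. G y x * H y x))\<^sup>2 \<le> (ennreal (sqrt a * sqrt b))\<^sup>2" .
  show ?thesis
  proof (cases "halfplane_integral (\<lambda>y x. G y x * H y x)" rule: ennreal_cases)
    case (real c)
    then have "c\<^sup>2 \<le> (sqrt a * sqrt b)\<^sup>2" using sq a b by (simp add: ennreal_power)
    then have "c \<le> sqrt a * sqrt b" by (rule power2_le_imp_le) (use a b in simp)
    then show ?thesis using real by (simp add: ennreal_leI)
  next
    case top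
    then show ?thesis using sq a b by (simp add: ennreal_power top_unique)
  qed
qed

text \<open>\<open>mA\<close> and \<open>mX\<close> are the symbols of |D| and D. They differ from
  \<open>dy\<close> and \<open>dx\<close> by unimodular constants, which norms do not see and which
  would only clutter the identity \<open>commutator_symbol\<close>.\<close>

definition mA :: "(real \<Rightarrow> complex) \<Rightarrow> real \<Rightarrow> complex" where
  "mA W \<xi> = complex_of_real \<bar>\<xi>\<bar> * W \<xi>"

definition mX :: "(real \<Rightarrow> complex) \<Rightarrow> real \<Rightarrow> complex" where
  "mX W \<xi> = complex_of_real \<xi> * W \<xi>"

lemma mA_measurable [measurable]: "W \<in> borel_measurable borel \<Longrightarrow> mA W \<in> borel_measurable borel"
  unfolding mA_def[abs_def] by measurable

lemma mX_measurable [measurable]: "W \<in> borel_measurable borel \<Longrightarrow> mX W \<in> borel_measurable borel"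
  unfolding mX_def[abs_def] by measurable

lemma exp_L12_mA: "exp_L12 W \<Longrightarrow> exp_L12 (mA W)"
  unfolding mA_def[abs_def] by (intro exp_L12_mult) auto

lemma exp_L12_mX: "exp_L12 W \<Longrightarrow> exp_L12 (mX W)"
  unfolding mX_def[abs_def] by (intro exp_L12_mult) auto

lemma halfplane_mA: "sq_int W \<Longrightarrow> halfplane_integral (\<lambda>y x. (norm (PE (mA W) y x))\<^sup>2) \<le> ennreal (pi / 2 * n2 W)"
  unfolding mA_def[abs_def] by (rule halfplane_integral_square) auto

lemma halfplane_mX: "sq_int W \<Longrightarrow> halfplane_integral (\<lambda>y x. (norm (PE (mX W) y x))\<^sup>2) \<le> ennreal (pi / 2 * n2 W)"
  unfolding mX_def[abs_def] by (rule halfplane_integral_square) auto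

lemma norm_PE_mA: "norm (PE (mA R) y x) = norm (PE (dy R) y x)"
proof -
  have "damp y (dy R) = (\<lambda>\<xi>. (- 1) * damp y (mA R) \<xi>)" by (auto simp: damp_def dy_def mA_def)
  then have "PE (dy R) y x = - 1 * PE (mA R) y x" unfolding PE_def by (simp only: ft_cmult)
  then show ?thesis by simp
qed

lemma norm_PE_mX: "norm (PE (mX R) y x) = norm (PE (dx R) y x)"
proof -
  have "damp y (dx R) = (\<lambda>\<xi>. (- \<i>) * damp y (mX R) \<xi>)" by (auto simp: damp_def dx_def mX_def)
  then have "PE (dx R) y x = - \<i> * PE (mX R) y x" unfolding PE_def by (simp only: ft_cmult)
  then show ?thesis by (simp add: norm_mult)
qed

lemma halfplane_mono:
  "(\<And>y x. 0 < y \<Longrightarrow> G y x \<le> H y x) \<Longrightarrow> halfplane_integral G \<le> halfplane_integral H"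
  unfolding halfplane_integral_def
  by (intro nn_integral_mono) (auto simp: indicator_def intro!: ennreal_leI mult_left_mono)

lemma halfplane_cmult:
  assumes c: "0 \<le> c" and [measurable]: "case_prod G \<in> borel_measurable (lborel \<Otimes>\<^sub>M lborel)"
  shows "halfplane_integral (\<lambda>y x. c * G y x) = ennreal c * halfplane_integral G"
proof -
  have "ennreal (y * (c * G y x)) * indicator {0<..} y = ennreal c * (ennreal (y * G y x) * indicator {0<..} y)" for y x
    using c by (simp add: ennreal_mult'[symmetric] mult.left_commute flip: mult.assoc)
  then show ?thesis unfolding halfplane_integral_def
    by (simp add: nn_integral_cmult)
qed

text \<open>Signs only enter through the frequencies of differentiated factors, so no Hilbert transform falls on an
  undifferentiated one.\<close>

lemma commutator_symbol:
  fixes \<xi> \<eta> :: real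
  defines "\<zeta> \<equiv> - \<xi> - \<eta>" and "s \<equiv> \<bar>\<xi>\<bar> + \<bar>\<eta>\<bar> + \<bar>\<xi> + \<eta>\<bar>"
  shows "(\<bar>\<xi> + \<eta>\<bar> - \<bar>\<eta>\<bar>) * s\<^sup>2 = 2 * (\<bar>\<xi>\<bar> * \<bar>\<xi>\<bar> * \<bar>\<zeta>\<bar>) - 2 * (\<bar>\<xi>\<bar> * \<xi> * \<zeta>) - 2 * (\<bar>\<xi>\<bar> * \<bar>\<xi>\<bar> * \<bar>\<eta>\<bar>)
      + 2 * (\<bar>\<xi>\<bar> * \<xi> * \<eta>) + 2 * (\<xi> * \<eta> * \<bar>\<zeta>\<bar>) - 2 * (\<xi> * \<bar>\<eta>\<bar> * \<zeta>)"
proof -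
  have "\<bar>\<zeta>\<bar> = \<bar>\<xi> + \<eta>\<bar>" unfolding \<zeta>_def by linarith
  then show ?thesis unfolding s_def \<zeta>_def
    \<comment> \<open>On each cone where the three signs are fixed the identity is
      polynomial.\<close>
    by (cases "0 \<le> \<xi>"; cases "0 \<le> \<eta>"; cases "0 \<le> \<xi> + \<eta>")
       (auto simp: abs_of_nonneg abs_of_neg power2_eq_square algebra_simps not_le)
qed

text \<open>In the application \<open>P\<close> and \<open>Q\<close> are the transforms of A and of
  a Schwartz function, and \<open>f\<close> is a truncated bounded function. The resulting bound is
  in terms of \<open>mX P\<close>, \<open>Q\<close> and \<open>M\<close>.\<close>

locale trilinear =
  fixes P Q f :: "real \<Rightarrow> complex" and M :: real
  assumes P: "sq_int P" and X: "sq_int (mX P)" and Q1: "integrable lborel Q" and Q: "sq_int Q"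
    and f: "integrable lborel f" and fM: "\<And>x. norm (f x) \<le> M"
begin

abbreviation "R \<equiv> ft f"
abbreviation "N \<equiv> 2 * pi * M"
text \<open>The bound for one term of the decomposition: 22 pi N from the half plane estimates,
  divided by 2 pi in \<open>tri_halfplane\<close>.\<close>

abbreviation "B \<equiv> 11 * N * (sqrt (n2 (mX P)) * sqrt (n2 Q))"

section \<open>Estimates of the six terms\<close>

lemma M0: "0 \<le> M" using order_trans[OF norm_ge_zero fM[of 0]] .

lemma measurable1 [measurable]:
  "P \<in> borel_measurable borel" "Q \<in> borel_measurable borel" "f \<in> borel_measurable borel"
  using P Q f by auto

lemma f12: "L12 f" by (rule L12_bounded[OF f fM])

lemma R_sq: "sq_int R" by (rule Bessel[OF f12])

lemma R_exp: "exp_L12 R" by (rule exp_L12_sq_int[OF R_sq])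

lemma u_le: "0 < y \<Longrightarrow> norm (PE R y x) \<le> N"
  by (rule PE_ft_bound[OF f fM])

lemma Xa: "sq_int (mA P)" "n2 (mA P) = n2 (mX P)"
  using X by (auto simp: sq_int_def n2_def mA_def[abs_def] mX_def[abs_def] norm_mult)

text \<open>The qualitative bound K is the L^1 norm of \<open>f\<close>, which is absent from the
  conclusion of \<open>carleson\<close>. Each of \<open>mA R\<close> and \<open>mX R\<close>
  accounts for one partial derivative of u.\<close>

lemma carleson_R:
  assumes W: "sq_int W" and T: "T = mA R \<or> T = mX R"
  shows "halfplane_integral (\<lambda>y x. (norm (PE W y x) * norm (PE T y x))\<^sup>2) \<le> ennreal (22 * pi * N\<^sup>2 * n2 W)"
proof -
  interpret green R W "LINT \<xi>|lborel. norm (f \<xi>)" N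
    by unfold_locales (auto simp: norm_ft_le u_le W)
  have "halfplane_integral (\<lambda>y x. (norm (PE W y x) * norm (PE T y x))\<^sup>2) \<le> halfplane_integral grad_u"
    using T by (intro halfplane_mono) (auto simp: grad_u_def norm_PE_mA norm_PE_mX power_mult_distrib)
  with carleson show ?thesis by (rule order_trans[rotated])
qed

text \<open>The pointwise comparison provides absolute convergence and thereby the passage to the
  half plane; the size of the term comes from the half plane integral \<open>hp\<close>.\<close>

lemma tri_term:
  assumes ex: "exp_L12 P'" "exp_L12 Q'" "exp_L12 R'"
    and le: "\<And>z. norm (tri P' Q' R' z) \<le> (freq_sum z)\<^sup>2 * norm (tri (mX P) Q R z)"
    and hp: "halfplane_integral (\<lambda>y x. norm (PE P' y x) * norm (PE Q' y x) * norm (PE R' y x)) \<le> ennreal (2 * pi * B)"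
  shows "integrable (lborel \<Otimes>\<^sub>M lborel) (\<lambda>z. tri P' Q' R' z / complex_of_real ((freq_sum z)\<^sup>2))"
    and "norm (LINT z|(lborel \<Otimes>\<^sub>M lborel). tri P' Q' R' z / complex_of_real ((freq_sum z)\<^sup>2)) \<le> B"
proof -
  have [measurable]: "P' \<in> borel_measurable borel" "Q' \<in> borel_measurable borel" "R' \<in> borel_measurable borel"
    using ex by auto
  have B0: "0 \<le> B" using M0 by simp
  show int: "integrable (lborel \<Otimes>\<^sub>M lborel) (\<lambda>z. tri P' Q' R' z / complex_of_real ((freq_sum z)\<^sup>2))"
  proof (rule Bochner_Integration.integrable_bound[OF tri_integrable_swap[OF X Q1 R_sq]])
    show "AE z in lborel \<Otimes>\<^sub>M lborel. norm (tri P' Q' R' z / complex_of_real ((freq_sum z)\<^sup>2)) \<le> norm (tri (mX P) Q R z)"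
      using freq_sum_AE
    proof eventually_elim
      case (elim z)
      then show ?case using le[of z] by (simp add: norm_divide norm_power pos_divide_le_eq mult.commute)
    qed
  qed measurable
  have "ennreal (norm (LINT z|(lborel \<Otimes>\<^sub>M lborel). tri P' Q' R' z / complex_of_real ((freq_sum z)\<^sup>2))) \<le> ennreal (1 / (2 * pi)) * ennreal (2 * pi * B)"
    by (rule order_trans[OF tri_halfplane[OF ex int] mult_left_mono[OF hp]]) simp
  also have "\<dots> = ennreal B"
  proof -
    have "ennreal (1 / (2 * pi)) * ennreal (2 * pi * c) = ennreal c" if "0 \<le> c" for c
      using that by (simp flip: ennreal_mult)
    then show ?thesis using B0 by blast
  qed
  finally show "norm (LINT z|(lborel \<Otimes>\<^sub>M lborel). tri P' Q' R' z / complex_of_real ((freq_sum z)\<^sup>2)) \<le> B"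
    using B0 by (simp only: ennreal_le_iff)
qed

text \<open>Raising pi / 2 to 22 pi turns the product under the roots into a square times a
  b.\<close>

lemma pi_sqrt: "sqrt (pi / 2 * a) * sqrt (22 * pi * N\<^sup>2 * b) \<le> 22 * pi * N * (sqrt a * sqrt b)" if "0 \<le> a" "0 \<le> b"
proof -
  have "sqrt (pi / 2 * a) * sqrt (22 * pi * N\<^sup>2 * b) \<le> sqrt (22 * pi * a) * sqrt (22 * pi * N\<^sup>2 * b)"
    using that by (intro mult_right_mono real_sqrt_le_mono) auto
  also have "\<dots> = sqrt ((22 * pi * N)\<^sup>2 * (a * b))"
    by (simp add: real_sqrt_mult[symmetric] power2_eq_square mult_ac)
  also have "\<dots> = 22 * pi * N * (sqrt a * sqrt b)"
    using M0 by (simp add: real_sqrt_mult)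
  finally show ?thesis .
qed

text \<open>The terms with R differentiated: Cauchy-Schwarz pairs the square function of
  \<open>P'\<close> with the Carleson estimate for the other two factors.\<close>

lemma hp_R:
  assumes P': "halfplane_integral (\<lambda>y x. (norm (PE P' y x))\<^sup>2) \<le> ennreal (pi / 2 * a)" "0 \<le> a" "P' \<in> borel_measurable borel"
    and W: "sq_int W" "n2 W = b" and T: "T = mA R \<or> T = mX R"
  shows "halfplane_integral (\<lambda>y x. norm (PE P' y x) * (norm (PE W y x) * norm (PE T y x))) \<le> ennreal (22 * pi * N * (sqrt a * sqrt b))"
proof -
  note P'(3)[measurable]
  have [measurable]: "W \<in> borel_measurable borel" "T \<in> borel_measurable borel" using W T by auto
  have "halfplane_integral (\<lambda>y x. norm (PE P' y x) * (norm (PE W y x) * norm (PE T y x))) \<le> ennreal (sqrt (pi / 2 * a) * sqrt (22 * pi * N\<^sup>2 * b))"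
    using carleson_R[OF W(1) T] W(2) n2_nonneg[of W] P'
    by (intro halfplane_Cauchy_Schwarz) (auto simp: W(2))
  also have "\<dots> \<le> ennreal (22 * pi * N * (sqrt a * sqrt b))"
    using pi_sqrt[OF P'(2), of b] W(2) n2_nonneg[of W] by (intro ennreal_leI) auto
  finally show ?thesis .
qed

text \<open>The terms with R undifferentiated: its extension is bounded by N, and two square
  functions remain. The constant is enlarged to the one of \<open>hp_R\<close>.\<close>

lemma hp_bounded:
  assumes P': "halfplane_integral (\<lambda>y x. (norm (PE P' y x))\<^sup>2) \<le> ennreal (pi / 2 * a)" "0 \<le> a" "P' \<in> borel_measurable borel"
    and Q': "halfplane_integral (\<lambda>y x. (norm (PE Q' y x))\<^sup>2) \<le> ennreal (pi / 2 * b)" "0 \<le> b" "Q' \<in> borel_measurable borel"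
  shows "halfplane_integral (\<lambda>y x. norm (PE P' y x) * norm (PE Q' y x) * norm (PE R y x)) \<le> ennreal (22 * pi * N * (sqrt a * sqrt b))"
proof -
  note P'(3)[measurable] Q'(3)[measurable]
  have "halfplane_integral (\<lambda>y x. norm (PE P' y x) * norm (PE Q' y x) * norm (PE R y x))
      \<le> halfplane_integral (\<lambda>y x. N * (norm (PE P' y x) * norm (PE Q' y x)))"
    by (intro halfplane_mono) (simp add: mult.commute[of N] mult_left_mono u_le)
  also have "\<dots> = ennreal N * halfplane_integral (\<lambda>y x. norm (PE P' y x) * norm (PE Q' y x))"
    using M0 by (intro halfplane_cmult) auto
  also have "\<dots> \<le> ennreal N * ennreal (sqrt (pi / 2 * a) * sqrt (pi / 2 * b))"
    using P' Q' by (intro mult_left_mono halfplane_Cauchy_Schwarz) auto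
  also have "\<dots> = ennreal (N * (pi / 2 * (sqrt a * sqrt b)))"
    using M0 P'(2) Q'(2) by (simp add: ennreal_mult[symmetric] real_sqrt_mult real_sqrt_divide)
  also have "\<dots> \<le> ennreal (22 * pi * N * (sqrt a * sqrt b))"
    using M0 P'(2) Q'(2) by (intro ennreal_leI) (simp add: mult_ac mult_left_mono)
  finally show ?thesis .
qed

lemma weight_le:
  assumes "a \<le> s" "b \<le> s" "0 \<le> a" "0 \<le> b" "0 \<le> p" "0 \<le> t"
  shows "a * b * (p * t) \<le> s\<^sup>2 * (p * (t::real))"
  unfolding power2_eq_square using assms by (intro mult_right_mono mult_mono) auto

text \<open>Divided by the squared frequency sum, \<open>commutator_symbol\<close> splits the form
  into six terms with coefficient 2, so the bound is 12 \<open>B\<close>.\<close>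

theorem trilinear_bound:
  "norm (LINT z|(lborel \<Otimes>\<^sub>M lborel). complex_of_real (\<bar>fst z + snd z\<bar> - \<bar>snd z\<bar>) * tri P Q R z)
    \<le> 264 * pi * M * (sqrt (n2 (mX P)) * sqrt (n2 Q))"
proof -
  note e = exp_L12_sq_int[OF P] exp_L12_sq_int[OF Q] R_exp
  have f1: "\<bar>fst z\<bar> \<le> freq_sum z" "\<bar>snd z\<bar> \<le> freq_sum z" "\<bar>- fst z - snd z\<bar> \<le> freq_sum z" for z
    unfolding freq_sum_def by linarith+
  have nt: "norm (tri (mX P) Q R z) = \<bar>fst z\<bar> * norm (tri P Q R z)" for z by (simp add: tri_def mX_def norm_mult)
  have hA: "halfplane_integral (\<lambda>y x. (norm (PE (mA (mA P)) y x))\<^sup>2) \<le> ennreal (pi / 2 * n2 (mX P))"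
    using halfplane_mA[OF Xa(1)] by (simp add: Xa)
  have hX: "halfplane_integral (\<lambda>y x. (norm (PE (mA (mX P)) y x))\<^sup>2) \<le> ennreal (pi / 2 * n2 (mX P))"
    by (rule halfplane_mA[OF X])
  \<comment> \<open>One frequency \<xi> always stays with \<open>P\<close>, for the norm of
    \<open>mX P\<close>. In the first two terms the Carleson estimate takes w to be the extension of
    \<open>Q\<close>, in the last two that of \<open>mX P\<close>; in the middle ones R is not
    differentiated.\<close>
  have h1: "halfplane_integral (\<lambda>y x. norm (PE (mA (mA P)) y x) * norm (PE Q y x) * norm (PE (mA R) y x)) \<le> ennreal (2 * pi * B)"
    using hp_R[OF hA _ _ Q refl, of "mA R"] by (simp add: mult_ac)
  have h2: "halfplane_integral (\<lambda>y x. norm (PE (mA (mX P)) y x) * norm (PE Q y x) * norm (PE (mX R) y x)) \<le> ennreal (2 * pi * B)"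
    using hp_R[OF hX _ _ Q refl, of "mX R"] by (simp add: mult_ac)
  have h3: "halfplane_integral (\<lambda>y x. norm (PE (mA (mA P)) y x) * norm (PE (mA Q) y x) * norm (PE R y x)) \<le> ennreal (2 * pi * B)"
    using hp_bounded[OF hA _ _ halfplane_mA[OF Q]] by (simp add: mult_ac)
  have h4: "halfplane_integral (\<lambda>y x. norm (PE (mA (mX P)) y x) * norm (PE (mX Q) y x) * norm (PE R y x)) \<le> ennreal (2 * pi * B)"
    using hp_bounded[OF hX _ _ halfplane_mX[OF Q]] by (simp add: mult_ac)
  have h5: "halfplane_integral (\<lambda>y x. norm (PE (mX P) y x) * norm (PE (mX Q) y x) * norm (PE (mA R) y x)) \<le> ennreal (2 * pi * B)"
    using hp_R[OF halfplane_mX[OF Q] _ _ X refl, of "mA R"] by (simp add: mult_ac)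
  have h6: "halfplane_integral (\<lambda>y x. norm (PE (mX P) y x) * norm (PE (mA Q) y x) * norm (PE (mX R) y x)) \<le> ennreal (2 * pi * B)"
    using hp_R[OF halfplane_mA[OF Q] _ _ X refl, of "mX R"] by (simp add: mult_ac)
  \<comment> \<open>Each monomial is |\<xi>| times two more frequencies, each of modulus at most
    \<open>freq_sum z\<close>.\<close>
  have w: "norm (tri P' Q' R' z) \<le> (freq_sum z)\<^sup>2 * norm (tri (mX P) Q R z)"
    if "norm (tri P' Q' R' z) = a * b * (\<bar>fst z\<bar> * norm (tri P Q R z))" "a \<le> freq_sum z" "b \<le> freq_sum z" "0 \<le> a" "0 \<le> b"
    for P' Q' R' z a b
    unfolding that(1) nt by (rule weight_le) (use that in auto)
  have w1: "norm (tri (mA (mA P)) Q (mA R) z) \<le> (freq_sum z)\<^sup>2 * norm (tri (mX P) Q R z)" for z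
    by (rule w[where a = "\<bar>fst z\<bar>" and b = "\<bar>- fst z - snd z\<bar>"]) (auto simp: f1 tri_def mA_def mX_def norm_mult mult_ac simp del: of_real_diff of_real_minus)
  have w2: "norm (tri (mA (mX P)) Q (mX R) z) \<le> (freq_sum z)\<^sup>2 * norm (tri (mX P) Q R z)" for z
    by (rule w[where a = "\<bar>fst z\<bar>" and b = "\<bar>- fst z - snd z\<bar>"]) (auto simp: f1 tri_def mA_def mX_def norm_mult mult_ac simp del: of_real_diff of_real_minus)
  have w3: "norm (tri (mA (mA P)) (mA Q) R z) \<le> (freq_sum z)\<^sup>2 * norm (tri (mX P) Q R z)" for z
    by (rule w[where a = "\<bar>fst z\<bar>" and b = "\<bar>snd z\<bar>"]) (auto simp: f1 tri_def mA_def mX_def norm_mult mult_ac simp del: of_real_diff of_real_minus)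
  have w4: "norm (tri (mA (mX P)) (mX Q) R z) \<le> (freq_sum z)\<^sup>2 * norm (tri (mX P) Q R z)" for z
    by (rule w[where a = "\<bar>fst z\<bar>" and b = "\<bar>snd z\<bar>"]) (auto simp: f1 tri_def mA_def mX_def norm_mult mult_ac simp del: of_real_diff of_real_minus)
  have w5: "norm (tri (mX P) (mX Q) (mA R) z) \<le> (freq_sum z)\<^sup>2 * norm (tri (mX P) Q R z)" for z
    by (rule w[where a = "\<bar>snd z\<bar>" and b = "\<bar>- fst z - snd z\<bar>"]) (auto simp: f1 tri_def mA_def mX_def norm_mult mult_ac simp del: of_real_diff of_real_minus)
  have w6: "norm (tri (mX P) (mA Q) (mX R) z) \<le> (freq_sum z)\<^sup>2 * norm (tri (mX P) Q R z)" for z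
    by (rule w[where a = "\<bar>snd z\<bar>" and b = "\<bar>- fst z - snd z\<bar>"]) (auto simp: f1 tri_def mA_def mX_def norm_mult mult_ac simp del: of_real_diff of_real_minus)
  define T where "T P' Q' R' = (\<lambda>z. tri P' Q' R' z / complex_of_real ((freq_sum z)\<^sup>2))" for P' Q' R'
  note t1 = tri_term[OF exp_L12_mA[OF exp_L12_mA[OF e(1)]] e(2) exp_L12_mA[OF e(3)] w1 h1]
  note t2 = tri_term[OF exp_L12_mA[OF exp_L12_mX[OF e(1)]] e(2) exp_L12_mX[OF e(3)] w2 h2]
  note t3 = tri_term[OF exp_L12_mA[OF exp_L12_mA[OF e(1)]] exp_L12_mA[OF e(2)] e(3) w3 h3]
  note t4 = tri_term[OF exp_L12_mA[OF exp_L12_mX[OF e(1)]] exp_L12_mX[OF e(2)] e(3) w4 h4]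
  note t5 = tri_term[OF exp_L12_mX[OF e(1)] exp_L12_mX[OF e(2)] exp_L12_mA[OF e(3)] w5 h5]
  note t6 = tri_term[OF exp_L12_mX[OF e(1)] exp_L12_mA[OF e(2)] exp_L12_mX[OF e(3)] w6 h6]
  define T1 where "T1 = T (mA (mA P)) Q (mA R)"
  define T2 where "T2 = T (mA (mX P)) Q (mX R)"
  define T3 where "T3 = T (mA (mA P)) (mA Q) R"
  define T4 where "T4 = T (mA (mX P)) (mX Q) R"
  define T5 where "T5 = T (mX P) (mX Q) (mA R)"
  define T6 where "T6 = T (mX P) (mA Q) (mX R)"
  let ?L = "lborel \<Otimes>\<^sub>M lborel :: (real \<times> real) measure"
  have i: "integrable ?L T1" "integrable ?L T2" "integrable ?L T3" "integrable ?L T4" "integrable ?L T5" "integrable ?L T6"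
    unfolding T1_def T2_def T3_def T4_def T5_def T6_def T_def by (rule t1(1) t2(1) t3(1) t4(1) t5(1) t6(1))+
  have n: "norm (integral\<^sup>L ?L T1) \<le> B" "norm (integral\<^sup>L ?L T2) \<le> B" "norm (integral\<^sup>L ?L T3) \<le> B"
    "norm (integral\<^sup>L ?L T4) \<le> B" "norm (integral\<^sup>L ?L T5) \<le> B" "norm (integral\<^sup>L ?L T6) \<le> B"
    unfolding T1_def T2_def T3_def T4_def T5_def T6_def T_def by (rule t1(2) t2(2) t3(2) t4(2) t5(2) t6(2))+
  have "(LINT z|?L. complex_of_real (\<bar>fst z + snd z\<bar> - \<bar>snd z\<bar>) * tri P Q R z)
      = (LINT z|?L. 2 * T1 z - 2 * T2 z - 2 * T3 z + 2 * T4 z + 2 * T5 z - 2 * T6 z)"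
  proof (rule Bochner_Integration.integral_cong_AE)
    show "AE z in ?L. complex_of_real (\<bar>fst z + snd z\<bar> - \<bar>snd z\<bar>) * tri P Q R z
        = 2 * T1 z - 2 * T2 z - 2 * T3 z + 2 * T4 z + 2 * T5 z - 2 * T6 z"
      using freq_sum_AE
    proof eventually_elim
      case (elim z)
      define S where "S = complex_of_real ((freq_sum z)\<^sup>2)"
      have S: "S \<noteq> 0" using elim by (simp add: S_def)
      have ST: "S * (a / complex_of_real ((freq_sum z)\<^sup>2)) = a" for a using elim by (simp add: S_def)
      obtain \<xi> \<eta> where z: "z = (\<xi>, \<eta>)" by fastforce
      define t where "t = tri P Q R z"
      have "complex_of_real ((\<bar>\<xi> + \<eta>\<bar> - \<bar>\<eta>\<bar>) * (freq_sum z)\<^sup>2) * t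
        = complex_of_real (2 * (\<bar>\<xi>\<bar> * \<bar>\<xi>\<bar> * \<bar>- \<xi> - \<eta>\<bar>) - 2 * (\<bar>\<xi>\<bar> * \<xi> * (- \<xi> - \<eta>)) - 2 * (\<bar>\<xi>\<bar> * \<bar>\<xi>\<bar> * \<bar>\<eta>\<bar>)
          + 2 * (\<bar>\<xi>\<bar> * \<xi> * \<eta>) + 2 * (\<xi> * \<eta> * \<bar>- \<xi> - \<eta>\<bar>) - 2 * (\<xi> * \<bar>\<eta>\<bar> * (- \<xi> - \<eta>))) * t"
        using commutator_symbol[of \<xi> \<eta>] by (simp only: freq_sum_def z fst_conv snd_conv)
      also have "\<dots> = 2 * (S * T1 z) - 2 * (S * T2 z) - 2 * (S * T3 z) + 2 * (S * T4 z) + 2 * (S * T5 z) - 2 * (S * T6 z)"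
      proof -
        have "S * T1 z = complex_of_real (\<bar>\<xi>\<bar> * \<bar>\<xi>\<bar> * \<bar>- \<xi> - \<eta>\<bar>) * t" "S * T2 z = complex_of_real (\<bar>\<xi>\<bar> * \<xi> * (- \<xi> - \<eta>)) * t"
          "S * T3 z = complex_of_real (\<bar>\<xi>\<bar> * \<bar>\<xi>\<bar> * \<bar>\<eta>\<bar>) * t" "S * T4 z = complex_of_real (\<bar>\<xi>\<bar> * \<xi> * \<eta>) * t"
          "S * T5 z = complex_of_real (\<xi> * \<eta> * \<bar>- \<xi> - \<eta>\<bar>) * t" "S * T6 z = complex_of_real (\<xi> * \<bar>\<eta>\<bar> * (- \<xi> - \<eta>)) * t"
          unfolding T1_def T2_def T3_def T4_def T5_def T6_def T_def ST
          unfolding t_def z tri_def mA_def mX_def fst_conv snd_conv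
          by (simp_all only: of_real_mult mult_ac)
        then show ?thesis by (simp only: of_real_add of_real_diff of_real_mult of_real_numeral left_diff_distrib distrib_right mult.assoc)
      qed
      also have "\<dots> = S * (2 * T1 z - 2 * T2 z - 2 * T3 z + 2 * T4 z + 2 * T5 z - 2 * T6 z)"
        by (simp add: algebra_simps)
      finally have "S * (complex_of_real (\<bar>\<xi> + \<eta>\<bar> - \<bar>\<eta>\<bar>) * t) = S * (2 * T1 z - 2 * T2 z - 2 * T3 z + 2 * T4 z + 2 * T5 z - 2 * T6 z)"
        by (simp only: S_def of_real_mult mult_ac)
      then show ?case using S by (simp add: z t_def)
    qed
    show "(\<lambda>z. 2 * T1 z - 2 * T2 z - 2 * T3 z + 2 * T4 z + 2 * T5 z - 2 * T6 z) \<in> borel_measurable ?L"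
      using i by measurable
  qed measurable
  also have "\<dots> = 2 * integral\<^sup>L ?L T1 - 2 * integral\<^sup>L ?L T2 - 2 * integral\<^sup>L ?L T3 + 2 * integral\<^sup>L ?L T4 + 2 * integral\<^sup>L ?L T5 - 2 * integral\<^sup>L ?L T6"
    using i by simp
  finally have eq: "(LINT z|?L. complex_of_real (\<bar>fst z + snd z\<bar> - \<bar>snd z\<bar>) * tri P Q R z)
      = 2 * integral\<^sup>L ?L T1 - 2 * integral\<^sup>L ?L T2 - 2 * integral\<^sup>L ?L T3 + 2 * integral\<^sup>L ?L T4 + 2 * integral\<^sup>L ?L T5 - 2 * integral\<^sup>L ?L T6" .
  have tri6: "norm (2 * a - 2 * b - 2 * c + 2 * d + 2 * e' - 2 * g) \<le> 2 * norm a + 2 * norm b + 2 * norm c + 2 * norm d + 2 * norm e' + 2 * norm g"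
    for a b c d e' g :: complex
    by (intro order_trans[OF norm_triangle_ineq4] order_trans[OF norm_triangle_ineq] add_mono) (auto simp: norm_mult)
  have "norm (LINT z|?L. complex_of_real (\<bar>fst z + snd z\<bar> - \<bar>snd z\<bar>) * tri P Q R z) \<le> 12 * B"
    unfolding eq using tri6[of "integral\<^sup>L ?L T1" "integral\<^sup>L ?L T2" "integral\<^sup>L ?L T3" "integral\<^sup>L ?L T4" "integral\<^sup>L ?L T5" "integral\<^sup>L ?L T6"] n by linarith
  then show ?thesis by (simp add: mult_ac)
qed

end

section \<open>Duality\<close>

lemma fourier_eq_ft: "\<phi> \<in> borel_measurable borel \<Longrightarrow> fourier \<phi> = ft \<phi>"
  unfolding fourier_def[abs_def] ft_def[abs_def]
  by (subst integral_completion) (auto simp: mult.commute)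

lemma L2I:
  assumes u: "u \<in> borel_measurable lebesgue" and ae: "AE x in lebesgue. u x = u' x" and u': "sq_int u'"
  shows "u \<in> L2" "L2_norm u = sqrt (n2 u')"
proof -
  have [measurable]: "u' \<in> borel_measurable borel" using u' by auto
  have m: "(\<lambda>x. (norm (u x))\<^sup>2) \<in> borel_measurable lebesgue" using u by measurable
  have ae2: "AE x in lebesgue. (norm (u x))\<^sup>2 = (norm (u' x))\<^sup>2" using ae by eventually_elim simp
  have m': "(\<lambda>x. (norm (u' x))\<^sup>2) \<in> borel_measurable borel" by measurable
  note * = lebesgue_lborel[OF m m' ae2]
  show "u \<in> L2" using u u' * by (simp add: L2_def sq_int_def)
  show "L2_norm u = sqrt (n2 u')" using * by (simp add: L2_norm_def n2_def)
qed

lemma L2D: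
  assumes u: "u \<in> L2" and u' [measurable]: "u' \<in> borel_measurable borel" and ae: "AE x in lebesgue. u x = u' x"
  shows "sq_int u'" "L2_norm u = sqrt (n2 u')"
proof -
  have um: "u \<in> borel_measurable lebesgue" and ui: "integrable lebesgue (\<lambda>x. (norm (u x))\<^sup>2)" using u by (auto simp: L2_def)
  have m: "(\<lambda>x. (norm (u x))\<^sup>2) \<in> borel_measurable lebesgue" using um by measurable
  have ae2: "AE x in lebesgue. (norm (u x))\<^sup>2 = (norm (u' x))\<^sup>2" using ae by eventually_elim simp
  have m': "(\<lambda>x. (norm (u' x))\<^sup>2) \<in> borel_measurable borel" by measurable
  note * = lebesgue_lborel[OF m m' ae2]
  show "sq_int u'" using ui * by (simp add: sq_int_def)
  show "L2_norm u = sqrt (n2 u')" using * by (simp add: L2_norm_def n2_def)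
qed

lemma borel_lebesgue: "f \<in> borel_measurable borel \<Longrightarrow> f \<in> borel_measurable lebesgue"
  by (simp add: measurable_completion)

lemma lebesgue_pairing:
  fixes u u' v :: "real \<Rightarrow> complex"
  assumes u: "u \<in> borel_measurable lebesgue" and ae: "AE x in lebesgue. u x = u' x" and u': "u' \<in> borel_measurable borel"
    and v: "v \<in> borel_measurable borel"
  shows "integrable lebesgue (\<lambda>x. u x * v x) \<longleftrightarrow> integrable lborel (\<lambda>x. u' x * v x)"
    "(LINT x|lebesgue. u x * v x) = (LINT x|lborel. u' x * v x)"
proof -
  have m: "(\<lambda>x. u x * v x) \<in> borel_measurable lebesgue" using u borel_lebesgue[OF v] by measurable
  have m': "(\<lambda>x. u' x * v x) \<in> borel_measurable borel" using u' v by measurable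
  have ae2: "AE x in lebesgue. u x * v x = u' x * v x" using ae by eventually_elim simp
  show "integrable lebesgue (\<lambda>x. u x * v x) \<longleftrightarrow> integrable lborel (\<lambda>x. u' x * v x)"
    "(LINT x|lebesgue. u x * v x) = (LINT x|lborel. u' x * v x)"
    using lebesgue_lborel[OF m m' ae2] by simp_all
qed

lemma has_fourier_L2I:
  assumes u: "u \<in> borel_measurable lebesgue" and ae: "AE x in lebesgue. u x = u' x" and u': "sq_int u'" and U: "sq_int U"
    and eq: "\<And>\<phi>. \<phi> \<in> schwartz \<Longrightarrow> (LINT \<xi>|lborel. U \<xi> * \<phi> \<xi>) = (LINT x|lborel. u' x * ft \<phi> x)"
  shows "has_fourier_L2 u U"
  unfolding has_fourier_L2_def
proof (intro conjI ballI)
  have Um: "U \<in> borel_measurable borel" and um': "u' \<in> borel_measurable borel" using U u' by auto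
  show "u \<in> L2" by (rule L2I[OF u ae u'])
  show "U \<in> L2" by (rule L2I[OF borel_lebesgue[OF Um] _ U]) simp
  fix \<phi> assume \<phi>: "\<phi> \<in> schwartz"
  have \<phi>m: "\<phi> \<in> borel_measurable borel" by (rule schwartz_measurable[OF \<phi>])
  have "(LINT \<xi>|lebesgue. U \<xi> * \<phi> \<xi>) = (LINT \<xi>|lborel. U \<xi> * \<phi> \<xi>)"
    by (rule lebesgue_pairing[OF borel_lebesgue[OF Um] _ Um \<phi>m]) simp
  also have "\<dots> = (LINT x|lborel. u' x * ft \<phi> x)" by (rule eq[OF \<phi>])
  also have "\<dots> = (LINT x|lebesgue. u x * ft \<phi> x)"
    by (rule lebesgue_pairing(2)[OF u ae um' ft_measurable[OF \<phi>m], symmetric])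
  finally show "(LINT \<xi>|lebesgue. U \<xi> * \<phi> \<xi>) = (LINT x|lebesgue. u x * fourier \<phi> x)"
    by (simp only: fourier_eq_ft[OF \<phi>m])
qed

text \<open>|D| is applied on the Fourier side and inverted by duality: the inverse transform is the
  transform of the reflection over 2 pi. Test functions in \<open>L12\<close> are needed because it
  will be paired with f and f A, which are not Schwartz. The last conclusion covers every Lebesgue
  representative of \<open>u'\<close>.\<close>

lemma absD_exists:
  assumes u': "L12 u'" and D: "sq_int (mA (ft u'))"
  obtains h where "sq_int h"
    "\<And>k. L12 k \<Longrightarrow> (LINT x|lborel. h x * k x) = complex_of_real (1 / (2 * pi)) * (LINT \<xi>|lborel. mA (ft u') (- \<xi>) * ft k \<xi>)"
    "\<And>u. u \<in> borel_measurable lebesgue \<Longrightarrow> AE x in lebesgue. u x = u' x \<Longrightarrow> has_absD u h"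
proof -
  have ui: "integrable lborel u'" and u2: "sq_int u'" using u' by (auto simp: L12_def)
  have D': "sq_int (\<lambda>\<xi>. mA (ft u') (- \<xi>))" by (rule sq_int_reflect[OF D])
  have "sq_int (\<lambda>\<xi>. complex_of_real (1 / (2 * pi)) * mA (ft u') (- \<xi>))" by (rule sq_int_cmult[OF D'])
  from L2_fourier_exists[OF this] obtain h where h: "sq_int h"
    and hk: "\<And>k. L12 k \<Longrightarrow> (LINT x|lborel. h x * k x) = (LINT \<xi>|lborel. complex_of_real (1 / (2 * pi)) * mA (ft u') (- \<xi>) * ft k \<xi>)"
    by blast
  have hk': "(LINT x|lborel. h x * k x) = complex_of_real (1 / (2 * pi)) * (LINT \<xi>|lborel. mA (ft u') (- \<xi>) * ft k \<xi>)" if "L12 k" for k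
    unfolding hk[OF that] by (simp only: mult.assoc integral_mult_right_zero)
  have um: "u' \<in> borel_measurable borel" and hm: "h \<in> borel_measurable borel" using u2 h by auto
  have abs: "has_absD u h" if u: "u \<in> borel_measurable lebesgue" and ae: "AE x in lebesgue. u x = u' x" for u
    unfolding has_absD_def
  proof (intro exI conjI)
    show "has_fourier_L2 u (ft u')"
    proof (rule has_fourier_L2I[OF u ae u2])
      show "sq_int (ft u')" by (rule Bessel[OF u'])
      show "(LINT \<xi>|lborel. ft u' \<xi> * \<phi> \<xi>) = (LINT x|lborel. u' x * ft \<phi> x)" if "\<phi> \<in> schwartz" for \<phi>
        using schwartz_L12[OF that] by (intro ft_multiplication ui) (simp add: L12_def)
    qed
    have "has_fourier_L2 h (mA (ft u'))"
    proof (rule has_fourier_L2I[OF borel_lebesgue[OF hm] _ h D])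
      fix \<phi> assume \<phi>: "\<phi> \<in> schwartz"
      have F: "L12 (ft \<phi>)" by (rule ft_schwartz_L12[OF \<phi>])
      have [measurable]: "\<phi> \<in> borel_measurable borel" by (rule schwartz_measurable[OF \<phi>])
      note um[measurable]
      have "AE x in lborel. ft (ft \<phi>) x = complex_of_real (2 * pi) * \<phi> (- x)"
        using F by (intro ft_inversion schwartz_L12 \<phi>) (simp add: L12_def)
      then have ae: "AE x in lborel. mA (ft u') (- x) * ft (ft \<phi>) x = complex_of_real (2 * pi) * (mA (ft u') (- x) * \<phi> (- x))"
        by eventually_elim simp
      have "(LINT x|lborel. h x * ft \<phi> x) = complex_of_real (1 / (2 * pi)) * (LINT x|lborel. mA (ft u') (- x) * ft (ft \<phi>) x)"
        by (rule hk'[OF F])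
      also have "(LINT x|lborel. mA (ft u') (- x) * ft (ft \<phi>) x) = (LINT x|lborel. complex_of_real (2 * pi) * (mA (ft u') (- x) * \<phi> (- x)))"
        by (rule Bochner_Integration.integral_cong_AE[OF _ _ ae]) measurable
      also have "\<dots> = complex_of_real (2 * pi) * (LINT x|lborel. mA (ft u') x * \<phi> x)"
        using integral_reflect[of "\<lambda>x. mA (ft u') x * \<phi> x"] by simp
      finally show "(LINT \<xi>|lborel. mA (ft u') \<xi> * \<phi> \<xi>) = (LINT x|lborel. h x * ft \<phi> x)" by simp
    qed simp
    then show "has_fourier_L2 h (\<lambda>\<xi>. complex_of_real \<bar>\<xi>\<bar> * ft u' \<xi>)" by (simp add: mA_def[abs_def])
  qed
  show ?thesis by (rule that[OF h hk' abs])
qed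

text \<open>The change of variables \<eta> = - \<xi> - \<zeta> makes the frequency \<zeta> of f the
  outer variable; there the symbol |\<xi> + \<eta>| = |\<zeta>| is constant in the inner
  integral.\<close>

lemma shear_integral:
  fixes G :: "real \<Rightarrow> real \<Rightarrow> complex"
  assumes G: "integrable (lborel \<Otimes>\<^sub>M lborel) (\<lambda>z. G (fst z) (snd z))"
  shows "(LINT z|(lborel \<Otimes>\<^sub>M lborel). G (fst z) (snd z)) = (LINT \<zeta>|lborel. LINT \<xi>|lborel. G \<xi> (- \<xi> - \<zeta>))"
proof -
  have [measurable]: "(\<lambda>z. G (fst z) (snd z)) \<in> borel_measurable (lborel \<Otimes>\<^sub>M lborel)" using G by auto
  have m: "(\<lambda>(\<xi>, \<zeta>). G \<xi> (- \<xi> - \<zeta>)) \<in> borel_measurable (lborel \<Otimes>\<^sub>M lborel)"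
  proof -
    have "(\<lambda>z. (fst z, - fst z - snd z)) \<in> (lborel \<Otimes>\<^sub>M lborel) \<rightarrow>\<^sub>M (lborel \<Otimes>\<^sub>M (lborel :: real measure) :: (real \<times> real) measure)" by measurable
    from measurable_compose[OF this, of "\<lambda>z. G (fst z) (snd z)" borel] show ?thesis by (simp add: case_prod_unfold)
  qed
  have int: "integrable (lborel \<Otimes>\<^sub>M lborel) (\<lambda>(\<xi>, \<zeta>). G \<xi> (- \<xi> - \<zeta>))"
  proof (rule lborel_pair.Fubini_integrable[OF m])
    have "integrable lborel (\<lambda>\<xi>. LINT \<eta>|lborel. norm (G \<xi> \<eta>))"
      using lborel_pair.integrable_fst'[OF integrable_norm[OF G]] by simp
    moreover have "(LINT \<zeta>|lborel. norm (G \<xi> (- \<xi> - \<zeta>))) = (LINT \<eta>|lborel. norm (G \<xi> \<eta>))" for \<xi>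
      by (rule integral_affine_reflect)
    ultimately show "integrable lborel (\<lambda>\<xi>. LINT \<zeta>|lborel. norm (case (\<xi>, \<zeta>) of (\<xi>, \<zeta>) \<Rightarrow> G \<xi> (- \<xi> - \<zeta>)))" by simp
    show "AE \<xi> in lborel. integrable lborel (\<lambda>\<zeta>. case (\<xi>, \<zeta>) of (\<xi>, \<zeta>) \<Rightarrow> G \<xi> (- \<xi> - \<zeta>))"
      using lborel_pair.AE_integrable_fst'[OF G]
    proof eventually_elim
      case (elim \<xi>)
      then have "integrable lborel (\<lambda>\<eta>. G \<xi> \<eta>)" by simp
      from integrable_affine_reflect[OF this, of "- \<xi>"] show ?case by simp
    qed
  qed
  have "(LINT z|(lborel \<Otimes>\<^sub>M lborel). G (fst z) (snd z)) = (LINT \<xi>|lborel. LINT \<eta>|lborel. G \<xi> \<eta>)"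
    using lborel_pair.integral_fst'[OF G] by simp
  also have "\<dots> = (LINT \<xi>|lborel. LINT \<zeta>|lborel. G \<xi> (- \<xi> - \<zeta>))"
    by (simp only: integral_affine_reflect)
  also have "\<dots> = (LINT \<zeta>|lborel. LINT \<xi>|lborel. G \<xi> (- \<xi> - \<zeta>))"
    by (rule lborel_pair.Fubini_integral[OF int, symmetric])
  finally show ?thesis .
qed

section \<open>The commutator as a trilinear form\<close>

lemma L12_mult_schwartz:
  assumes u: "sq_int u" and \<phi>: "\<phi> \<in> schwartz"
  shows "L12 (\<lambda>x. u x * \<phi> x)"
proof -
  have p: "sq_int \<phi>" using schwartz_L12[OF \<phi>] by (simp add: L12_def)
  obtain C where C: "\<And>x. norm (\<phi> x) \<le> C / (1 + x\<^sup>2)" using schwartz_bound[OF \<phi>] by blast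
  have "0 \<le> C" using order_trans[OF norm_ge_zero C[of 0]] by simp
  have "norm (\<phi> x) \<le> C" for x
  proof (rule order_trans[OF C])
    have "C / (1 + x\<^sup>2) \<le> C / 1" using \<open>0 \<le> C\<close> by (intro divide_left_mono) (auto simp: add_pos_nonneg)
    then show "C / (1 + x\<^sup>2) \<le> C" by simp
  qed
  from sq_int_bounded_mult[OF u schwartz_measurable[OF \<phi>] this] have "sq_int (\<lambda>x. u x * \<phi> x)" by (simp add: mult.commute)
  then show ?thesis unfolding L12_def using sq_int_mult_integrable[OF u p] by simp
qed

text \<open>The Fourier side of A in H^1: \<open>V\<close> is its transform and \<open>B\<close> its
  derivative, and \<open>XB\<close> turns bounds in terms of \<open>mX V\<close> into bounds by the
  derivative.\<close>

locale H1_function =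
  fixes A B V :: "real \<Rightarrow> complex"
  assumes AV: "fourier_L2 A V" and BV: "fourier_L2 B (\<lambda>\<xi>. \<i> * (complex_of_real \<xi> * V \<xi>))" and Vi: "integrable lborel V"
    and X: "sq_int (mX V)" and XB: "n2 (mX V) \<le> 2 * pi * n2 B"
begin

lemma A_sq: "sq_int A" and B_sq: "sq_int B" and V_sq: "sq_int V"
  using AV BV by (auto simp: fourier_L2_def)

lemma meas [measurable]: "A \<in> borel_measurable borel" "B \<in> borel_measurable borel" "V \<in> borel_measurable borel"
  using A_sq B_sq V_sq by auto

text \<open>The integral of f (A |D| \<phi> - |D| (A \<phi>)) on the Fourier side. The two terms
  have the symbols |\<eta>| and |\<xi> + \<eta>|, hence the minus sign; each carries 1 / (2 pi) from
  |D| and another one from the product with A.\<close>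

definition form :: "(real \<Rightarrow> complex) \<Rightarrow> (real \<Rightarrow> complex) \<Rightarrow> complex" where
  "form f \<phi> = - complex_of_real (1 / (4 * pi\<^sup>2)) * (LINT z|(lborel \<Otimes>\<^sub>M lborel). complex_of_real (\<bar>fst z + snd z\<bar> - \<bar>snd z\<bar>) * tri V (ft \<phi>) (ft f) z)"

lemma ft_A_schwartz:
  assumes \<phi>: "\<phi> \<in> schwartz"
  shows "ft (\<lambda>x. A x * \<phi> x) \<zeta> = complex_of_real (1 / (2 * pi)) * (LINT \<xi>|lborel. V \<xi> * ft \<phi> (\<zeta> - \<xi>))"
  using ft_schwartz_L12[OF \<phi>] by (intro ft_mult_L2[OF AV schwartz_L12[OF \<phi>]]) (simp add: L12_def)

text \<open>By Leibniz' rule on the Fourier side, \<open>D (A \<phi>)\<close> is the sum of two products of an \<open>L\<^sup>2\<close> and a Schwartz function.\<close>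

lemma mA_ft_A_schwartz:
  assumes \<phi>: "\<phi> \<in> schwartz"
  shows "sq_int (mA (ft (\<lambda>x. A x * \<phi> x)))"
proof -
  have d: "vderiv \<phi> \<in> schwartz" by (rule schwartz_vderiv[OF \<phi>])
  have F: "L12 (ft \<phi>)" by (rule ft_schwartz_L12[OF \<phi>])
  have xF: "sq_int (\<lambda>\<xi>. complex_of_real \<xi> * ft \<phi> \<xi>)" by (rule sq_int_mult_ft_schwartz[OF \<phi>])
  have 1: "ft (\<lambda>x. B x * \<phi> x) \<zeta> = complex_of_real (1 / (2 * pi)) * (LINT \<xi>|lborel. (\<i> * (complex_of_real \<xi> * V \<xi>)) * ft \<phi> (\<zeta> - \<xi>))" for \<zeta>
    using F by (intro ft_mult_L2[OF BV schwartz_L12[OF \<phi>]]) (simp add: L12_def)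
  have eq: "ft (\<lambda>x. B x * \<phi> x) \<zeta> + ft (\<lambda>x. A x * vderiv \<phi> x) \<zeta> = \<i> * (complex_of_real \<zeta> * ft (\<lambda>x. A x * \<phi> x) \<zeta>)" for \<zeta>
  proof -
    have F2: "sq_int (\<lambda>\<xi>. ft \<phi> (\<zeta> - \<xi>))" using F by (intro sq_int_affine_reflect) (simp add: L12_def)
    have xF2: "sq_int (\<lambda>\<xi>. complex_of_real (\<zeta> - \<xi>) * ft \<phi> (\<zeta> - \<xi>))" by (rule sq_int_affine_reflect[OF xF])
    have i1: "integrable lborel (\<lambda>\<xi>. (complex_of_real \<xi> * V \<xi>) * ft \<phi> (\<zeta> - \<xi>))"
      using sq_int_mult_integrable[OF X F2] by (simp add: mX_def)
    have i2: "integrable lborel (\<lambda>\<xi>. V \<xi> * (complex_of_real (\<zeta> - \<xi>) * ft \<phi> (\<zeta> - \<xi>)))"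
      by (rule sq_int_mult_integrable[OF V_sq xF2])
    have "ft (\<lambda>x. B x * \<phi> x) \<zeta> + ft (\<lambda>x. A x * vderiv \<phi> x) \<zeta>
        = complex_of_real (1 / (2 * pi)) * \<i> * ((LINT \<xi>|lborel. (complex_of_real \<xi> * V \<xi>) * ft \<phi> (\<zeta> - \<xi>)) + (LINT \<xi>|lborel. V \<xi> * (complex_of_real (\<zeta> - \<xi>) * ft \<phi> (\<zeta> - \<xi>))))"
      unfolding 1 ft_A_schwartz[OF d] ft_vderiv[OF \<phi>]
      by (simp only: mult.assoc mult.left_commute[of _ \<i>] integral_mult_right_zero distrib_left)
    also have "(LINT \<xi>|lborel. (complex_of_real \<xi> * V \<xi>) * ft \<phi> (\<zeta> - \<xi>)) + (LINT \<xi>|lborel. V \<xi> * (complex_of_real (\<zeta> - \<xi>) * ft \<phi> (\<zeta> - \<xi>)))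
        = (LINT \<xi>|lborel. (complex_of_real \<xi> * V \<xi>) * ft \<phi> (\<zeta> - \<xi>) + V \<xi> * (complex_of_real (\<zeta> - \<xi>) * ft \<phi> (\<zeta> - \<xi>)))"
      by (rule Bochner_Integration.integral_add[OF i1 i2, symmetric])
    also have "\<dots> = (LINT \<xi>|lborel. complex_of_real \<zeta> * (V \<xi> * ft \<phi> (\<zeta> - \<xi>)))"
      by (intro Bochner_Integration.integral_cong refl) (simp add: algebra_simps)
    also have "\<dots> = complex_of_real \<zeta> * (LINT \<xi>|lborel. V \<xi> * ft \<phi> (\<zeta> - \<xi>))" by simp
    finally show ?thesis unfolding ft_A_schwartz[OF \<phi>] by (simp only: mult_ac)
  qed
  have "sq_int (\<lambda>\<zeta>. - \<i> * (ft (\<lambda>x. B x * \<phi> x) \<zeta> + ft (\<lambda>x. A x * vderiv \<phi> x) \<zeta>))"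
    by (intro sq_int_cmult sq_int_add Bessel L12_mult_schwartz A_sq B_sq \<phi> d)
  then have s: "sq_int (\<lambda>\<zeta>. complex_of_real \<zeta> * ft (\<lambda>x. A x * \<phi> x) \<zeta>)"
    unfolding eq by (simp add: mult.assoc[symmetric])
  have [measurable]: "\<phi> \<in> borel_measurable borel" by (rule schwartz_measurable[OF \<phi>])
  show ?thesis by (rule sq_int_mono[OF _ s]) (auto simp: mA_def norm_mult)
qed

lemma mA_ft_schwartz: "\<phi> \<in> schwartz \<Longrightarrow> sq_int (mA (ft \<phi>))"
  using sq_int_mult_ft_schwartz[of \<phi>] schwartz_measurable[of \<phi>]
  by (intro sq_int_mono[OF _ sq_int_mult_ft_schwartz[of \<phi>]]) (auto simp: mA_def norm_mult)

text \<open>|\<xi> + \<eta>| \<le> |\<xi>| + |\<eta>|, and the two parts converge for different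
  reasons: \<open>V\<close> is in L^1 when |\<eta>| falls on \<open>ft \<phi>\<close>, and
  \<open>ft \<phi>\<close> is in L^1 when |\<xi>| falls on \<open>V\<close>.\<close>

lemma tri_V_integrable:
  assumes \<phi>: "\<phi> \<in> schwartz" and f: "L12 f"
  shows "integrable (lborel \<Otimes>\<^sub>M lborel) (\<lambda>z. complex_of_real \<bar>snd z\<bar> * tri V (ft \<phi>) (ft f) z)"
    and "integrable (lborel \<Otimes>\<^sub>M lborel) (\<lambda>z. complex_of_real \<bar>fst z + snd z\<bar> * tri V (ft \<phi>) (ft f) z)"
proof -
  have R: "sq_int (ft f)" by (rule Bessel[OF f])
  have F: "integrable lborel (ft \<phi>)" using ft_schwartz_L12[OF \<phi>] by (simp add: L12_def)
  have [measurable]: "\<phi> \<in> borel_measurable borel" "f \<in> borel_measurable borel"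
    using schwartz_measurable[OF \<phi>] f by (auto simp: L12_def)
  have i1: "integrable (lborel \<Otimes>\<^sub>M lborel) (tri V (mA (ft \<phi>)) (ft f))"
    by (rule tri_integrable[OF Vi mA_ft_schwartz[OF \<phi>] R])
  have i2: "integrable (lborel \<Otimes>\<^sub>M lborel) (tri (mX V) (ft \<phi>) (ft f))"
    by (rule tri_integrable_swap[OF X F R])
  show "integrable (lborel \<Otimes>\<^sub>M lborel) (\<lambda>z. complex_of_real \<bar>snd z\<bar> * tri V (ft \<phi>) (ft f) z)"
    using i1 by (simp add: tri_def[abs_def] mA_def mult_ac)
  show "integrable (lborel \<Otimes>\<^sub>M lborel) (\<lambda>z. complex_of_real \<bar>fst z + snd z\<bar> * tri V (ft \<phi>) (ft f) z)"
  proof (rule Bochner_Integration.integrable_bound[OF Bochner_Integration.integrable_add[OF integrable_norm[OF i1] integrable_norm[OF i2]]])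
    show "AE z in lborel \<Otimes>\<^sub>M lborel. norm (complex_of_real \<bar>fst z + snd z\<bar> * tri V (ft \<phi>) (ft f) z)
        \<le> norm (norm (tri V (mA (ft \<phi>)) (ft f) z) + norm (tri (mX V) (ft \<phi>) (ft f) z))"
    proof (rule AE_I2)
      fix z :: "real \<times> real"
      have "\<bar>fst z + snd z\<bar> * norm (tri V (ft \<phi>) (ft f) z) \<le> (\<bar>snd z\<bar> + \<bar>fst z\<bar>) * norm (tri V (ft \<phi>) (ft f) z)"
        by (intro mult_right_mono) auto
      then show "norm (complex_of_real \<bar>fst z + snd z\<bar> * tri V (ft \<phi>) (ft f) z)
        \<le> norm (norm (tri V (mA (ft \<phi>)) (ft f) z) + norm (tri (mX V) (ft \<phi>) (ft f) z))"
        by (simp add: tri_def mA_def mX_def norm_mult ring_distribs mult_ac)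
    qed
  qed measurable
qed

text \<open>264 pi from the trilinear bound, 1 / (4 pi^2) from the definition and sqrt (2 pi) twice
  from Plancherel make 132.\<close>

lemma form_bound:
  assumes \<phi>: "\<phi> \<in> schwartz" and f: "integrable lborel f" and M: "\<And>x. norm (f x) \<le> M"
  shows "norm (form f \<phi>) \<le> 132 * M * sqrt (n2 B) * sqrt (n2 \<phi>)"
proof -
  have F: "L12 (ft \<phi>)" by (rule ft_schwartz_L12[OF \<phi>])
  interpret trilinear V "ft \<phi>" f M
    by unfold_locales (use F V_sq X f M in \<open>auto simp: L12_def\<close>)
  have "norm (form f \<phi>) = 1 / (4 * pi\<^sup>2) * norm (LINT z|(lborel \<Otimes>\<^sub>M lborel). complex_of_real (\<bar>fst z + snd z\<bar> - \<bar>snd z\<bar>) * tri V (ft \<phi>) (ft f) z)"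
    by (simp add: form_def norm_mult norm_divide norm_power)
  also have "\<dots> \<le> 1 / (4 * pi\<^sup>2) * (264 * pi * M * (sqrt (n2 (mX V)) * sqrt (n2 (ft \<phi>))))"
    by (intro mult_left_mono trilinear_bound) auto
  also have "\<dots> \<le> 1 / (4 * pi\<^sup>2) * (264 * pi * M * (sqrt (2 * pi * n2 B) * sqrt (2 * pi * n2 \<phi>)))"
    using M0 by (intro mult_left_mono mult_mono real_sqrt_le_mono XB Bessel schwartz_L12 \<phi>) auto
  also have "sqrt (2 * pi * n2 B) * sqrt (2 * pi * n2 \<phi>) = 2 * pi * (sqrt (n2 B) * sqrt (n2 \<phi>))"
  proof -
    have "sqrt (2 * pi * n2 B) * sqrt (2 * pi * n2 \<phi>) = sqrt ((2 * pi)\<^sup>2 * (n2 B * n2 \<phi>))"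
      by (simp add: real_sqrt_mult[symmetric] power2_eq_square mult_ac)
    then show ?thesis by (simp add: real_sqrt_mult)
  qed
  also have "1 / (4 * pi\<^sup>2) * (264 * pi * M * (2 * pi * (sqrt (n2 B) * sqrt (n2 \<phi>)))) = 132 * M * sqrt (n2 B) * sqrt (n2 \<phi>)"
    by (simp add: power2_eq_square)
  finally show ?thesis .
qed

lemma form_add:
  assumes \<phi>: "\<phi> \<in> schwartz" and \<psi>: "\<psi> \<in> schwartz" and f: "L12 f"
  shows "form f (\<lambda>x. \<phi> x + \<psi> x) = form f \<phi> + form f \<psi>"
proof -
  have i: "integrable lborel \<phi>" "integrable lborel \<psi>" using schwartz_L12[OF \<phi>] schwartz_L12[OF \<psi>] by (auto simp: L12_def)
  have I: "integrable (lborel \<Otimes>\<^sub>M lborel) (\<lambda>z. complex_of_real (\<bar>fst z + snd z\<bar> - \<bar>snd z\<bar>) * tri V (ft \<phi>) (ft f) z)" if "\<phi> \<in> schwartz" for \<phi>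
    using Bochner_Integration.integrable_diff[OF tri_V_integrable(2,1)[OF that f]] by (simp add: left_diff_distrib)
  have "(LINT z|(lborel \<Otimes>\<^sub>M lborel). complex_of_real (\<bar>fst z + snd z\<bar> - \<bar>snd z\<bar>) * tri V (ft (\<lambda>x. \<phi> x + \<psi> x)) (ft f) z)
      = (LINT z|(lborel \<Otimes>\<^sub>M lborel). complex_of_real (\<bar>fst z + snd z\<bar> - \<bar>snd z\<bar>) * tri V (ft \<phi>) (ft f) z
        + complex_of_real (\<bar>fst z + snd z\<bar> - \<bar>snd z\<bar>) * tri V (ft \<psi>) (ft f) z)"
    by (simp only: tri_def ft_add[OF i] distrib_left distrib_right)
  also have "\<dots> = (LINT z|(lborel \<Otimes>\<^sub>M lborel). complex_of_real (\<bar>fst z + snd z\<bar> - \<bar>snd z\<bar>) * tri V (ft \<phi>) (ft f) z)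
        + (LINT z|(lborel \<Otimes>\<^sub>M lborel). complex_of_real (\<bar>fst z + snd z\<bar> - \<bar>snd z\<bar>) * tri V (ft \<psi>) (ft f) z)"
    by (rule Bochner_Integration.integral_add[OF I[OF \<phi>] I[OF \<psi>]])
  finally show ?thesis unfolding form_def by (simp only: distrib_left)
qed

lemma form_cmult: "form f (\<lambda>x. c * \<phi> x) = c * form f \<phi>"
proof -
  have "(LINT z|(lborel \<Otimes>\<^sub>M lborel). complex_of_real (\<bar>fst z + snd z\<bar> - \<bar>snd z\<bar>) * tri V (ft (\<lambda>x. c * \<phi> x)) (ft f) z)
      = (LINT z|(lborel \<Otimes>\<^sub>M lborel). c * (complex_of_real (\<bar>fst z + snd z\<bar> - \<bar>snd z\<bar>) * tri V (ft \<phi>) (ft f) z))"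
    by (simp only: tri_def ft_cmult mult_ac)
  also have "\<dots> = c * (LINT z|(lborel \<Otimes>\<^sub>M lborel). complex_of_real (\<bar>fst z + snd z\<bar> - \<bar>snd z\<bar>) * tri V (ft \<phi>) (ft f) z)"
    by (rule integral_mult_right_zero)
  finally show ?thesis unfolding form_def by (simp only: mult_ac)
qed

text \<open>\<open>h\<close> and \<open>H\<close> stand for \<open>|D| \<phi>\<close> and \<open>|D| (A \<phi>)\<close>.\<close>

lemma form_eq:
  assumes \<phi>: "\<phi> \<in> schwartz" and f: "integrable lborel f" and M: "\<And>x. norm (f x) \<le> M"
    and h: "sq_int h" "\<And>k. L12 k \<Longrightarrow> (LINT x|lborel. h x * k x) = complex_of_real (1 / (2 * pi)) * (LINT \<xi>|lborel. mA (ft \<phi>) (- \<xi>) * ft k \<xi>)"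
    and H: "sq_int H" "\<And>k. L12 k \<Longrightarrow> (LINT x|lborel. H x * k x) = complex_of_real (1 / (2 * pi)) * (LINT \<xi>|lborel. mA (ft (\<lambda>x. A x * \<phi> x)) (- \<xi>) * ft k \<xi>)"
  shows "(LINT x|lborel. f x * (A x * h x - H x)) = form f \<phi>"
proof -
  have f12: "L12 f" by (rule L12_bounded[OF f M])
  have f2: "sq_int f" using f12 by (simp add: L12_def)
  have [measurable]: "f \<in> borel_measurable borel" "h \<in> borel_measurable borel" "H \<in> borel_measurable borel" "\<phi> \<in> borel_measurable borel"
    using f h(1) H(1) schwartz_measurable[OF \<phi>] by auto
  have fA: "L12 (\<lambda>x. f x * A x)"
    unfolding L12_def using sq_int_bounded_mult[OF A_sq _ M] sq_int_mult_integrable[OF f2 A_sq] by auto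
  define c where "c = complex_of_real (1 / (2 * pi))"
  have cc: "c * c = complex_of_real (1 / (4 * pi\<^sup>2))" by (simp add: c_def power2_eq_square)
  note I = tri_V_integrable[OF \<phi> f12]
  \<comment> \<open>The term with |D| (A \<phi>): its symbol is the modulus of the frequency of f,
    because the three frequencies add up to zero.\<close>
  have "(LINT x|lborel. H x * f x) = c * (LINT \<zeta>|lborel. mA (ft (\<lambda>x. A x * \<phi> x)) (- \<zeta>) * ft f \<zeta>)"
    unfolding c_def by (rule H(2)[OF f12])
  also have "(LINT \<zeta>|lborel. mA (ft (\<lambda>x. A x * \<phi> x)) (- \<zeta>) * ft f \<zeta>)
      = c * (LINT \<zeta>|lborel. LINT \<xi>|lborel. complex_of_real \<bar>\<xi> + (- \<xi> - \<zeta>)\<bar> * tri V (ft \<phi>) (ft f) (\<xi>, - \<xi> - \<zeta>))"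
  proof -
    have "mA (ft (\<lambda>x. A x * \<phi> x)) (- \<zeta>) * ft f \<zeta> = c * (LINT \<xi>|lborel. complex_of_real \<bar>\<xi> + (- \<xi> - \<zeta>)\<bar> * tri V (ft \<phi>) (ft f) (\<xi>, - \<xi> - \<zeta>))" for \<zeta>
    proof -
      have "(LINT \<xi>|lborel. complex_of_real \<bar>\<xi> + (- \<xi> - \<zeta>)\<bar> * tri V (ft \<phi>) (ft f) (\<xi>, - \<xi> - \<zeta>))
          = (LINT \<xi>|lborel. complex_of_real \<bar>\<zeta>\<bar> * ft f \<zeta> * (V \<xi> * ft \<phi> (- \<zeta> - \<xi>)))"
      proof (intro Bochner_Integration.integral_cong refl)
        fix \<xi>
        have "- \<xi> - (- \<xi> - \<zeta>) = \<zeta>" "\<bar>\<xi> + (- \<xi> - \<zeta>)\<bar> = \<bar>\<zeta>\<bar>" "- \<xi> - \<zeta> = - \<zeta> - \<xi>" by simp_all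
        then show "complex_of_real \<bar>\<xi> + (- \<xi> - \<zeta>)\<bar> * tri V (ft \<phi>) (ft f) (\<xi>, - \<xi> - \<zeta>) = complex_of_real \<bar>\<zeta>\<bar> * ft f \<zeta> * (V \<xi> * ft \<phi> (- \<zeta> - \<xi>))"
          unfolding tri_def fst_conv snd_conv by (simp only: mult_ac)
      qed
      also have "\<dots> = complex_of_real \<bar>\<zeta>\<bar> * ft f \<zeta> * (LINT \<xi>|lborel. V \<xi> * ft \<phi> (- \<zeta> - \<xi>))"
        by (rule integral_mult_right_zero)
      finally show ?thesis unfolding mA_def ft_A_schwartz[OF \<phi>] c_def by (simp only: abs_minus_cancel mult_ac)
    qed
    then show ?thesis by (simp only: integral_mult_right_zero)
  qed
  also have "(LINT \<zeta>|lborel. LINT \<xi>|lborel. complex_of_real \<bar>\<xi> + (- \<xi> - \<zeta>)\<bar> * tri V (ft \<phi>) (ft f) (\<xi>, - \<xi> - \<zeta>))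
      = (LINT z|(lborel \<Otimes>\<^sub>M lborel). complex_of_real \<bar>fst z + snd z\<bar> * tri V (ft \<phi>) (ft f) z)"
    using shear_integral[of "\<lambda>\<xi> \<eta>. complex_of_real \<bar>\<xi> + \<eta>\<bar> * tri V (ft \<phi>) (ft f) (\<xi>, \<eta>)"] I(2) by simp
  finally have e1: "(LINT x|lborel. H x * f x) = c * c * (LINT z|(lborel \<Otimes>\<^sub>M lborel). complex_of_real \<bar>fst z + snd z\<bar> * tri V (ft \<phi>) (ft f) z)"
    by (simp only: mult.assoc)
  have ftfA: "ft (\<lambda>x. f x * A x) \<eta> = c * (LINT \<xi>|lborel. V \<xi> * ft f (\<eta> - \<xi>))" for \<eta>
  proof -
    define W where "W = (\<lambda>\<xi>. V (- \<xi>))"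
    have Wi: "integrable lborel W" unfolding W_def by (rule integrable_reflect[OF Vi])
    have ftW: "ft V (- x) = ft W x" for x
      unfolding ft_def W_def using integral_reflect[of "\<lambda>\<xi>. cis (- (- x * \<xi>)) * V \<xi>"] by simp
    have [measurable]: "W \<in> borel_measurable borel" using Wi by auto
    have "AE x in lborel. cis (- (\<eta> * x)) * (f x * A x) = c * (cis (- (\<eta> * x)) * (f x * ft W x))"
      using fourier_L2_inversion[OF AV Vi] by eventually_elim (simp only: ftW c_def mult_ac)
    then have "ft (\<lambda>x. f x * A x) \<eta> = (LINT x|lborel. c * (cis (- (\<eta> * x)) * (f x * ft W x)))"
      unfolding ft_def[of "\<lambda>x. f x * A x"] by (intro Bochner_Integration.integral_cong_AE) measurable
    also have "\<dots> = c * ft (\<lambda>x. f x * ft W x) \<eta>" by (simp only: integral_mult_right_zero ft_def[of "\<lambda>x. f x * ft W x"])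
    also have "ft (\<lambda>x. f x * ft W x) \<eta> = (LINT \<xi>|lborel. W \<xi> * ft f (\<eta> + \<xi>))" by (rule ft_mult_ft[OF f Wi])
    also have "\<dots> = (LINT \<xi>|lborel. V \<xi> * ft f (\<eta> - \<xi>))"
      using integral_reflect[of "\<lambda>\<xi>. V \<xi> * ft f (\<eta> - \<xi>)"] by (simp add: W_def)
    finally show ?thesis .
  qed
  have "(LINT x|lborel. h x * (f x * A x)) = c * (LINT \<eta>|lborel. mA (ft \<phi>) (- \<eta>) * ft (\<lambda>x. f x * A x) \<eta>)"
    unfolding c_def by (rule h(2)[OF fA])
  also have "(LINT \<eta>|lborel. mA (ft \<phi>) (- \<eta>) * ft (\<lambda>x. f x * A x) \<eta>) = (LINT \<eta>|lborel. mA (ft \<phi>) \<eta> * ft (\<lambda>x. f x * A x) (- \<eta>))"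
    using integral_reflect[of "\<lambda>\<eta>. mA (ft \<phi>) \<eta> * ft (\<lambda>x. f x * A x) (- \<eta>)"] by simp
  also have "\<dots> = c * (LINT \<eta>|lborel. LINT \<xi>|lborel. complex_of_real \<bar>\<eta>\<bar> * tri V (ft \<phi>) (ft f) (\<xi>, \<eta>))"
  proof -
    have "mA (ft \<phi>) \<eta> * ft (\<lambda>x. f x * A x) (- \<eta>) = c * (LINT \<xi>|lborel. complex_of_real \<bar>\<eta>\<bar> * tri V (ft \<phi>) (ft f) (\<xi>, \<eta>))" for \<eta>
    proof -
      have "(LINT \<xi>|lborel. complex_of_real \<bar>\<eta>\<bar> * tri V (ft \<phi>) (ft f) (\<xi>, \<eta>)) = (LINT \<xi>|lborel. mA (ft \<phi>) \<eta> * (V \<xi> * ft f (- \<eta> - \<xi>)))"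
      proof (intro Bochner_Integration.integral_cong refl)
        fix \<xi>
        have "- \<xi> - \<eta> = - \<eta> - \<xi>" by simp
        then show "complex_of_real \<bar>\<eta>\<bar> * tri V (ft \<phi>) (ft f) (\<xi>, \<eta>) = mA (ft \<phi>) \<eta> * (V \<xi> * ft f (- \<eta> - \<xi>))"
          unfolding tri_def mA_def fst_conv snd_conv by (simp only: mult_ac)
      qed
      also have "\<dots> = mA (ft \<phi>) \<eta> * (LINT \<xi>|lborel. V \<xi> * ft f (- \<eta> - \<xi>))" by (rule integral_mult_right_zero)
      finally show ?thesis unfolding ftfA by (simp only: mult_ac)
    qed
    then show ?thesis by (simp only: integral_mult_right_zero)
  qed
  also have "(LINT \<eta>|lborel. LINT \<xi>|lborel. complex_of_real \<bar>\<eta>\<bar> * tri V (ft \<phi>) (ft f) (\<xi>, \<eta>))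
      = (LINT z|(lborel \<Otimes>\<^sub>M lborel). complex_of_real \<bar>snd z\<bar> * tri V (ft \<phi>) (ft f) z)"
    using lborel_pair.integral_snd[of "\<lambda>\<xi> \<eta>. complex_of_real \<bar>\<eta>\<bar> * tri V (ft \<phi>) (ft f) (\<xi>, \<eta>)"] I(1)
    by (simp add: case_prod_unfold)
  finally have e2: "(LINT x|lborel. h x * (f x * A x)) = c * c * (LINT z|(lborel \<Otimes>\<^sub>M lborel). complex_of_real \<bar>snd z\<bar> * tri V (ft \<phi>) (ft f) z)"
    by (simp only: mult.assoc)
  have "(LINT x|lborel. f x * (A x * h x - H x)) = (LINT x|lborel. h x * (f x * A x) - H x * f x)"
    by (intro Bochner_Integration.integral_cong refl) (simp add: algebra_simps)
  also have "\<dots> = (LINT x|lborel. h x * (f x * A x)) - (LINT x|lborel. H x * f x)"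
    using fA f2 by (intro Bochner_Integration.integral_diff sq_int_mult_integrable h H) (auto simp: L12_def)
  also have "\<dots> = - (c * c) * ((LINT z|(lborel \<Otimes>\<^sub>M lborel). complex_of_real \<bar>fst z + snd z\<bar> * tri V (ft \<phi>) (ft f) z)
      - (LINT z|(lborel \<Otimes>\<^sub>M lborel). complex_of_real \<bar>snd z\<bar> * tri V (ft \<phi>) (ft f) z))"
    unfolding e1 e2 by (simp add: algebra_simps)
  also have "\<dots> = form f \<phi>"
    unfolding form_def cc using I by (simp add: left_diff_distrib)
  finally show ?thesis .
qed

end

text \<open>\<open>is_absD u h\<close>: \<open>h = |D| u\<close>, tested against functions whose Fourier transform is merely in \<open>L\<^sup>2\<close>.\<close>

definition is_absD :: "(real \<Rightarrow> complex) \<Rightarrow> (real \<Rightarrow> complex) \<Rightarrow> bool" where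
  "is_absD u h \<longleftrightarrow> sq_int h \<and> (\<forall>k. L12 k \<longrightarrow>
     (LINT x|lborel. h x * k x) = complex_of_real (1 / (2 * pi)) * (LINT \<xi>|lborel. mA (ft u) (- \<xi>) * ft k \<xi>))"

text \<open>Truncation makes a bounded function integrable without raising its supremum, so
  \<open>form_bound\<close> holds uniformly in n.\<close>

definition cutoff :: "(real \<Rightarrow> complex) \<Rightarrow> nat \<Rightarrow> real \<Rightarrow> complex" where
  "cutoff f n x = indicator {- real n..real n} x *\<^sub>R f x"

section \<open>Truncation and existence of the commutator\<close>

lemma cutoff_integrable:
  assumes [measurable]: "f \<in> borel_measurable borel" and M: "\<And>x. norm (f x) \<le> M"
  shows "integrable lborel (cutoff f n)" "norm (cutoff f n x) \<le> M"
proof -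
  have M0: "0 \<le> M" using order_trans[OF norm_ge_zero M[of 0]] .
  have "integrable lborel (\<lambda>x. indicator {- real n..real n} x * M)"
    by (intro integrable_mult_left) (simp add: integrable_indicator_iff)
  then show "integrable lborel (cutoff f n)"
    unfolding cutoff_def[abs_def]
    by (rule Bochner_Integration.integrable_bound) (auto simp: indicator_def intro: order_trans[OF M abs_ge_self])
  show "norm (cutoff f n x) \<le> M"
    using M[of x] M0 by (simp add: cutoff_def indicator_def)
qed

lemma cutoff_measurable [measurable]: "f \<in> borel_measurable borel \<Longrightarrow> cutoff f n \<in> borel_measurable borel"
  unfolding cutoff_def[abs_def] by measurable

lemma cutoff_eventually: "eventually (\<lambda>n. cutoff f n x = f x) sequentially"
proof -
  obtain N :: nat where N: "\<bar>x\<bar> \<le> real N" using real_arch_simple by blast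
  show ?thesis using eventually_ge_at_top[of N]
    by eventually_elim (use N in \<open>auto simp: cutoff_def indicator_def\<close>)
qed

context H1_function
begin

lemma form_is_absD:
  assumes "\<phi> \<in> schwartz" "integrable lborel f" "\<And>x. norm (f x) \<le> M" "is_absD \<phi> h" "is_absD (\<lambda>x. A x * \<phi> x) H"
  shows "(LINT x|lborel. f x * (A x * h x - H x)) = form f \<phi>"
  using form_eq[OF assms(1-3)] assms(4,5) by (simp add: is_absD_def)

text \<open>The commutator of a Schwartz function is only known to be in \<open>L\<^sup>1 + L\<^sup>2\<close> a priori; testing with its truncated
  conjugate phase puts it in \<open>L\<^sup>1\<close>.\<close>

lemma commutator_integrable:
  assumes \<phi>: "\<phi> \<in> schwartz" and h: "is_absD \<phi> h" and H: "is_absD (\<lambda>x. A x * \<phi> x) H"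
  shows "integrable lborel (\<lambda>x. A x * h x - H x)"
proof -
  define k where "k = (\<lambda>x. A x * h x - H x)"
  have h2: "sq_int h" and H2: "sq_int H" using h H by (auto simp: is_absD_def)
  have [measurable]: "h \<in> borel_measurable borel" "H \<in> borel_measurable borel" using h2 H2 by auto
  have k [measurable]: "k \<in> borel_measurable borel" unfolding k_def by measurable
  \<comment> \<open>The conjugate phase of \<open>k\<close>, bounded by 1; division by zero gives 0
    where \<open>k\<close> vanishes.\<close>
  define s where "s = (\<lambda>x. cnj (k x) / complex_of_real (norm (k x)))"
  have [measurable]: "s \<in> borel_measurable borel" unfolding s_def by measurable
  have s1: "norm (s x) \<le> 1" for x by (simp add: s_def norm_divide)
  have sk: "s x * k x = complex_of_real (norm (k x))" for x
  proof (cases "k x = 0")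
    case False
    have "cnj (k x) * k x = complex_of_real (norm (k x)) * complex_of_real (norm (k x))"
      using complex_norm_square[of "k x"] by (simp add: power2_eq_square mult.commute)
    then show ?thesis using False by (simp add: s_def divide_simps)
  qed (simp add: s_def)
  \<comment> \<open>\<open>form_bound\<close> with M = 1. It does not depend on the truncation, so
    Fatou's lemma puts \<open>k\<close> in L^1.\<close>
  define D where "D = 132 * 1 * sqrt (n2 B) * sqrt (n2 \<phi>)"
  have bound: "(\<integral>\<^sup>+x. ennreal (norm (cutoff k n x)) \<partial>lborel) \<le> ennreal D" for n
  proof -
    have ci: "integrable lborel (cutoff s n)" by (rule cutoff_integrable(1)[OF _ s1]) measurable
    have cb: "norm (cutoff s n x) \<le> 1" for x by (rule cutoff_integrable(2)[OF _ s1]) measurable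
    have c2: "sq_int (cutoff s n)" using L12_bounded[OF ci cb] by (simp add: L12_def)
    have cnk: "cutoff s n x * k x = complex_of_real (norm (cutoff k n x))" for x
      by (cases "x \<in> {- real n..real n}") (auto simp: cutoff_def sk)
    have i1: "integrable lborel (\<lambda>x. cutoff s n x * (A x * h x))"
      by (rule Bochner_Integration.integrable_bound[OF sq_int_mult_integrable[OF A_sq h2]])
         (auto simp: norm_mult intro!: AE_I2 mult_left_le_one_le cb)
    have "integrable lborel (\<lambda>x. cutoff s n x * (A x * h x) - cutoff s n x * H x)"
      by (intro Bochner_Integration.integrable_diff i1 sq_int_mult_integrable c2 H2)
    then have "integrable lborel (\<lambda>x. cutoff s n x * k x)" by (simp add: k_def right_diff_distrib)
    then have i: "integrable lborel (\<lambda>x. norm (cutoff k n x))"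
      using integrable_norm[of lborel "\<lambda>x. cutoff s n x * k x"] unfolding cnk by simp
    have "cutoff s n x * (A x * h x - H x) = cutoff s n x * k x" for x by (simp only: k_def)
    then have "cutoff s n x * (A x * h x - H x) = complex_of_real (norm (cutoff k n x))" for x
      by (simp only: cnk)
    then have "complex_of_real (LINT x|lborel. norm (cutoff k n x)) = form (cutoff s n) \<phi>"
      using form_is_absD[OF \<phi> ci cb h H] by (simp only: integral_complex_of_real)
    then have "norm (complex_of_real (LINT x|lborel. norm (cutoff k n x))) \<le> D"
      using form_bound[OF \<phi> ci cb] by (simp only: D_def)
    then have "(LINT x|lborel. norm (cutoff k n x)) \<le> D" by simp
    then show ?thesis using nn_integral_eq_integral[OF i] by (simp add: ennreal_leI)
  qed
  have "(\<integral>\<^sup>+x. ennreal (norm (k x)) \<partial>lborel) = (\<integral>\<^sup>+x. liminf (\<lambda>n. ennreal (norm (cutoff k n x))) \<partial>lborel)"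
  proof (rule nn_integral_cong)
    fix x
    have "(\<lambda>n. ennreal (norm (cutoff k n x))) \<longlonglongrightarrow> ennreal (norm (k x))"
      by (rule tendsto_eventually, rule eventually_mono[OF cutoff_eventually[of k x]]) simp
    then show "ennreal (norm (k x)) = liminf (\<lambda>n. ennreal (norm (cutoff k n x)))"
      by (intro lim_imp_Liminf[symmetric]) auto
  qed
  also have "\<dots> \<le> liminf (\<lambda>n. \<integral>\<^sup>+x. ennreal (norm (cutoff k n x)) \<partial>lborel)"
    by (intro nn_integral_liminf) measurable
  also have "\<dots> \<le> ennreal D"
    by (intro Liminf_le always_eventually allI bound) simp
  finally have "(\<integral>\<^sup>+x. ennreal (norm (k x)) \<partial>lborel) < \<infinity>"
    using le_less_trans[OF _ ennreal_less_top] by simp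
  then have "integrable lborel k" by (intro integrableI_bounded) auto
  then show ?thesis by (simp add: k_def)
qed

text \<open>The forms of the truncations of f are bounded uniformly, and they converge by dominated
  convergence because the commutator of a Schwartz function is integrable. Their limit is a bounded
  functional, represented by \<open>g\<close>.\<close>

lemma commutator_exists:
  assumes f [measurable]: "f \<in> borel_measurable borel" and M: "\<And>x. norm (f x) \<le> M"
  obtains g where "sq_int g" "sqrt (n2 g) \<le> 132 * M * sqrt (n2 B)"
    "\<And>\<phi> h H. \<phi> \<in> schwartz \<Longrightarrow> is_absD \<phi> h \<Longrightarrow> is_absD (\<lambda>x. A x * \<phi> x) H \<Longrightarrow>
       (LINT x|lborel. g x * \<phi> x) = (LINT x|lborel. f x * (A x * h x - H x))"
proof -
  \<comment> \<open>\<open>lim\<close> makes \<open>L\<close> a function of \<phi> without a choice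
    of \<open>h\<close> and \<open>H\<close>, which exist for each Schwartz function and identify
    the limit.\<close>
  define L where "L = (\<lambda>\<phi>. lim (\<lambda>n. form (cutoff f n) \<phi>))"
  note c = cutoff_integrable[OF f M]
  have M0: "0 \<le> M" using order_trans[OF norm_ge_zero M[of 0]] .
  have lim_k: "(\<lambda>n. form (cutoff f n) \<phi>) \<longlonglongrightarrow> (LINT x|lborel. f x * (A x * h x - H x))"
    if \<phi>: "\<phi> \<in> schwartz" and h: "is_absD \<phi> h" and H: "is_absD (\<lambda>x. A x * \<phi> x) H" for \<phi> h H
  proof -
    have [measurable]: "h \<in> borel_measurable borel" "H \<in> borel_measurable borel" using h H by (auto simp: is_absD_def)
    have "(\<lambda>n. LINT x|lborel. cutoff f n x * (A x * h x - H x)) \<longlonglongrightarrow> (LINT x|lborel. f x * (A x * h x - H x))"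
    proof (rule integral_dominated_convergence)
      show "integrable lborel (\<lambda>x. M * norm (A x * h x - H x))"
        using commutator_integrable[OF \<phi> h H] by (intro integrable_mult_right integrable_norm)
      show "AE x in lborel. (\<lambda>n. cutoff f n x * (A x * h x - H x)) \<longlonglongrightarrow> f x * (A x * h x - H x)"
      proof (rule AE_I2)
        fix x
        show "(\<lambda>n. cutoff f n x * (A x * h x - H x)) \<longlonglongrightarrow> f x * (A x * h x - H x)"
          by (rule tendsto_eventually, rule eventually_mono[OF cutoff_eventually[of f x]]) simp
      qed
      show "AE x in lborel. norm (cutoff f n x * (A x * h x - H x)) \<le> M * norm (A x * h x - H x)" for n
        by (intro AE_I2) (simp add: norm_mult mult_right_mono c(2))
    qed measurable
    then show ?thesis by (simp only: form_is_absD[OF \<phi> c h H])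
  qed
  have conv: "(\<lambda>n. form (cutoff f n) \<phi>) \<longlonglongrightarrow> L \<phi>" if \<phi>: "\<phi> \<in> schwartz" for \<phi>
  proof -
    obtain h where "is_absD \<phi> h"
      using absD_exists[OF schwartz_L12[OF \<phi>] mA_ft_schwartz[OF \<phi>]] unfolding is_absD_def by metis
    moreover obtain H where "is_absD (\<lambda>x. A x * \<phi> x) H"
      using absD_exists[OF L12_mult_schwartz[OF A_sq \<phi>] mA_ft_A_schwartz[OF \<phi>]] unfolding is_absD_def by metis
    ultimately have "convergent (\<lambda>n. form (cutoff f n) \<phi>)" using lim_k[OF \<phi>] by (auto simp: convergent_def)
    then show ?thesis unfolding L_def by (simp only: convergent_LIMSEQ_iff)
  qed
  have cL: "L12 (cutoff f n)" for n by (rule L12_bounded[OF c])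
  have "\<exists>g. sq_int g \<and> sqrt (n2 g) \<le> 132 * M * sqrt (n2 B) \<and> (\<forall>\<phi>\<in>schwartz. (LINT x|lborel. g x * \<phi> x) = L \<phi>)"
  proof (rule Riesz_L2)
    fix \<phi> \<psi> :: "real \<Rightarrow> complex" and a :: complex
    assume \<phi>: "\<phi> \<in> schwartz"
    show "sq_int \<phi>" using schwartz_L12[OF \<phi>] by (simp add: L12_def)
    show "(\<lambda>x. a * \<phi> x) \<in> schwartz" by (rule schwartz_cmult[OF \<phi>])
    show "L (\<lambda>x. a * \<phi> x) = a * L \<phi>"
      using conv[OF schwartz_cmult[OF \<phi>]] tendsto_mult_left[OF conv[OF \<phi>], of a]
      unfolding form_cmult by (rule LIMSEQ_unique)
    show "norm (L \<phi>) \<le> 132 * M * sqrt (n2 B) * sqrt (n2 \<phi>)"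
      using tendsto_norm[OF conv[OF \<phi>]] by (rule Lim_bounded) (use form_bound[OF \<phi> c] in auto)
    assume \<psi>: "\<psi> \<in> schwartz"
    show "(\<lambda>x. \<phi> x + \<psi> x) \<in> schwartz" by (rule schwartz_add[OF \<phi> \<psi>])
    show "L (\<lambda>x. \<phi> x + \<psi> x) = L \<phi> + L \<psi>"
      using conv[OF schwartz_add[OF \<phi> \<psi>]] tendsto_add[OF conv[OF \<phi>] conv[OF \<psi>]]
      unfolding form_add[OF \<phi> \<psi> cL] by (rule LIMSEQ_unique)
  next
    show "(\<lambda>x. 0) \<in> schwartz" using schwartz_cmult[OF schwartz_gauss, of 0] by simp
  qed (use M0 in simp)
  then obtain g where g: "sq_int g" "sqrt (n2 g) \<le> 132 * M * sqrt (n2 B)" "\<And>\<phi>. \<phi> \<in> schwartz \<Longrightarrow> (LINT x|lborel. g x * \<phi> x) = L \<phi>" by auto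
  show ?thesis
  proof (rule that[OF g(1,2)])
    fix \<phi> h H assume \<phi>: "\<phi> \<in> schwartz" and "is_absD \<phi> h" "is_absD (\<lambda>x. A x * \<phi> x) H"
    from LIMSEQ_unique[OF conv[OF \<phi>] lim_k[OF this]]
    show "(LINT x|lborel. g x * \<phi> x) = (LINT x|lborel. f x * (A x * h x - H x))" using g(3)[OF \<phi>] by simp
  qed
qed

end

text \<open>The Poisson estimate and the truncation ask for a bound at every point rather than
  almost everywhere.\<close>

lemma Linf_borel_version:
  assumes f: "f \<in> Linf"
  obtains f' where "f' \<in> borel_measurable borel" "AE x in lebesgue. f x = f' x" "\<And>x. norm (f' x) \<le> Linf_norm f"
proof -
  define S where "S = esssup lebesgue (\<lambda>x. ereal (norm (f x)))"
  have fm: "f \<in> borel_measurable lebesgue" and fin: "S < \<infinity>" using f by (auto simp: Linf_def S_def)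
  have ae: "AE x in lebesgue. ereal (norm (f x)) \<le> S" unfolding S_def by (rule esssup_AE)
  \<comment> \<open>A negative essential supremum would make the real line a null set. Together with
    finiteness this ensures that \<open>real_of_ereal\<close> loses nothing.\<close>
  have S0: "0 \<le> S"
  proof (rule ccontr)
    assume neg: "\<not> 0 \<le> S"
    have "AE x::real in lebesgue. False"
      using ae
    proof eventually_elim
      case (elim x)
      then have "ereal (norm (f x)) < 0" using neg le_less_trans[of "ereal (norm (f x))" S 0] by (simp add: not_le)
      then show ?case by simp
    qed
    then have "AE x::real in lborel. False" by (simp only: AE_completion_iff)
    from AE_E2[OF this] show False by simp
  qed
  define M where "M = Linf_norm f"
  have SM: "S = ereal M" unfolding M_def Linf_norm_def S_def[symmetric] using fin S0 by (cases S) auto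
  have M0: "0 \<le> M" using S0 SM by simp
  obtain g where g [measurable]: "g \<in> borel_measurable borel" and gae: "AE x in lebesgue. f x = g x"
    by (rule lebesgue_borel_version[OF fm])
  define f' where "f' = (\<lambda>x. if norm (g x) \<le> M then g x else 0)"
  show ?thesis
  proof (rule that[of f'])
    show "f' \<in> borel_measurable borel" unfolding f'_def by measurable
    show "AE x in lebesgue. f x = f' x" using gae ae by eventually_elim (auto simp: f'_def SM)
    show "norm (f' x) \<le> Linf_norm f" for x using M0 by (simp add: f'_def M_def[symmetric])
  qed
qed

section \<open>Assembly of the estimate\<close>

lemma absD_pairingI:
  assumes h: "has_absD \<psi> h" "h \<in> borel_measurable borel"
    and u: "u \<in> borel_measurable lebesgue" "AE x in lebesgue. u x = u' x" "u' \<in> borel_measurable borel"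
    and i: "integrable lborel (\<lambda>x. u' x * h x)"
  shows "has_absD_pairing u \<psi> (LINT x|lborel. u' x * h x)"
  unfolding has_absD_pairing_def
  using h(1) lebesgue_pairing[OF u h(2)] i by (auto simp: has_bochner_integral_iff)

theorem lemma2p10:
  "\<exists>C>0. \<forall>A\<in>H1. \<forall>f\<in>Linf. \<exists>g.
     has_absD_commutator A f g \<and> L2_norm g \<le> C * H1_norm A * Linf_norm f"
proof (intro exI[of _ 132] conjI ballI)
  fix A f assume A: "A \<in> H1" and f: "f \<in> Linf"
  \<comment> \<open>The derivative chosen inside \<open>H1_norm\<close>, so that the final bound can
    be compared with that norm directly.\<close>
  define B where "B = (SOME B. has_weak_deriv A B)"
  have wd: "has_weak_deriv A B" using A unfolding H1_def B_def by (simp add: someI_ex)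
  then have AL: "A \<in> L2" and BL: "B \<in> L2" by (auto simp: has_weak_deriv_def)
  then have Am: "A \<in> borel_measurable lebesgue" and Bm: "B \<in> borel_measurable lebesgue" by (auto simp: L2_def)
  obtain A' where A'm: "A' \<in> borel_measurable borel" and A'ae: "AE x in lebesgue. A x = A' x" by (rule lebesgue_borel_version[OF Am])
  obtain B' where B'm: "B' \<in> borel_measurable borel" and B'ae: "AE x in lebesgue. B x = B' x" by (rule lebesgue_borel_version[OF Bm])
  note A' = L2D[OF AL A'm A'ae] and B' = L2D[OF BL B'm B'ae]
  have weak: "(LINT x|lborel. B' x * \<phi> x) = - (LINT x|lborel. A' x * vderiv \<phi> x)" if \<phi>: "\<phi> \<in> schwartz" for \<phi>
    using wd \<phi> lebesgue_pairing(2)[OF Bm B'ae B'm schwartz_measurable[OF \<phi>]]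
      lebesgue_pairing(2)[OF Am A'ae A'm schwartz_measurable[OF schwartz_vderiv[OF \<phi>]]]
    by (simp add: has_weak_deriv_def)
  obtain V where V: "fourier_L2 A' V" "fourier_L2 B' (\<lambda>\<xi>. \<i> * (complex_of_real \<xi> * V \<xi>))" "integrable lborel V"
    "sq_int (\<lambda>\<xi>. complex_of_real \<xi> * V \<xi>)" "n2 (\<lambda>\<xi>. complex_of_real \<xi> * V \<xi>) \<le> 2 * pi * n2 B'"
    by (rule H1_fourier[OF A'(1) B'(1) weak])
  interpret H1_function A' B' V
    by unfold_locales (use V in \<open>simp_all add: mX_def[abs_def]\<close>)
  obtain f' where f'm: "f' \<in> borel_measurable borel" and f'ae: "AE x in lebesgue. f x = f' x" and f'M: "\<And>x. norm (f' x) \<le> Linf_norm f"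
    using Linf_borel_version[OF f] by blast
  have fm: "f \<in> borel_measurable lebesgue" using f by (simp add: Linf_def)
  obtain g where g: "sq_int g" "sqrt (n2 g) \<le> 132 * Linf_norm f * sqrt (n2 B')"
    and gk: "\<And>\<phi> h H. \<phi> \<in> schwartz \<Longrightarrow> is_absD \<phi> h \<Longrightarrow> is_absD (\<lambda>x. A' x * \<phi> x) H \<Longrightarrow>
       (LINT x|lborel. g x * \<phi> x) = (LINT x|lborel. f' x * (A' x * h x - H x))"
    by (rule commutator_exists[OF f'm f'M]) blast
  have gm: "g \<in> borel_measurable borel" using g by auto
  note gL = L2I[OF borel_lebesgue[OF gm] _ g(1)]
  have "has_absD_commutator A f g"
    unfolding has_absD_commutator_def
  proof (intro conjI ballI)
    show "g \<in> L2" by (rule gL) simp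
    fix \<phi> assume \<phi>: "\<phi> \<in> schwartz"
    note \<phi>m = schwartz_measurable[OF \<phi>]
    obtain h where h: "is_absD \<phi> h" and ha: "has_absD \<phi> h"
    proof (rule absD_exists[OF schwartz_L12[OF \<phi>] mA_ft_schwartz[OF \<phi>]])
      fix h
      assume *: "sq_int h" "\<And>k. L12 k \<Longrightarrow> (LINT x|lborel. h x * k x) = complex_of_real (1 / (2 * pi)) * (LINT \<xi>|lborel. mA (ft \<phi>) (- \<xi>) * ft k \<xi>)"
        "\<And>u. u \<in> borel_measurable lebesgue \<Longrightarrow> AE x in lebesgue. u x = \<phi> x \<Longrightarrow> has_absD u h"
      show thesis by (rule that[of h]) (use * borel_lebesgue[OF \<phi>m] in \<open>auto simp: is_absD_def\<close>)
    qed
    have A\<phi>m: "(\<lambda>x. A x * \<phi> x) \<in> borel_measurable lebesgue" using Am borel_lebesgue[OF \<phi>m] by measurable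
    have A\<phi>ae: "AE x in lebesgue. A x * \<phi> x = A' x * \<phi> x" using A'ae by eventually_elim simp
    obtain H where H: "is_absD (\<lambda>x. A' x * \<phi> x) H" and Ha: "has_absD (\<lambda>x. A x * \<phi> x) H"
    proof (rule absD_exists[OF L12_mult_schwartz[OF A_sq \<phi>] mA_ft_A_schwartz[OF \<phi>]])
      fix h
      assume *: "sq_int h" "\<And>k. L12 k \<Longrightarrow> (LINT x|lborel. h x * k x) = complex_of_real (1 / (2 * pi)) * (LINT \<xi>|lborel. mA (ft (\<lambda>x. A' x * \<phi> x)) (- \<xi>) * ft k \<xi>)"
        "\<And>u. u \<in> borel_measurable lebesgue \<Longrightarrow> AE x in lebesgue. u x = A' x * \<phi> x \<Longrightarrow> has_absD u h"
      show thesis by (rule that[of h]) (use * A\<phi>m A\<phi>ae in \<open>auto simp: is_absD_def\<close>)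
    qed
    have h2: "sq_int h" and H2: "sq_int H" using h H by (auto simp: is_absD_def)
    have hm: "h \<in> borel_measurable borel" and Hm: "H \<in> borel_measurable borel" using h2 H2 by auto
    have bd: "integrable lborel (\<lambda>x. f' x * u x)" if u: "integrable lborel u" for u
    proof (rule Bochner_Integration.integrable_bound)
      show "integrable lborel (\<lambda>x. Linf_norm f * norm (u x))" using u by auto
      show "(\<lambda>x. f' x * u x) \<in> borel_measurable lborel" using f'm u by auto
      have "norm (f' x * u x) \<le> Linf_norm f * norm (u x)" for x by (simp add: norm_mult mult_right_mono f'M)
      then show "AE x in lborel. norm (f' x * u x) \<le> norm (Linf_norm f * norm (u x))"
        by (intro AE_I2) (metis abs_ge_self order_trans real_norm_def)
    qed
    have i1: "integrable lborel (\<lambda>x. f' x * (A' x * h x))" by (rule bd[OF sq_int_mult_integrable[OF A_sq h2]])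
    have i2: "integrable lborel (\<lambda>x. f' x * (A' x * h x - H x))" by (rule bd[OF commutator_integrable[OF \<phi> h H]])
    \<comment> \<open>\<open>H\<close> is merely in L^2 and \<open>f'\<close> merely bounded, so
      their product is not integrable for general reasons. It is the difference of \<open>i1\<close>
      and \<open>i2\<close>, and this is why the second pairing in the definition of the commutator
      exists.\<close>
    have i3: "integrable lborel (\<lambda>x. f' x * H x)"
      using Bochner_Integration.integrable_diff[OF i1 i2] by (simp add: algebra_simps)
    have i1': "integrable lborel (\<lambda>x. (A' x * f' x) * h x)" using i1 by (simp add: mult_ac)
    show "\<exists>a b. has_absD_pairing (\<lambda>x. A x * f x) \<phi> a \<and> has_absD_pairing f (\<lambda>x. A x * \<phi> x) b \<and> (LINT x|lebesgue. g x * \<phi> x) = a - b"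
    proof (intro exI conjI)
      show "has_absD_pairing (\<lambda>x. A x * f x) \<phi> (LINT x|lborel. (A' x * f' x) * h x)"
      proof (rule absD_pairingI[OF ha hm _ _ _ i1'])
        show "(\<lambda>x. A x * f x) \<in> borel_measurable lebesgue" using Am fm by measurable
        show "AE x in lebesgue. A x * f x = A' x * f' x" using A'ae f'ae by eventually_elim simp
        show "(\<lambda>x. A' x * f' x) \<in> borel_measurable borel" using A'm f'm by measurable
      qed
      show "has_absD_pairing f (\<lambda>x. A x * \<phi> x) (LINT x|lborel. f' x * H x)"
        by (rule absD_pairingI[OF Ha Hm fm f'ae f'm i3])
      have "(LINT x|lebesgue. g x * \<phi> x) = (LINT x|lborel. g x * \<phi> x)"
        by (rule lebesgue_pairing[OF borel_lebesgue[OF gm] _ gm \<phi>m]) simp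
      also have "\<dots> = (LINT x|lborel. f' x * (A' x * h x - H x))" by (rule gk[OF \<phi> h H])
      also have "\<dots> = (LINT x|lborel. (A' x * f' x) * h x - f' x * H x)"
        by (intro Bochner_Integration.integral_cong refl) (simp add: algebra_simps)
      also have "\<dots> = (LINT x|lborel. (A' x * f' x) * h x) - (LINT x|lborel. f' x * H x)"
        by (rule Bochner_Integration.integral_diff[OF i1' i3])
      finally show "(LINT x|lebesgue. g x * \<phi> x) = (LINT x|lborel. (A' x * f' x) * h x) - (LINT x|lborel. f' x * H x)" .
    qed
  qed
  moreover have "L2_norm g \<le> 132 * H1_norm A * Linf_norm f"
  proof -
    \<comment> \<open>The estimate is by the derivative of A alone, one of the two summands under
      the root.\<close>
    have "L2_norm B \<le> H1_norm A"
      unfolding H1_norm_def B_def[symmetric] by (intro real_le_rsqrt) simp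
    then have "132 * Linf_norm f * sqrt (n2 B') \<le> 132 * Linf_norm f * H1_norm A"
      using order_trans[OF norm_ge_zero f'M[of 0]] unfolding B'(2) by (intro mult_left_mono) auto
    then show ?thesis using g(2) gL(2) by (simp add: mult_ac)
  qed
  ultimately show "\<exists>g. has_absD_commutator A f g \<and> L2_norm g \<le> 132 * H1_norm A * Linf_norm f" by blast
qed simp

end
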